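(* Let $(\Omega,\Sigma)$ be a non-trivial measurable space, with $\Sigma$ a $\sigma$-algebra, and let $X$ be a Banach space over $\mathbb{K}\in\{\mathbb{R},\mathbb{C}\}$, which is assumed infinite-dimensional except in (1). The following statements hold. (1) If $X\neq\{0\}$ ($X$ not necessarily infinite-dimensional), then $ba(\Sigma,X)$ always has a separable quotient. (2) If $X\supset c_{0}$, then $ba(\Sigma,X)$ has a quotient isomorphic to $\ell_{2}$. (3) If $X\supset c_{0}$ but $X\not\supset\ell_{\infty}$, then $ba(\Sigma,X)$ has a complemented copy of $c_{0}$. (4) If $\Sigma$ admits no atomless probability measure, then $ca(\Sigma,X)$ has a quotient isomorphic to $\ell_{1}$. (5) If $X\supset c_{0}$ and $\Sigma$ admits a nonzero atomless $\lambda\in ca^{+}(\Sigma)$, then $ca(\Sigma,X)$ has a quotient isomorphic to $\ell_{2}$. (6) If there exists some $F\in cca(\Sigma,X)$ of unbounded variation, then $cca(\Sigma,X)$ has a separable quotient. (7) If $X\supset c_{0}$, then $cca(\Sigma,X)$ contains a complemented copy of $c_{0}$. (8) If $X\supset\ell_{1}$, then $\mathcal{M}_{1}(\Sigma,X)$ has a quotient isomorphic to $\ell_{1}$.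
   Context: $(\Omega,\Sigma)$ is non-trivial if $\Sigma$ contains infinitely many pairwise disjoint (nonempty) sets. $ba(\Sigma,X)$ is the Banach space of all bounded finitely additive measures $F:\Sigma\to X$ with the semivariation norm. $ca(\Sigma,X)$ is its closed linear subspace of countably additive measures, and $cca(\Sigma,X)$ is the closed linear subspace of $ca(\Sigma,X)$ of all measures with relatively compact range. $bvca(\Sigma,X)$ is the Banach space of all countably additive measures $F:\Sigma\to X$ of bounded variation with the variation norm $|F|$. $ca^{+}(\Sigma)$ is the set of positive finite (countably additive) measures on $\Sigma$. $\mathcal{M}_{1}(\Sigma,X)$ is the closed linear subspace of $bvca(\Sigma,X)$ of all $F\in bvca(\Sigma,X)$ having the Radon-Nikodým property, i.e. such that for each $\lambda\in ca^{+}(\Sigma)$ with $F\ll\lambda$ there exists $f\in L_{1}(\lambda,X)$ (Bochner integrable) with $F(E)=\int_{E}f\,d\lambda$ for every $E\in\Sigma$. $E\supset Z$ (resp. $E\not\supset Z$) means that $E$ contains (resp. does not contain) an isomorphic copy of $Z$; a copy is complemented if it is the range of a bounded linear projection. A Banach space $E$ has a separable quotient if $E/M$ is infinite-dimensional and separable for some closed linear subspace $M$. *)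

theory Defs
  imports "HOL-Analysis.Analysis" "HOL-Probability.Probability_Measure"
begin

section \<open>The scalar field\<close>

text \<open>
  The types of this class are exactly the isometric copies of the real and of the complex field, so
  that a type variable of this class ranges over the two possible scalar fields.
\<close>

class real_or_complex = real_normed_field +
  assumes real_or_complex:
    "(\<forall>z. \<exists>a. z = scaleR a 1) \<or>
     (\<exists>i. i * i = - 1 \<and>
       (\<forall>z. \<exists>a b. z = scaleR a 1 + scaleR b i \<and> norm z = sqrt (a\<^sup>2 + b\<^sup>2)))"

instance real :: real_or_complex
  by standard auto

instance complex :: real_or_complex
proof
  have "\<exists>a b. z = scaleR a 1 + scaleR b \<i> \<and> norm z = sqrt (a\<^sup>2 + b\<^sup>2)" for z :: complex
    by (rule exI[of _ "Re z"], rule exI[of _ "Im z"]) (simp add: complex_eq_iff cmod_def)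
  then show "(\<forall>z::complex. \<exists>a. z = scaleR a 1) \<or>
     (\<exists>i::complex. i * i = - 1 \<and>
       (\<forall>z. \<exists>a b. z = scaleR a 1 + scaleR b i \<and> norm z = sqrt (a\<^sup>2 + b\<^sup>2)))"
    by (intro disjI2 exI[of _ \<i>]) auto
qed

text \<open>
  A Banach space over \<open>'k\<close>: a real Banach space whose multiplication by real scalars is extended
  to \<open>'k\<close> in a way compatible with the norm.
\<close>

locale banach_space_over = vector_space smul
  for smul :: "'k::real_or_complex \<Rightarrow> 'x::banach \<Rightarrow> 'x" +
  assumes norm_scale: "norm (smul c x) = norm c * norm x"
    and scale_of_real: "smul (of_real r) x = scaleR r x"


section \<open>Normed spaces with explicit carrier\<close>

record ('k, 'v) nspace =
  vcarrier :: "'v set"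
  vadd :: "'v \<Rightarrow> 'v \<Rightarrow> 'v"
  vzero :: "'v"
  vscale :: "'k \<Rightarrow> 'v \<Rightarrow> 'v"
  vnorm :: "'v \<Rightarrow> real"

definition type_nspace :: "('k \<Rightarrow> 'x \<Rightarrow> 'x) \<Rightarrow> ('k, 'x::real_normed_vector) nspace" where
  "type_nspace smul =
     \<lparr>vcarrier = UNIV, vadd = (+), vzero = 0, vscale = smul, vnorm = norm\<rparr>"

definition fun_nspace ::
    "('k \<Rightarrow> 'x \<Rightarrow> 'x) \<Rightarrow> ('i \<Rightarrow> 'x) set \<Rightarrow> (('i \<Rightarrow> 'x) \<Rightarrow> real)
      \<Rightarrow> ('k, 'i \<Rightarrow> 'x::ab_group_add) nspace" where
  "fun_nspace smul V N =
     \<lparr>vcarrier = V, vadd = (\<lambda>F G i. F i + G i), vzero = (\<lambda>i. 0),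
      vscale = (\<lambda>c F i. smul c (F i)), vnorm = N\<rparr>"

definition vdist :: "('k::real_or_complex, 'v) nspace \<Rightarrow> 'v \<Rightarrow> 'v \<Rightarrow> real" where
  "vdist E x y = vnorm E (vadd E x (vscale E (- 1) y))"

definition linear_subspace :: "('k, 'v) nspace \<Rightarrow> 'v set \<Rightarrow> bool" where
  "linear_subspace E M \<longleftrightarrow> M \<subseteq> vcarrier E \<and> vzero E \<in> M \<and>
     (\<forall>x\<in>M. \<forall>y\<in>M. vadd E x y \<in> M) \<and> (\<forall>c. \<forall>x\<in>M. vscale E c x \<in> M)"

definition closed_subspace :: "('k::real_or_complex, 'v) nspace \<Rightarrow> 'v set \<Rightarrow> bool" where
  "closed_subspace E M \<longleftrightarrow> linear_subspace E M \<and>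
     (\<forall>x\<in>vcarrier E. (\<forall>e>0. \<exists>m\<in>M. vdist E x m < e) \<longrightarrow> x \<in> M)"

definition lin_span :: "('k, 'v) nspace \<Rightarrow> 'v set \<Rightarrow> 'v set" where
  "lin_span E B = \<Inter>{M. linear_subspace E M \<and> B \<subseteq> M}"

definition infinite_dimensional :: "('k, 'v) nspace \<Rightarrow> bool" where
  "infinite_dimensional E \<longleftrightarrow>
     \<not> (\<exists>B. finite B \<and> B \<subseteq> vcarrier E \<and> lin_span E B = vcarrier E)"

definition separable :: "('k::real_or_complex, 'v) nspace \<Rightarrow> bool" where
  "separable E \<longleftrightarrow> (\<exists>D. countable D \<and> D \<subseteq> vcarrier E \<and>
     (\<forall>x\<in>vcarrier E. \<forall>e>0. \<exists>d\<in>D. vdist E x d < e))"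

definition bounded_operator ::
    "('k, 'v) nspace \<Rightarrow> ('k, 'w) nspace \<Rightarrow> ('v \<Rightarrow> 'w) \<Rightarrow> bool" where
  "bounded_operator E F T \<longleftrightarrow>
     (\<forall>x\<in>vcarrier E. T x \<in> vcarrier F) \<and>
     (\<forall>x\<in>vcarrier E. \<forall>y\<in>vcarrier E. T (vadd E x y) = vadd F (T x) (T y)) \<and>
     (\<forall>c. \<forall>x\<in>vcarrier E. T (vscale E c x) = vscale F c (T x)) \<and>
     (\<exists>C. \<forall>x\<in>vcarrier E. vnorm F (T x) \<le> C * vnorm E x)"

definition isomorphic_nspace :: "('k, 'v) nspace \<Rightarrow> ('k, 'w) nspace \<Rightarrow> bool" where
  "isomorphic_nspace E F \<longleftrightarrow>
     (\<exists>T S. bounded_operator E F T \<and> bounded_operator F E S \<and>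
        (\<forall>x\<in>vcarrier E. S (T x) = x) \<and> (\<forall>y\<in>vcarrier F. T (S y) = y))"

definition contains_copy :: "('k, 'v) nspace \<Rightarrow> ('k, 'w) nspace \<Rightarrow> bool" where
  "contains_copy E Z \<longleftrightarrow>
     (\<exists>M. linear_subspace E M \<and> isomorphic_nspace (E\<lparr>vcarrier := M\<rparr>) Z)"

definition contains_complemented_copy :: "('k, 'v) nspace \<Rightarrow> ('k, 'w) nspace \<Rightarrow> bool" where
  "contains_complemented_copy E Z \<longleftrightarrow>
     (\<exists>M P. linear_subspace E M \<and> isomorphic_nspace (E\<lparr>vcarrier := M\<rparr>) Z \<and>
        bounded_operator E E P \<and> (\<forall>x\<in>vcarrier E. P (P x) = P x) \<and> P ` vcarrier E = M)"

text \<open>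
  The elements of the quotient are the cosets \<open>x + M\<close>. Adding \<open>M\<close> in the scalar multiplication
  only matters for the scalar \<open>0\<close>, where the product has to be the coset \<open>M\<close> instead of \<open>{0}\<close>.
\<close>

definition quotient_nspace :: "('k, 'v) nspace \<Rightarrow> 'v set \<Rightarrow> ('k, 'v set) nspace" where
  "quotient_nspace E M =
     \<lparr>vcarrier = (\<lambda>x. vadd E x ` M) ` vcarrier E,
      vadd = (\<lambda>A B. {vadd E a b | a b. a \<in> A \<and> b \<in> B}),
      vzero = M,
      vscale = (\<lambda>c A. {vadd E (vscale E c a) m | a m. a \<in> A \<and> m \<in> M}),
      vnorm = (\<lambda>A. INF a\<in>A. vnorm E a)\<rparr>"

definition has_separable_quotient :: "('k::real_or_complex, 'v) nspace \<Rightarrow> bool" where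
  "has_separable_quotient E \<longleftrightarrow>
     (\<exists>M. closed_subspace E M \<and> infinite_dimensional (quotient_nspace E M) \<and>
        separable (quotient_nspace E M))"

definition has_quotient_isomorphic_to ::
    "('k::real_or_complex, 'v) nspace \<Rightarrow> ('k, 'w) nspace \<Rightarrow> bool" where
  "has_quotient_isomorphic_to E Z \<longleftrightarrow>
     (\<exists>M. closed_subspace E M \<and> isomorphic_nspace (quotient_nspace E M) Z)"


section \<open>Classical sequence spaces\<close>

definition c0_space :: "('k::real_or_complex, nat \<Rightarrow> 'k) nspace" where
  "c0_space = fun_nspace (*) {x. x \<longlonglongrightarrow> 0} (\<lambda>x. SUP n. norm (x n))"

definition l1_space :: "('k::real_or_complex, nat \<Rightarrow> 'k) nspace" where
  "l1_space = fun_nspace (*) {x. summable (\<lambda>n. norm (x n))} (\<lambda>x. \<Sum>n. norm (x n))"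

definition l2_space :: "('k::real_or_complex, nat \<Rightarrow> 'k) nspace" where
  "l2_space =
     fun_nspace (*) {x. summable (\<lambda>n. (norm (x n))\<^sup>2)} (\<lambda>x. sqrt (\<Sum>n. (norm (x n))\<^sup>2))"

definition linf_space :: "('k::real_or_complex, nat \<Rightarrow> 'k) nspace" where
  "linf_space = fun_nspace (*) {x. bounded (range x)} (\<lambda>x. SUP n. norm (x n))"


section \<open>Vector measures\<close>

definition nontrivial_sigma_algebra :: "'a set set \<Rightarrow> bool" where
  "nontrivial_sigma_algebra S \<longleftrightarrow> (\<exists>D. D \<subseteq> S \<and> infinite D \<and> disjoint D \<and> {} \<notin> D)"

definition variation :: "'a set set \<Rightarrow> ('a set \<Rightarrow> 'b::real_normed_vector) \<Rightarrow> 'a set \<Rightarrow> ennreal" where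
  "variation S F E = (SUP P\<in>{P. finite P \<and> P \<subseteq> S \<and> partition_on E P}. \<Sum>A\<in>P. ennreal (norm (F A)))"

definition dual_unit_ball ::
    "('k::real_or_complex \<Rightarrow> 'x::real_normed_vector \<Rightarrow> 'x) \<Rightarrow> ('x \<Rightarrow> 'k) set" where
  "dual_unit_ball smul =
     {\<phi>. Vector_Spaces.linear smul (*) \<phi> \<and> (\<forall>x. norm (\<phi> x) \<le> norm x)}"

definition semivariation ::
    "('k::real_or_complex \<Rightarrow> 'x::real_normed_vector \<Rightarrow> 'x) \<Rightarrow> 'a set set \<Rightarrow>
      ('a set \<Rightarrow> 'x) \<Rightarrow> 'a set \<Rightarrow> ennreal" where
  "semivariation smul S F E = (SUP \<phi>\<in>dual_unit_ball smul. variation S (\<phi> \<circ> F) E)"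

text \<open>
  A measure on the sets in \<open>S\<close> is represented by the function that is moreover \<open>0\<close> at all other
  sets, so that equality of measures is equality of functions.
\<close>

definition ba_measures :: "'a set set \<Rightarrow> ('a set \<Rightarrow> 'x::real_normed_vector) set" where
  "ba_measures S = {F. (\<forall>E. E \<notin> S \<longrightarrow> F E = 0) \<and>
     (\<forall>A\<in>S. \<forall>B\<in>S. A \<inter> B = {} \<longrightarrow> F (A \<union> B) = F A + F B) \<and> bounded (F ` S)}"

definition ca_measures :: "'a set set \<Rightarrow> ('a set \<Rightarrow> 'x::real_normed_vector) set" where
  "ca_measures S = {F \<in> ba_measures S.
     \<forall>A. range A \<subseteq> S \<longrightarrow> disjoint_family A \<longrightarrow> (\<lambda>n::nat. F (A n)) sums F (\<Union>n. A n)}"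

definition cca_measures :: "'a set set \<Rightarrow> ('a set \<Rightarrow> 'x::real_normed_vector) set" where
  "cca_measures S = {F \<in> ca_measures S. compact (closure (F ` S))}"

definition bvca_measures :: "'a set \<Rightarrow> 'a set set \<Rightarrow> ('a set \<Rightarrow> 'x::real_normed_vector) set" where
  "bvca_measures \<Omega> S = {F \<in> ca_measures S. variation S F \<Omega> < \<infinity>}"

definition ca_pos :: "'a set \<Rightarrow> 'a set set \<Rightarrow> 'a measure set" where
  "ca_pos \<Omega> S = {M. space M = \<Omega> \<and> sets M = S \<and> finite_measure M}"

definition atomless :: "'a measure \<Rightarrow> bool" where
  "atomless M \<longleftrightarrow> (\<forall>A\<in>sets M. emeasure M A > 0 \<longrightarrow>
     (\<exists>B\<in>sets M. B \<subseteq> A \<and> 0 < emeasure M B \<and> emeasure M B < emeasure M A))"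

text \<open>
  The Bochner integral of the library is restricted to second countable codomains. Here it is
  without this restriction; the approximation by simple functions enforces strong measurability.
\<close>

definition has_gen_bochner_integral ::
    "'a measure \<Rightarrow> ('a \<Rightarrow> 'x::real_normed_vector) \<Rightarrow> 'x \<Rightarrow> bool" where
  "has_gen_bochner_integral M f x \<longleftrightarrow> f \<in> borel_measurable M \<and>
     (\<exists>s. (\<forall>i. Bochner_Integration.simple_bochner_integrable M (s i)) \<and>
        (\<lambda>i. \<integral>\<^sup>+\<omega>. ennreal (norm (f \<omega> - s i \<omega>)) \<partial>M) \<longlonglongrightarrow> 0 \<and>
        (\<lambda>i. Bochner_Integration.simple_bochner_integral M (s i)) \<longlonglongrightarrow> x)"

lemma has_gen_bochner_integral_eq:
  fixes f :: "'a \<Rightarrow> 'x::{real_normed_vector, second_countable_topology}"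
  shows "has_gen_bochner_integral M f x \<longleftrightarrow> has_bochner_integral M f x"
  by (auto simp: has_gen_bochner_integral_def has_bochner_integral.simps)

definition gen_bochner_integrable :: "'a measure \<Rightarrow> ('a \<Rightarrow> 'x::real_normed_vector) \<Rightarrow> bool" where
  "gen_bochner_integrable M f \<longleftrightarrow> (\<exists>x. has_gen_bochner_integral M f x)"

definition abs_cont :: "('a set \<Rightarrow> 'x::real_normed_vector) \<Rightarrow> 'a measure \<Rightarrow> bool" where
  "abs_cont F M \<longleftrightarrow> (\<forall>E\<in>null_sets M. F E = 0)"

definition radon_nikodym_measures ::
    "'a set \<Rightarrow> 'a set set \<Rightarrow> ('a set \<Rightarrow> 'x::real_normed_vector) set" where
  "radon_nikodym_measures \<Omega> S = {F \<in> bvca_measures \<Omega> S.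
     \<forall>M\<in>ca_pos \<Omega> S. abs_cont F M \<longrightarrow>
       (\<exists>f. gen_bochner_integrable M f \<and>
          (\<forall>E\<in>S. has_gen_bochner_integral M (\<lambda>\<omega>. indicator E \<omega> *\<^sub>R f \<omega>) (F E)))}"

definition ba_space ::
    "('k::real_or_complex \<Rightarrow> 'x::banach \<Rightarrow> 'x) \<Rightarrow> 'a set \<Rightarrow> 'a set set
      \<Rightarrow> ('k, 'a set \<Rightarrow> 'x) nspace" where
  "ba_space smul \<Omega> S =
     fun_nspace smul (ba_measures S) (\<lambda>F. enn2real (semivariation smul S F \<Omega>))"

definition ca_space ::
    "('k::real_or_complex \<Rightarrow> 'x::banach \<Rightarrow> 'x) \<Rightarrow> 'a set \<Rightarrow> 'a set set
      \<Rightarrow> ('k, 'a set \<Rightarrow> 'x) nspace" where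
  "ca_space smul \<Omega> S = (ba_space smul \<Omega> S)\<lparr>vcarrier := ca_measures S\<rparr>"

definition cca_space ::
    "('k::real_or_complex \<Rightarrow> 'x::banach \<Rightarrow> 'x) \<Rightarrow> 'a set \<Rightarrow> 'a set set
      \<Rightarrow> ('k, 'a set \<Rightarrow> 'x) nspace" where
  "cca_space smul \<Omega> S = (ba_space smul \<Omega> S)\<lparr>vcarrier := cca_measures S\<rparr>"

definition bvca_space ::
    "('k::real_or_complex \<Rightarrow> 'x::banach \<Rightarrow> 'x) \<Rightarrow> 'a set \<Rightarrow> 'a set set
      \<Rightarrow> ('k, 'a set \<Rightarrow> 'x) nspace" where
  "bvca_space smul \<Omega> S =
     fun_nspace smul (bvca_measures \<Omega> S) (\<lambda>F. enn2real (variation S F \<Omega>))"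

definition M1_space ::
    "('k::real_or_complex \<Rightarrow> 'x::banach \<Rightarrow> 'x) \<Rightarrow> 'a set \<Rightarrow> 'a set set
      \<Rightarrow> ('k, 'a set \<Rightarrow> 'x) nspace" where
  "M1_space smul \<Omega> S = (bvca_space smul \<Omega> S)\<lparr>vcarrier := radon_nikodym_measures \<Omega> S\<rparr>"

end

theory Submission
  imports Defs "HOL-Library.Function_Algebras"
begin

text \<open>
  Fix disjoint nonempty sets \<open>D n\<close> in the \<open>\<sigma>\<close>-algebra and points \<open>w n\<close> in \<open>D n\<close>.

  \<^bold>\<open>Quotients isomorphic to \<open>\<ell>\<^sub>1\<close>, and separable quotients.\<close> Let \<open>\<phi>\<close> be a functional with \<open>\<phi> u = 1\<close>. A
  bounded scalar measure has finite variation, so \<open>F \<mapsto> (\<phi> (F (D n)))\<^sub>n\<close> is a bounded operator into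
  \<open>\<ell>\<^sub>1\<close>. It is onto, because the measure \<open>\<Sum>n a n \<delta>\<^bsub>w n\<^esub>\<close> in the direction \<open>u\<close> is a preimage of \<open>a\<close> with
  norm at most a multiple of \<open>\<parallel>a\<parallel>\<^sub>1\<close>. These measures are countably additive, have relatively compact range
  and bounded variation, and have the Radon-Nikodym property. Hence the operator is onto on each of
  the four spaces of measures. Since \<open>\<ell>\<^sub>1\<close> is separable and infinite-dimensional, it also yields the
  separable quotients. What takes work for the Radon-Nikodym property is that the measures having it
  form a linear space: the summands of a measure absolutely continuous with respect to \<open>\<lambda>\<close> need not be
  absolutely continuous themselves (lemma \<open>radon_nikodym_add\<close>).

  \<^bold>\<open>Complemented copies of \<open>c\<^sub>0\<close>.\<close> Let \<open>J\<close> be an isomorphism of \<open>c\<^sub>0\<close> into \<open>X\<close>, and extend the coordinate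
  functionals of its range to functionals \<open>\<psi> n\<close> on \<open>X\<close> by the Hahn-Banach theorem. The measures
  \<open>\<Sum>n a n J(e n) \<delta>\<^bsub>w n\<^esub>\<close> with \<open>a\<close> in \<open>c\<^sub>0\<close> form a copy of \<open>c\<^sub>0\<close>, and \<open>F \<mapsto> (\<psi> n (F (D n)))\<^sub>n\<close> inverts this
  embedding. It maps into \<open>c\<^sub>0\<close> if \<open>F (D n)\<close> tends to zero (lemma \<open>complemented_c0\<close>). This is clear for
  countably additive measures. For finitely additive ones it is the theorem of Diestel and Faires: by
  Rosenthal's disjointification lemma, a measure bounded away from zero along a disjoint sequence
  embeds \<open>\<ell>\<^sub>\<infinity>\<close> into \<open>X\<close> through its integral (lemma \<open>ba_disjoint_null\<close>).

  \<^bold>\<open>Quotients isomorphic to \<open>\<ell>\<^sub>2\<close>.\<close> Suppose that scalar measures \<open>\<nu> n\<close> tend to zero at each set, but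
  \<open>\<nu> n (A n)\<close> is a nonzero constant for suitable sets \<open>A n\<close>. Then the diagonal measures
  \<open>E \<mapsto> J (a n \<nu> n E)\<^sub>n\<close>, for bounded sequences \<open>a\<close>, and the evaluations \<open>F \<mapsto> (\<psi> n (F (A n)))\<^sub>n\<close> exhibit
  \<open>\<ell>\<^sub>\<infinity>\<close> as a quotient, and \<open>\<ell>\<^sub>2\<close> is a quotient of \<open>\<ell>\<^sub>\<infinity>\<close> (lemma \<open>quotient_operator_l2\<close>). An operator from
  \<open>\<ell>\<^sub>\<infinity>\<close> onto \<open>\<ell>\<^sub>2\<close> takes the Rademacher coefficients of a bounded sequence on larger and larger finite
  cubes and passes to a limit along an ultrafilter; it is bounded by Bessel's inequality, and
  Riesz products give bounded preimages (lemma \<open>to_l2_lift\<close>). For \<open>\<nu> n\<close> one takes, among the finitely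
  additive measures, the coordinates of this operator on indicators of sets of indices \<open>j\<close> with \<open>w j\<close> in
  the given set; among the countably additive ones, the indefinite integrals of the Rademacher functions
  of an atomless measure, whose convergence to zero is an energy argument (lemma \<open>rad_tendsto_0\<close>).
\<close>


section \<open>The scalar field\<close>

text \<open>
  The class allows only the real and the complex field, so a scalar can be pushed isometrically
  into the complex numbers. This makes real and imaginary parts available uniformly, and all
  compactness and separability facts about scalars can be pulled back from there.
\<close>

definition scalar_embedding :: "('k::real_or_complex \<Rightarrow> complex) \<Rightarrow> bool" where
  "scalar_embedding \<iota> \<longleftrightarrow> (\<forall>x y. \<iota> (x + y) = \<iota> x + \<iota> y) \<and> (\<forall>x y. \<iota> (x * y) = \<iota> x * \<iota> y) \<and>
     (\<forall>r. \<iota> (of_real r) = of_real r) \<and> (\<forall>z. norm (\<iota> z) = norm z) \<and>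
     (surj \<iota> \<or> range \<iota> \<subseteq> \<real>)"

lemma ex_scalar_embedding: "\<exists>\<iota> :: 'k::real_or_complex \<Rightarrow> complex. scalar_embedding \<iota>"
proof (cases "\<forall>z::'k. \<exists>a. z = scaleR a 1")
  case True
  then obtain re :: "'k \<Rightarrow> real" where re: "\<And>z. z = of_real (re z)"
    unfolding of_real_def by metis
  have *: "re (of_real a) = a" for a
    using re[of "of_real a"] of_real_eq_iff by metis
  have "re (x + y) = re x + re y" "re (x * y) = re x * re y" for x y
    using re[of x] re[of y] * by (metis of_real_add, metis of_real_mult)
  moreover have "norm z = \<bar>re z\<bar>" for z
    using re[of z] by (metis norm_of_real)
  ultimately have "scalar_embedding (\<lambda>z. complex_of_real (re z))"
    unfolding scalar_embedding_def using * by auto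
  then show ?thesis by blast
next
  case False
  then obtain i :: 'k where i: "i * i = - 1"
      and ex: "\<And>z::'k. \<exists>a b. z = scaleR a 1 + scaleR b i \<and> norm z = sqrt (a\<^sup>2 + b\<^sup>2)"
    using real_or_complex[where 'a='k] by blast
  obtain f g where fg: "\<And>z. z = of_real (f z) + of_real (g z) * i"
      and nfg: "\<And>z. norm z = sqrt ((f z)\<^sup>2 + (g z)\<^sup>2)"
    using ex unfolding of_real_def by (metis mult_scaleR_left mult_1)
  \<comment> \<open>The element \<open>i\<close> is not real, as its square is negative; hence coordinates are unique.\<close>
  have unique0: "b = 0" if "of_real a + of_real b * i = (0::'k)" for a b
  proof (rule ccontr)
    assume b: "b \<noteq> 0"
    have "of_real b * i = - (of_real a :: 'k)"
      using that by (simp add: eq_neg_iff_add_eq_0 add.commute)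
    then have "i = of_real (- a / b)"
      using b by (simp add: field_simps)
    then have "of_real ((- a / b) * (- a / b)) = (of_real (- 1) :: 'k)"
      using i by (metis of_real_1 of_real_minus of_real_mult)
    then have "(- a / b) * (- a / b) = - 1"
      using of_real_eq_iff by blast
    then show False
      by (metis neg_0_le_iff_le not_one_le_zero zero_le_square)
  qed
  have unique: "a = c \<and> b = d"
    if "of_real a + of_real b * i = of_real c + (of_real d * i :: 'k)" for a b c d
  proof -
    have "of_real (a - c) + of_real (b - d) * i = (0::'k)"
      using that by (simp add: algebra_simps)
    then have "b = d" using unique0 by fastforce
    then show ?thesis using that by simp
  qed
  have coords: "f (of_real a + of_real b * i) = a" "g (of_real a + of_real b * i) = b" for a b
    using fg[of "of_real a + of_real b * i"] unique by metis+
  let ?\<iota> = "\<lambda>z. Complex (f z) (g z)"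
  have add: "f (x + y) = f x + f y \<and> g (x + y) = g x + g y" for x y
  proof -
    have "x + y = of_real (f x + f y) + of_real (g x + g y) * i"
      by (subst (1) fg[of x], subst (1) fg[of y]) (simp add: algebra_simps)
    then show ?thesis using coords by metis
  qed
  have mult: "f (x * y) = f x * f y - g x * g y \<and> g (x * y) = f x * g y + g x * f y" for x y
  proof -
    have "x * y = of_real (f x * f y) + of_real (f x * g y + g x * f y) * i
        + of_real (g x * g y) * (i * i)"
      by (subst (1) fg[of x], subst (1) fg[of y]) (simp add: algebra_simps)
    also have "\<dots> = of_real (f x * f y - g x * g y) + of_real (f x * g y + g x * f y) * i"
      by (simp add: i)
    finally show ?thesis using coords by metis
  qed
  have real: "f (of_real r) = r \<and> g (of_real r) = 0" for r
    using coords[of r 0] by simp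
  have "surj ?\<iota>"
  proof (rule surjI)
    show "?\<iota> (of_real (Re w) + of_real (Im w) * i) = w" for w
      by (simp add: coords)
  qed
  then have "scalar_embedding ?\<iota>"
    unfolding scalar_embedding_def
    by (simp add: add mult real nfg complex_eq_iff cmod_def)
  then show ?thesis by blast
qed

definition to_complex :: "'k::real_or_complex \<Rightarrow> complex" where
  "to_complex = (SOME \<iota>. scalar_embedding \<iota>)"

lemma scalar_embedding_to_complex:
  "scalar_embedding (to_complex :: 'k::real_or_complex \<Rightarrow> complex)"
  unfolding to_complex_def using ex_scalar_embedding by (rule someI_ex)

lemma to_complex_simps [simp]:
  "to_complex (x + y) = to_complex x + to_complex y"
  "to_complex (x * y) = to_complex x * to_complex y"
  "to_complex (of_real r) = of_real r"
  "norm (to_complex z) = norm z"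
  using scalar_embedding_to_complex unfolding scalar_embedding_def by blast+

lemma to_complex_real_or_surj:
  "surj (to_complex :: 'k \<Rightarrow> complex) \<or> range (to_complex :: 'k::real_or_complex \<Rightarrow> complex) \<subseteq> \<real>"
  using scalar_embedding_to_complex unfolding scalar_embedding_def by blast

lemma to_complex_0_1 [simp]: "to_complex 0 = 0" "to_complex 1 = 1"
  using to_complex_simps(3)[of 0] to_complex_simps(3)[of 1] by simp_all

lemma to_complex_minus [simp]: "to_complex (- x) = - to_complex x"
  using to_complex_simps(1)[of x "- x"] by (simp add: eq_neg_iff_add_eq_0 add.commute)

lemma to_complex_diff [simp]: "to_complex (x - y) = to_complex x - to_complex y"
  using to_complex_simps(1)[of x "- y"] by simp

lemma to_complex_inj: "to_complex x = to_complex y \<longleftrightarrow> x = y"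
  by (metis eq_iff_diff_eq_0 norm_eq_zero to_complex_diff to_complex_simps(4))

lemma to_complex_sum [simp]: "to_complex (sum f A) = (\<Sum>x\<in>A. to_complex (f x))"
  by (induction A rule: infinite_finite_induct) auto

lemma linear_to_complex: "linear to_complex"
  by (rule linearI) (auto simp: scaleR_conv_of_real)

lemma dist_to_complex [simp]: "dist (to_complex x) (to_complex y) = dist x y"
  by (metis dist_norm to_complex_diff to_complex_simps(4))

lemma closed_range_to_complex: "closed (range (to_complex :: 'k::real_or_complex \<Rightarrow> complex))"
proof (cases "surj (to_complex :: 'k \<Rightarrow> complex)")
  case True
  then show ?thesis by simp
next
  case False
  then have "range (to_complex :: 'k \<Rightarrow> complex) \<subseteq> \<real>"
    using to_complex_real_or_surj by blast
  moreover have "\<real> \<subseteq> range (to_complex :: 'k \<Rightarrow> complex)"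
    by (metis Reals_cases rangeI subsetI to_complex_simps(3))
  ultimately show ?thesis
    by (metis closed_complex_Reals subset_antisym)
qed

lemma compact_cball_scalar: "compact (cball (0::'k::real_or_complex) r)"
proof -
  let ?K = "range (to_complex :: 'k \<Rightarrow> complex) \<inter> cball 0 r"
  let ?j = "inv (to_complex :: 'k \<Rightarrow> complex)"
  have j: "?j (to_complex x) = x" for x
    by (rule inv_f_f) (auto simp: inj_def to_complex_inj)
  have "compact ?K"
    by (intro closed_Int_compact closed_range_to_complex compact_cball)
  moreover have "continuous_on ?K ?j"
    unfolding continuous_on_iff by (metis IntD1 dist_to_complex f_inv_into_f)
  ultimately have "compact (?j ` ?K)"
    by (rule compact_continuous_image[rotated])
  moreover have "?j ` ?K = cball 0 r"
  proof (intro set_eqI iffI)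
    fix x :: 'k assume "x \<in> cball 0 r"
    then have "to_complex x \<in> ?K" by simp
    then show "x \<in> ?j ` ?K" using j by (metis image_eqI)
  qed (auto simp: j)
  ultimately show ?thesis by simp
qed

text \<open>
  Compactness of balls gives completeness, so that absolutely convergent series of scalars converge.
\<close>

instance real_or_complex \<subseteq> heine_borel
proof
  fix f :: "nat \<Rightarrow> 'a" assume "bounded (range f)"
  then obtain B where "\<And>n. norm (f n) \<le> B" unfolding bounded_iff by blast
  then have "\<forall>n. f n \<in> cball 0 B" by simp
  then show "\<exists>l r. strict_mono r \<and> (f \<circ> r) \<longlonglongrightarrow> l"
    using compact_cball_scalar[of B, where 'k='a] unfolding compact_def by blast
qed

instance real_or_complex \<subseteq> banach ..

lemma countable_dense_scalars:
  "\<exists>D :: 'k::real_or_complex set. countable D \<and> 0 \<in> D \<and> (\<forall>x. \<forall>e>0. \<exists>d\<in>D. norm (x - d) < e)"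
proof -
  let ?R = "range (to_complex :: 'k \<Rightarrow> complex)"
  obtain T where T: "countable T" "T \<subseteq> ?R" "?R \<subseteq> closure T"
    using separable by blast
  let ?D = "insert 0 (inv to_complex ` T) :: 'k set"
  have "\<exists>d\<in>?D. norm (x - d) < e" if "e > 0" for x e
  proof -
    have "to_complex x \<in> closure T" using T by auto
    then obtain t where t: "t \<in> T" "dist t (to_complex x) < e"
      using \<open>e > 0\<close> closure_approachable by blast
    then have "to_complex (inv to_complex t :: 'k) = t"
      using T by (meson f_inv_into_f subsetD)
    then have "dist (inv to_complex t) x < e"
      using t by (metis dist_to_complex)
    then show ?thesis using t by (auto simp: dist_norm norm_minus_commute)
  qed
  then show ?thesis using T by (intro exI[of _ ?D]) auto
qed

lemma of_real_unit_scalar: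
  fixes z :: "'k::real_or_complex"
  obtains u where "norm u = 1" "u * z = of_real (norm z)"
proof (cases "z = 0")
  case True
  then show ?thesis by (intro that[of 1]) auto
next
  case False
  then show ?thesis
    by (intro that[of "of_real (norm z) / z"]) (auto simp: norm_divide)
qed

text \<open>
  One of the four half planes carries at least a quarter of the total mass. This is why a bounded
  scalar set function has bounded variation.
\<close>

lemma ex_subset_sum_norm_le:
  fixes z :: "'i \<Rightarrow> 'k::real_or_complex"
  assumes "finite I"
  shows "\<exists>J\<subseteq>I. (\<Sum>i\<in>I. norm (z i)) \<le> 4 * norm (\<Sum>i\<in>J. z i)"
proof -
  let ?r = "\<lambda>i. Re (to_complex (z i))" and ?s = "\<lambda>i. Im (to_complex (z i))"
  have half: "(\<Sum>i\<in>I. \<bar>f i\<bar>) \<le> (\<Sum>i\<in>{i\<in>I. f i \<ge> 0}. f i) + (\<Sum>i\<in>{i\<in>I. f i < 0}. - f i)"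
    for f :: "'i \<Rightarrow> real"
  proof -
    have "I = {i\<in>I. f i \<ge> 0} \<union> {i\<in>I. f i < 0}" by auto
    then have "(\<Sum>i\<in>I. \<bar>f i\<bar>) = (\<Sum>i\<in>{i\<in>I. f i \<ge> 0} \<union> {i\<in>I. f i < 0}. \<bar>f i\<bar>)"
      by simp
    also have "\<dots> = (\<Sum>i\<in>{i\<in>I. f i \<ge> 0}. \<bar>f i\<bar>) + (\<Sum>i\<in>{i\<in>I. f i < 0}. \<bar>f i\<bar>)"
      using assms by (intro sum.union_disjoint) auto
    finally show ?thesis by simp
  qed
  have "(\<Sum>i\<in>I. norm (z i)) \<le> (\<Sum>i\<in>I. \<bar>?r i\<bar> + \<bar>?s i\<bar>)"
    by (intro sum_mono) (metis cmod_le to_complex_simps(4))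
  also have "\<dots> \<le> (\<Sum>i\<in>{i\<in>I. ?r i \<ge> 0}. ?r i) + (\<Sum>i\<in>{i\<in>I. ?r i < 0}. - ?r i) +
      ((\<Sum>i\<in>{i\<in>I. ?s i \<ge> 0}. ?s i) + (\<Sum>i\<in>{i\<in>I. ?s i < 0}. - ?s i))"
    unfolding sum.distrib by (intro add_mono half)
  finally have le: "(\<Sum>i\<in>I. norm (z i)) \<le> \<dots>" .
  have "\<bar>\<Sum>i\<in>J. ?r i\<bar> \<le> norm (\<Sum>i\<in>J. z i)" for J
    using abs_Re_le_cmod[of "to_complex (\<Sum>i\<in>J. z i)"] to_complex_simps(4)[of "\<Sum>i\<in>J. z i"]
    by simp
  then have R: "(\<Sum>i\<in>J. ?r i) \<le> norm (\<Sum>i\<in>J. z i)" "- (\<Sum>i\<in>J. ?r i) \<le> norm (\<Sum>i\<in>J. z i)" for J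
    by (simp_all add: abs_le_iff)
  have "\<bar>\<Sum>i\<in>J. ?s i\<bar> \<le> norm (\<Sum>i\<in>J. z i)" for J
    using abs_Im_le_cmod[of "to_complex (\<Sum>i\<in>J. z i)"] to_complex_simps(4)[of "\<Sum>i\<in>J. z i"]
    by simp
  then have S: "(\<Sum>i\<in>J. ?s i) \<le> norm (\<Sum>i\<in>J. z i)" "- (\<Sum>i\<in>J. ?s i) \<le> norm (\<Sum>i\<in>J. z i)" for J
    by (simp_all add: abs_le_iff)
  have *: "4 * norm (\<Sum>i\<in>{i\<in>I. P i}. z i) < (\<Sum>i\<in>I. norm (z i))"
    if "\<not> ?thesis" for P
    using that by (metis (no_types, lifting) mem_Collect_eq not_le subsetI)
  have arith: False if "t \<le> a + b + (c + d)" "a \<le> a'" "b \<le> b'" "c \<le> c'" "d \<le> d'"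
    "4 * a' < t" "4 * b' < t" "4 * c' < t" "4 * d' < t" for t a b c d a' b' c' d' :: real
    using that by linarith
  show ?thesis
    using arith[OF le R(1) R(2)[folded sum_negf] S(1) S(2)[folded sum_negf] * * * *] by blast
qed


section \<open>Limits along an ultrafilter\<close>

lemma ex_ultrafilter_le:
  assumes "F0 \<noteq> (bot :: 'i filter)"
  shows "\<exists>F\<le>F0. F \<noteq> bot \<and> (\<forall>P. eventually P F \<or> eventually (\<lambda>i. \<not> P i) F)"
proof -
  let ?A = "{F. F \<le> F0 \<and> F \<noteq> bot}"
  have "\<exists>m\<in>?A. \<forall>a\<in>?A. m \<ge> a \<longrightarrow> a = m"
  proof (rule predicate_Zorn)
    show "partial_order_on ?A (relation_of (\<lambda>x y. x \<ge> y) ?A)"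
      by (rule partial_order_on_relation_ofI) auto
    fix C assume C: "C \<in> Chains (relation_of (\<lambda>x y. x \<ge> y) ?A)"
    have CA: "C \<subseteq> ?A" and lin: "a \<in> C \<Longrightarrow> b \<in> C \<Longrightarrow> a \<le> b \<or> b \<le> a" for a b
      using C unfolding Chains_def relation_of_def by blast+
    show "\<exists>u\<in>?A. \<forall>a\<in>C. a \<ge> u"
    proof (cases "C = {}")
      case True
      then show ?thesis using assms by auto
    next
      case False
      have "Inf X \<noteq> bot" if "X \<subseteq> C" "finite X" for X
      proof (cases "X = {}")
        case True
        show ?thesis
        proof
          assume "Inf X = bot"
          then have "F0 \<le> bot" using top_greatest[of F0] by (simp only: True Inf_empty)
          then show False using assms by (simp add: le_bot)
        qed
      next
        case ne: False
        have "\<exists>m\<in>X. \<forall>x\<in>X. m \<le> x"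
          using that(2) ne that(1)
        proof (induction X rule: finite_ne_induct)
          case (insert x X)
          then obtain m where "m \<in> X" "\<forall>x\<in>X. m \<le> x" by auto
          then show ?case using lin[of m x] insert.prems
            by (metis insert_iff insert_subset order_trans subsetD order_refl)
        qed auto
        then obtain m where m: "m \<in> X" "m \<le> Inf X" by (meson Inf_greatest)
        then have "m \<noteq> bot" using CA that by blast
        then show ?thesis using m(2) by (metis le_bot)
      qed
      then have "Inf C \<noteq> bot" by (rule Inf_filter_not_bot)
      moreover have "Inf C \<le> F0"
        using False CA by (metis (no_types, lifting) Inf_lower2 all_not_in_conv mem_Collect_eq subsetD)
      ultimately show ?thesis by (intro bexI[of _ "Inf C"]) (auto intro: Inf_lower)
    qed
  qed
  then obtain F where F: "F \<le> F0" "F \<noteq> bot"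
    and min: "\<And>G. G \<le> F0 \<Longrightarrow> G \<noteq> bot \<Longrightarrow> G \<le> F \<Longrightarrow> G = F" by auto
  have "eventually P F \<or> eventually (\<lambda>i. \<not> P i) F" for P
  proof (cases "inf F (principal {i. P i}) = bot")
    case True
    then have "eventually (\<lambda>i. False) (inf F (principal {i. P i}))" by simp
    then show ?thesis by (simp add: eventually_inf_principal)
  next
    case False
    then have "inf F (principal {i. P i}) = F"
      using F by (intro min) (auto intro: le_infI1)
    then have "eventually P (inf F (principal {i. P i})) \<longleftrightarrow> eventually P F" by simp
    then show ?thesis by (simp add: eventually_inf_principal)
  qed
  then show ?thesis using F by blast
qed

definition free_ultrafilter :: "nat filter" where
  "free_ultrafilter = (SOME F. F \<le> sequentially \<and> F \<noteq> bot \<and>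
     (\<forall>P. eventually P F \<or> eventually (\<lambda>i. \<not> P i) F))"

lemma free_ultrafilter:
  "free_ultrafilter \<le> sequentially" "free_ultrafilter \<noteq> bot"
  "eventually P free_ultrafilter \<or> eventually (\<lambda>i. \<not> P i) free_ultrafilter"
  using someI_ex[OF ex_ultrafilter_le[OF sequentially_bot, simplified]]
  unfolding free_ultrafilter_def by blast+

lemma bounded_tendsto_ultrafilter:
  fixes u :: "nat \<Rightarrow> 'k::real_or_complex"
  assumes "\<And>n. norm (u n) \<le> B"
  shows "(u \<longlongrightarrow> Lim free_ultrafilter u) free_ultrafilter"
proof -
  let ?F = "filtermap u free_ultrafilter"
  have "?F \<noteq> bot" using free_ultrafilter(2) by (simp add: filtermap_bot_iff)
  moreover have "eventually (\<lambda>x. x \<in> cball 0 B) ?F"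
    using assms by (simp add: eventually_filtermap)
  ultimately obtain x where x: "inf (nhds x) ?F \<noteq> bot"
    using compact_cball_scalar unfolding compact_filter by blast
  have "(u \<longlongrightarrow> x) free_ultrafilter"
  proof (rule topological_tendstoI)
    fix T assume T: "open T" "x \<in> T"
    have "\<not> eventually (\<lambda>i. \<not> u i \<in> T) free_ultrafilter"
    proof
      assume "eventually (\<lambda>i. \<not> u i \<in> T) free_ultrafilter"
      then have "eventually (\<lambda>y. y \<notin> T) ?F" by (simp add: eventually_filtermap)
      moreover have "eventually (\<lambda>y. y \<in> T) (nhds x)"
        using T by (rule eventually_nhds_in_open)
      ultimately have "eventually (\<lambda>y. False) (inf (nhds x) ?F)"
        unfolding eventually_inf by blast
      then show False using x by (simp add: trivial_limit_def)
    qed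
    then show "eventually (\<lambda>i. u i \<in> T) free_ultrafilter"
      using free_ultrafilter(3)[of "\<lambda>i. u i \<in> T"] by blast
  qed
  then show ?thesis using free_ultrafilter(2) tendsto_Lim by metis
qed


section \<open>The Hahn-Banach theorem\<close>

definition sublinear :: "('v::real_vector \<Rightarrow> real) \<Rightarrow> bool" where
  "sublinear p \<longleftrightarrow> (\<forall>x y. p (x + y) \<le> p x + p y) \<and> (\<forall>r\<ge>0. \<forall>x. p (r *\<^sub>R x) = r * p x)"

text \<open>
  For positive homogeneity, one inequality suffices: apply it to \<open>r\<close> and to its inverse.
\<close>

lemma sublinearI:
  assumes "\<And>x y. p (x + y) \<le> p x + p y" "\<And>r x. r > 0 \<Longrightarrow> p (r *\<^sub>R x) \<le> r * p x" "p 0 = 0"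
  shows "sublinear p"
  unfolding sublinear_def
proof (intro conjI allI impI)
  fix r :: real and x assume "r \<ge> 0"
  show "p (r *\<^sub>R x) = r * p x"
  proof (cases "r = 0")
    case False
    then have "r > 0" using \<open>r \<ge> 0\<close> by simp
    have "p x = p (inverse r *\<^sub>R (r *\<^sub>R x))" using \<open>r > 0\<close> by simp
    also have "\<dots> \<le> inverse r * p (r *\<^sub>R x)" using \<open>r > 0\<close> by (intro assms(2)) simp
    finally have "r * p x \<le> p (r *\<^sub>R x)" using \<open>r > 0\<close> by (simp add: field_simps)
    then show ?thesis using assms(2)[OF \<open>r > 0\<close>, of x] by simp
  qed (simp add: assms(3))
qed (rule assms(1))

lemma sublinear_add: "sublinear p \<Longrightarrow> p (x + y) \<le> p x + p y"
  and sublinear_scale: "sublinear p \<Longrightarrow> r \<ge> 0 \<Longrightarrow> p (r *\<^sub>R x) = r * p x"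
  unfolding sublinear_def by auto

lemma sublinear_0: "sublinear p \<Longrightarrow> p 0 = 0"
  using sublinear_scale[of p 0 0] by simp

lemma sublinear_ge: "sublinear p \<Longrightarrow> - p (- x) \<le> p x"
  using sublinear_add[of p x "- x"] sublinear_0[of p] by simp

text \<open>
  A chain of sublinear functionals below a fixed one has its pointwise infimum as a sublinear lower
  bound: the values are bounded below because \<open>q x \<ge> - q (- x) \<ge> - p (- x)\<close>.
\<close>

lemma ex_minimal_sublinear:
  assumes p: "sublinear p"
  shows "\<exists>q. sublinear q \<and> q \<le> p \<and> (\<forall>q'. sublinear q' \<longrightarrow> q' \<le> q \<longrightarrow> q' = q)"
proof -
  let ?A = "{q. sublinear q \<and> q \<le> p}"
  have "\<exists>m\<in>?A. \<forall>a\<in>?A. m \<ge> a \<longrightarrow> a = m"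
  proof (rule predicate_Zorn)
    show "partial_order_on ?A (relation_of (\<lambda>x y. x \<ge> y) ?A)"
      by (rule partial_order_on_relation_ofI) auto
    fix C assume C: "C \<in> Chains (relation_of (\<lambda>x y. x \<ge> y) ?A)"
    have CA: "\<And>q. q \<in> C \<Longrightarrow> sublinear q" "\<And>q. q \<in> C \<Longrightarrow> q \<le> p"
      and lin: "a \<in> C \<Longrightarrow> b \<in> C \<Longrightarrow> a \<le> b \<or> b \<le> a" for a b
      using C unfolding Chains_def relation_of_def by blast+
    show "\<exists>u\<in>?A. \<forall>a\<in>C. a \<ge> u"
    proof (cases "C = {}")
      case True
      then show ?thesis using p by auto
    next
      case False
      let ?u = "\<lambda>x. INF q\<in>C. q x"
      have "- p (- x) \<le> q x" if "q \<in> C" for q x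
        using sublinear_ge[OF CA(1)[OF that], of x] CA(2)[OF that] by (smt (verit) le_funE)
      then have bdd: "bdd_below ((\<lambda>q. q x) ` C)" for x by (intro bdd_belowI2)
      have low: "?u x \<le> q x" if "q \<in> C" for q x using bdd that by (rule cINF_lower)
      have greatest: "m \<le> ?u x" if "\<And>q. q \<in> C \<Longrightarrow> m \<le> q x" for m x
        using False that by (intro cINF_greatest) auto
      have "sublinear ?u"
      proof (rule sublinearI)
        fix x y
        have sum: "?u (x + y) \<le> q x + q' y" if q: "q \<in> C" "q' \<in> C" for q q'
        proof -
          obtain r where "r \<in> C" "r \<le> q" "r \<le> q'" using lin[OF q] q by blast
          then have "?u (x + y) \<le> r x + r y"
            using low[of r "x + y"] sublinear_add[OF CA(1)[of r], of x y] by linarith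
          also have "\<dots> \<le> q x + q' y"
            using \<open>r \<le> q\<close> \<open>r \<le> q'\<close> by (simp add: add_mono le_funD)
          finally show ?thesis .
        qed
        have "?u (x + y) - q x \<le> ?u y" if "q \<in> C" for q
          using sum[OF that] by (intro greatest) (smt (verit))
        then have "?u (x + y) - ?u y \<le> ?u x" by (intro greatest) (smt (verit))
        then show "?u (x + y) \<le> ?u x + ?u y" by simp
      next
        fix r :: real and x assume "r > 0"
        have "?u (r *\<^sub>R x) \<le> r * q x" if "q \<in> C" for q
          using low[OF that, of "r *\<^sub>R x"] sublinear_scale[OF CA(1)[OF that], of r x] \<open>r > 0\<close> by simp
        then have "?u (r *\<^sub>R x) / r \<le> ?u x"
          using \<open>r > 0\<close> by (intro greatest) (simp add: field_simps)
        then show "?u (r *\<^sub>R x) \<le> r * ?u x" using \<open>r > 0\<close> by (simp add: field_simps)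
      next
        have "(\<lambda>q. q 0) ` C = {0}" using False CA(1) sublinear_0 by force
        then show "?u 0 = 0" by simp
      qed
      moreover have "?u \<le> p"
        using False low CA(2) by (metis (no_types, lifting) all_not_in_conv le_fun_def order_trans)
      ultimately show ?thesis using low by (intro bexI[of _ ?u]) (auto intro: le_funI)
    qed
  qed
  then show ?thesis by (auto dest: order_trans)
qed

text \<open>
  If \<open>q\<close> is minimal, then comparing it with the sublinear functional
  \<open>x \<mapsto> inf\<^sub>t (q (x + t y) - t q y)\<close> below it gives superadditivity.
\<close>

lemma minimal_sublinear_linear:
  assumes q: "sublinear q" and min: "\<And>q'. sublinear q' \<Longrightarrow> q' \<le> q \<Longrightarrow> q' = q"
  shows "linear q"
proof -
  have super: "q x + q y \<le> q (x + y)" for x y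
  proof -
    let ?r = "\<lambda>x. INF t\<in>{0..}. q (x + t *\<^sub>R y) - t * q y"
    have "- q (- x) \<le> q (x + t *\<^sub>R y) - t * q y" if "t \<ge> 0" for x t
      using sublinear_add[OF q, of "x + t *\<^sub>R y" "- x"] sublinear_scale[OF q that] by simp
    then have bdd: "bdd_below ((\<lambda>t. q (x + t *\<^sub>R y) - t * q y) ` {0..})" for x
      by (intro bdd_belowI2) auto
    have low: "?r x \<le> q (x + t *\<^sub>R y) - t * q y" if "t \<ge> 0" for x t
      using bdd that by (intro cINF_lower) auto
    have greatest: "m \<le> ?r x" if "\<And>t. t \<ge> 0 \<Longrightarrow> m \<le> q (x + t *\<^sub>R y) - t * q y" for m x
      using that by (intro cINF_greatest) auto
    have "sublinear ?r"
    proof (rule sublinearI)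
      fix a b
      have sum: "?r (a + b) \<le> (q (a + s *\<^sub>R y) - s * q y) + (q (b + t *\<^sub>R y) - t * q y)"
        if "s \<ge> 0" "t \<ge> 0" for s t
        using low[of "s + t" "a + b"] that
          sublinear_add[OF q, of "a + s *\<^sub>R y" "b + t *\<^sub>R y"]
        by (simp add: algebra_simps)
      have "?r (a + b) - (q (a + s *\<^sub>R y) - s * q y) \<le> ?r b" if "s \<ge> 0" for s
        using sum[OF that] by (intro greatest) (smt (verit))
      then have "?r (a + b) - ?r b \<le> ?r a" by (intro greatest) (smt (verit))
      then show "?r (a + b) \<le> ?r a + ?r b" by simp
    next
      fix c :: real and a assume "c > 0"
      have "?r (c *\<^sub>R a) \<le> c * (q (a + t *\<^sub>R y) - t * q y)" if "t \<ge> 0" for t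
        using low[of "c * t" "c *\<^sub>R a"] sublinear_scale[OF q, of c "a + t *\<^sub>R y"] that \<open>c > 0\<close>
        by (simp add: algebra_simps)
      then have "?r (c *\<^sub>R a) / c \<le> ?r a"
        using \<open>c > 0\<close> by (intro greatest) (simp add: field_simps)
      then show "?r (c *\<^sub>R a) \<le> c * ?r a" using \<open>c > 0\<close> by (simp add: field_simps)
    next
      show "?r 0 = 0"
        using sublinear_scale[OF q] by (intro antisym greatest) (use low[of 0 0] sublinear_0[OF q] in auto)
    qed
    moreover have "?r \<le> q" using low[of 0] by (auto intro!: le_funI)
    ultimately have "?r = q" by (rule min)
    then have "q x = ?r x" using fun_cong[of ?r q x] by simp
    also have "\<dots> \<le> q (x + 1 *\<^sub>R y) - 1 * q y" by (rule low) simp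
    finally show ?thesis by simp
  qed
  then have add: "q (x + y) = q x + q y" for x y
    using sublinear_add[OF q] by (simp add: antisym)
  have neg: "q (- x) = - q x" for x
    using add[of x "- x"] sublinear_0[OF q] by simp
  show ?thesis
  proof (rule linearI)
    fix c :: real and x
    show "q (c *\<^sub>R x) = c *\<^sub>R q x"
      using sublinear_scale[OF q, of c x] sublinear_scale[OF q, of "- c" x] neg[of "c *\<^sub>R x"]
      by (cases "c \<ge> 0") auto
  qed (rule add)
qed

text \<open>
  The functional \<open>x \<mapsto> inf\<^sub>w (f w + C \<parallel>x - w\<parallel>)\<close> is sublinear and dominated by \<open>f\<close> on the subspace;
  any linear functional below it therefore extends \<open>f\<close>.
\<close>

lemma real_hahn_banach:
  fixes f :: "'v::real_normed_vector \<Rightarrow> real"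
  assumes W: "subspace W"
    and add: "\<And>x y. x \<in> W \<Longrightarrow> y \<in> W \<Longrightarrow> f (x + y) = f x + f y"
    and scale: "\<And>r x. x \<in> W \<Longrightarrow> f (r *\<^sub>R x) = r * f x"
    and bound: "\<And>x. x \<in> W \<Longrightarrow> \<bar>f x\<bar> \<le> C * norm x" and C: "C \<ge> 0"
  shows "\<exists>g. linear g \<and> (\<forall>x\<in>W. g x = f x) \<and> (\<forall>x. \<bar>g x\<bar> \<le> C * norm x)"
proof -
  let ?p = "\<lambda>x. INF w\<in>W. f w + C * norm (x - w)"
  have W0: "0 \<in> W" using W by (rule subspace_0)
  have f0: "f 0 = 0" using scale[OF W0, of 0] by simp
  have "- (C * norm x) \<le> f w + C * norm (x - w)" if "w \<in> W" for w x
  proof -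
    have "C * norm w \<le> C * (norm (x - w) + norm x)"
      using C norm_triangle_ineq4[of x "x - w"] by (intro mult_left_mono) auto
    then show ?thesis using bound[OF that] by (simp add: algebra_simps)
  qed
  then have bdd: "bdd_below ((\<lambda>w. f w + C * norm (x - w)) ` W)" for x by (intro bdd_belowI2)
  have low: "?p x \<le> f w + C * norm (x - w)" if "w \<in> W" for w x
    using bdd that by (rule cINF_lower)
  have greatest: "m \<le> ?p x" if "\<And>w. w \<in> W \<Longrightarrow> m \<le> f w + C * norm (x - w)" for m x
    using that W0 by (intro cINF_greatest) auto
  have p: "sublinear ?p"
  proof (rule sublinearI)
    fix x y
    have sum: "?p (x + y) \<le> (f v + C * norm (x - v)) + (f w + C * norm (y - w))"
      if "v \<in> W" "w \<in> W" for v w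
    proof -
      have "C * norm (x + y - (v + w)) \<le> C * (norm (x - v) + norm (y - w))"
        using C norm_triangle_ineq[of "x - v" "y - w"]
        by (intro mult_left_mono) (auto simp: algebra_simps)
      then show ?thesis
        using low[OF subspace_add[OF W that], of "x + y"] add[OF that] by (simp add: algebra_simps)
    qed
    have "?p (x + y) - (f v + C * norm (x - v)) \<le> ?p y" if "v \<in> W" for v
      using sum[OF that] by (intro greatest) (smt (verit))
    then have "?p (x + y) - ?p y \<le> ?p x" by (intro greatest) (smt (verit))
    then show "?p (x + y) \<le> ?p x + ?p y" by simp
  next
    fix r :: real and x assume r: "r > 0"
    have "?p (r *\<^sub>R x) \<le> r * (f w + C * norm (x - w))" if "w \<in> W" for w
      using low[OF subspace_scale[OF W that], of "r *\<^sub>R x" r] scale[OF that] r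
      by (simp add: algebra_simps scaleR_diff_right[symmetric] del: scaleR_diff_right)
    then have "?p (r *\<^sub>R x) / r \<le> ?p x"
      using r by (intro greatest) (simp add: field_simps)
    then show "?p (r *\<^sub>R x) \<le> r * ?p x" using r by (simp add: field_simps)
  next
    have "0 \<le> f w + C * norm (0 - w)" if "w \<in> W" for w
      using bound[OF that] by simp
    then have "0 \<le> ?p 0" by (rule greatest)
    then show "?p 0 = 0" using low[OF W0, of 0] f0 by simp
  qed
  then obtain g where g: "sublinear g" "g \<le> ?p"
      and "\<And>q'. sublinear q' \<Longrightarrow> q' \<le> g \<Longrightarrow> q' = g"
    using ex_minimal_sublinear by blast
  then have lin: "linear g" by (intro minimal_sublinear_linear)
  have le: "g w \<le> f w" if "w \<in> W" for w
    using le_funD[OF g(2), of w] low[OF that, of w] by simp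
  have "g w = f w" if "w \<in> W" for w
    using le[OF that] le[OF subspace_neg[OF W that]] scale[OF that, of "- 1"]
    by (simp add: linear_neg[OF lin])
  moreover have "g x \<le> C * norm x" for x
    using le_funD[OF g(2), of x] low[OF W0, of x] f0 by simp
  then have "\<bar>g x\<bar> \<le> C * norm x" for x
    by (metis abs_le_iff lin linear_neg norm_minus_cancel)
  ultimately show ?thesis using lin by blast
qed

context banach_space_over
begin

lemma smul_scaleR: "smul c (r *\<^sub>R x) = r *\<^sub>R smul c x"
  by (metis mult.commute scale_of_real scale_scale)

text \<open>
  Over the complex numbers, a functional is recovered from its real part \<open>h\<close> as
  \<open>h x - i h (i x)\<close>, and rotating its value to the positive half line transfers the bound.
\<close>

theorem hahn_banach:
  fixes f :: "'x \<Rightarrow> 'k"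
  assumes W: "subspace W"
    and add: "\<And>x y. x \<in> W \<Longrightarrow> y \<in> W \<Longrightarrow> f (x + y) = f x + f y"
    and scale: "\<And>c x. x \<in> W \<Longrightarrow> f (smul c x) = c * f x"
    and bound: "\<And>x. x \<in> W \<Longrightarrow> norm (f x) \<le> C * norm x" and C: "C \<ge> 0"
  shows "\<exists>g. Vector_Spaces.linear smul (*) g \<and> (\<forall>x\<in>W. g x = f x) \<and> (\<forall>x. norm (g x) \<le> C * norm x)"
proof -
  let ?re = "\<lambda>x. Re (to_complex (f x))"
  have sW: "Real_Vector_Spaces.subspace W"
    using W by (auto simp: Real_Vector_Spaces.subspace_def subspace_def scale_of_real[symmetric])
  have re: "\<bar>?re x\<bar> \<le> norm (f x)" for x
    using abs_Re_le_cmod[of "to_complex (f x)"] by simp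
  have "\<exists>h. linear h \<and> (\<forall>x\<in>W. h x = ?re x) \<and> (\<forall>x. \<bar>h x\<bar> \<le> C * norm x)"
    using sW C
  proof (intro real_hahn_banach)
    show "?re (r *\<^sub>R x) = r * ?re x" if "x \<in> W" for r x
      using scale[OF that, of "of_real r"] by (simp add: scale_of_real)
    show "\<bar>?re x\<bar> \<le> C * norm x" if "x \<in> W" for x
      using bound[OF that] re[of x] by linarith
  qed (auto simp: add)
  then obtain h where h: "linear h" "\<And>x. x \<in> W \<Longrightarrow> h x = ?re x" "\<And>x. \<bar>h x\<bar> \<le> C * norm x"
    by blast
  have lin: "Vector_Spaces.linear smul (*) g"
    if "\<And>x y. g (x + y) = g x + g y" "\<And>c x. g (smul c x) = c * g x" for g :: "'x \<Rightarrow> 'k"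
    using that by unfold_locales (auto simp: algebra_simps)
  show ?thesis
  proof (cases "surj (to_complex :: 'k \<Rightarrow> complex)")
    case False
    then have real: "to_complex (z::'k) \<in> \<real>" for z using to_complex_real_or_surj by blast
    have eq: "z = of_real (Re (to_complex z))" for z :: 'k
      using real[of z] by (metis complex_is_Real_iff of_real_Re to_complex_inj to_complex_simps(3))
    let ?g = "\<lambda>x. of_real (h x) :: 'k"
    have "?g (smul c x) = c * ?g x" for c x
    proof -
      have "smul c x = Re (to_complex c) *\<^sub>R x" by (metis eq scale_of_real)
      then show ?thesis using linear_scale[OF h(1)] by (subst (2) eq[of c]) simp
    qed
    then have "Vector_Spaces.linear smul (*) ?g"
      by (intro lin) (auto simp: linear_add[OF h(1)])
    moreover have "?g x = f x" if "x \<in> W" for x using h(2)[OF that] eq[of "f x"] by simp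
    moreover have "norm (?g x) \<le> C * norm x" for x using h(3)[of x] by simp
    ultimately show ?thesis by blast
  next
    case True
    then obtain i :: 'k where i: "to_complex i = \<i>" by (metis surjD)
    have eq: "z = of_real (Re (to_complex z)) + of_real (Im (to_complex z)) * i" for z :: 'k
      by (subst to_complex_inj[symmetric]) (simp add: i complex_eq_iff)
    let ?g = "\<lambda>x. of_real (h x) - of_real (h (smul i x)) * i"
    have hsmul: "h (smul c x) = Re (to_complex c) * h x + Im (to_complex c) * h (smul i x)" for c x
    proof -
      have "smul c x = Re (to_complex c) *\<^sub>R x + Im (to_complex c) *\<^sub>R smul i x"
        by (subst eq[of c]) (simp only: scale_left_distrib scale_of_real scale_scale[symmetric])
      then show ?thesis using h(1) by (simp add: linear_add linear_scale)
    qed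
    have gsmul: "?g (smul c x) = c * ?g x" for c x
    proof -
      have "h (smul i (smul c x)) = h (smul (i * c) x)" by simp
      also have "\<dots> = Re (to_complex c) * h (smul i x) - Im (to_complex c) * h x"
        by (subst hsmul) (simp add: i)
      finally have *: "h (smul i (smul c x)) = Re (to_complex c) * h (smul i x) - Im (to_complex c) * h x" .
      show ?thesis
        unfolding * unfolding hsmul[of c]
        by (subst to_complex_inj[symmetric]) (simp add: i complex_eq_iff algebra_simps)
    qed
    then have "Vector_Spaces.linear smul (*) ?g"
      by (intro lin) (auto simp: linear_add[OF h(1)] scale_right_distrib algebra_simps)
    moreover have "?g x = f x" if "x \<in> W" for x
    proof -
      have "smul i x \<in> W" using W that by (rule subspace_scale)
      then have "h (smul i x) = - Im (to_complex (f x))" using h(2) scale[OF that, of i] by (simp add: i)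
      then show ?thesis using h(2)[OF that] eq[of "f x"] by simp
    qed
    moreover have "norm (?g x) \<le> C * norm x" for x
    proof -
      obtain u where u: "norm u = 1" "u * ?g x = of_real (norm (?g x))"
        by (rule of_real_unit_scalar)
      then have "of_real (norm (?g x)) = ?g (smul u x)" using gsmul by simp
      then have "complex_of_real (norm (?g x)) = to_complex (?g (smul u x))"
        by (metis to_complex_simps(3))
      then have "norm (?g x) = h (smul u x)" by (simp add: i complex_eq_iff)
      also have "\<dots> \<le> C * norm x" using h(3)[of "smul u x"] u by (simp add: norm_scale)
      finally show ?thesis .
    qed
    ultimately show ?thesis by blast
  qed
qed

lemma subspace_line: "subspace (range (\<lambda>c. smul c x))"
proof -
  have "range (\<lambda>c. smul c x) = span {x}" by (auto simp: span_singleton)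
  then show ?thesis by simp
qed

lemma ex_norming_functional: "\<exists>\<phi>\<in>dual_unit_ball smul. \<phi> x = of_real (norm x)"
proof (cases "x = 0")
  case True
  have "(\<lambda>_. 0) \<in> dual_unit_ball smul"
    unfolding dual_unit_ball_def by (auto, unfold_locales) (auto simp: algebra_simps)
  then show ?thesis using True by auto
next
  case False
  let ?f = "\<lambda>y. (SOME c. y = smul c x) * of_real (norm x)"
  have f: "?f (smul c x) = c * of_real (norm x)" for c
  proof -
    have "(SOME c'. smul c x = smul c' x) = c"
      using False by (intro some_equality) (auto simp: scale_cancel_right)
    then show ?thesis by simp
  qed
  have "\<exists>g. Vector_Spaces.linear smul (*) g \<and> (\<forall>y\<in>range (\<lambda>c. smul c x). g y = ?f y) \<and>
      (\<forall>y. norm (g y) \<le> 1 * norm y)"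
  proof (rule hahn_banach[OF subspace_line])
    fix y z assume "y \<in> range (\<lambda>c. smul c x)" "z \<in> range (\<lambda>c. smul c x)"
    then obtain a b where "y = smul a x" "z = smul b x" by blast
    moreover have "?f (smul a x + smul b x) = ?f (smul a x) + ?f (smul b x)"
      by (simp only: scale_left_distrib[symmetric] f) (simp add: algebra_simps)
    ultimately show "?f (y + z) = ?f y + ?f z" by simp
  next
    fix c y assume "y \<in> range (\<lambda>c. smul c x)"
    then obtain a where "y = smul a x" by blast
    moreover have "?f (smul c (smul a x)) = c * ?f (smul a x)"
      by (simp only: scale_scale f) simp
    ultimately show "?f (smul c y) = c * ?f y" by simp
  next
    fix y assume "y \<in> range (\<lambda>c. smul c x)"
    then obtain a where "y = smul a x" by blast
    then show "norm (?f y) \<le> 1 * norm y"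
      by (simp only: f) (simp add: norm_mult norm_scale)
  qed simp
  then obtain g where g: "Vector_Spaces.linear smul (*) g"
      "\<And>y. y \<in> range (\<lambda>c. smul c x) \<Longrightarrow> g y = ?f y" "\<And>y. norm (g y) \<le> 1 * norm y"
    by blast
  have "g (smul 1 x) = ?f (smul 1 x)" by (rule g(2)) blast
  also have "?f (smul 1 x) = of_real (norm x)" unfolding f by simp
  finally have "g x = of_real (norm x)" by simp
  then show ?thesis using g by (auto simp: dual_unit_ball_def)
qed

end


section \<open>Quotients and complemented copies of spaces of functions\<close>

lemma fun_nspace_simps [simp]:
  "vcarrier (fun_nspace smul V N) = V"
  "vadd (fun_nspace smul V N) = (\<lambda>F G i. F i + G i)"
  "vzero (fun_nspace smul V N) = (\<lambda>i. 0)"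
  "vscale (fun_nspace smul V N) = (\<lambda>c F i. smul c (F i))"
  "vnorm (fun_nspace smul V N) = N"
  "(fun_nspace smul V N)\<lparr>vcarrier := W\<rparr> = fun_nspace smul W N"
  by (simp_all add: fun_nspace_def)

definition fun_subspace :: "('k \<Rightarrow> 'x \<Rightarrow> 'x::ab_group_add) \<Rightarrow> ('i \<Rightarrow> 'x) set \<Rightarrow> bool" where
  "fun_subspace smul V \<longleftrightarrow> (\<lambda>i. 0) \<in> V \<and> (\<forall>F\<in>V. \<forall>G\<in>V. (\<lambda>i. F i + G i) \<in> V) \<and>
     (\<forall>c. \<forall>F\<in>V. (\<lambda>i. smul c (F i)) \<in> V)"

lemma fun_subspaceD:
  assumes "fun_subspace smul V"
  shows "(\<lambda>i. 0) \<in> V" "F \<in> V \<Longrightarrow> G \<in> V \<Longrightarrow> (\<lambda>i. F i + G i) \<in> V"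
    "F \<in> V \<Longrightarrow> (\<lambda>i. smul c (F i)) \<in> V"
  using assms unfolding fun_subspace_def by blast+

lemma linear_subspace_fun_nspace:
  "linear_subspace (fun_nspace smul V N) M \<longleftrightarrow> M \<subseteq> V \<and> fun_subspace smul M"
  unfolding linear_subspace_def fun_subspace_def by auto

lemma bounded_operator_fun_nspace:
  "bounded_operator (fun_nspace smul V N) (fun_nspace smul' W N') T \<longleftrightarrow>
     (\<forall>F\<in>V. T F \<in> W) \<and> (\<forall>F\<in>V. \<forall>G\<in>V. T (\<lambda>i. F i + G i) = (\<lambda>i. T F i + T G i)) \<and>
     (\<forall>c. \<forall>F\<in>V. T (\<lambda>i. smul c (F i)) = (\<lambda>i. smul' c (T F i))) \<and>
     (\<exists>C. \<forall>F\<in>V. N' (T F) \<le> C * N F)"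
  unfolding bounded_operator_def by simp

lemma bounded_operator_funD:
  assumes "bounded_operator (fun_nspace smul V N) (fun_nspace smul' W N') T"
  shows "F \<in> V \<Longrightarrow> T F \<in> W"
    "F \<in> V \<Longrightarrow> G \<in> V \<Longrightarrow> T (\<lambda>i. F i + G i) = (\<lambda>i. T F i + T G i)"
    "F \<in> V \<Longrightarrow> T (\<lambda>i. smul c (F i)) = (\<lambda>i. smul' c (T F i))"
    "\<exists>C. \<forall>F\<in>V. N' (T F) \<le> C * N F"
  using assms unfolding bounded_operator_fun_nspace by blast+

text \<open>
  The projection is \<open>J \<circ> P\<close>: it is idempotent because \<open>P \<circ> J = id\<close>, and on its range \<open>P\<close> inverts \<open>J\<close>.
\<close>

lemma contains_complemented_copyI:
  assumes W: "fun_subspace smul' W"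
    and J: "bounded_operator (fun_nspace smul' W N') (fun_nspace smul V N) J"
    and P: "bounded_operator (fun_nspace smul V N) (fun_nspace smul' W N') P"
    and PJ: "\<And>a. a \<in> W \<Longrightarrow> P (J a) = a"
    and nonneg: "\<And>F. F \<in> V \<Longrightarrow> N F \<ge> 0" "\<And>a. a \<in> W \<Longrightarrow> N' a \<ge> 0"
  shows "contains_complemented_copy (fun_nspace smul V N) (fun_nspace smul' W N')"
proof -
  note J' = bounded_operator_funD[OF J] and P' = bounded_operator_funD[OF P]
  have "fun_subspace smul (J ` W)"
    unfolding fun_subspace_def
  proof (intro conjI ballI allI)
    have W0: "(\<lambda>i. 0) \<in> W" using W by (rule fun_subspaceD)
    have "J (\<lambda>i. 0) = (\<lambda>i. J (\<lambda>i. 0) i + J (\<lambda>i. 0) i)"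
      using J'(2)[OF W0 W0] by (simp only: add_0)
    then have "J (\<lambda>i. 0) i = J (\<lambda>i. 0) i + J (\<lambda>i. 0) i" for i by (rule fun_cong)
    then have "J (\<lambda>i. 0) = (\<lambda>i. 0)" by (intro ext) (metis add_cancel_right_right)
    then show "(\<lambda>i. 0) \<in> J ` W" using W0 by (rule image_eqI[OF sym])
  next
    fix F G assume "F \<in> J ` W" "G \<in> J ` W"
    then obtain a b where ab: "a \<in> W" "b \<in> W" and FG: "F = J a" "G = J b" by blast
    show "(\<lambda>i. F i + G i) \<in> J ` W"
      unfolding FG J'(2)[OF ab, symmetric] using fun_subspaceD(2)[OF W ab] by (rule imageI)
  next
    fix c F assume "F \<in> J ` W"
    then obtain a where a: "a \<in> W" and F: "F = J a" by blast
    show "(\<lambda>i. smul c (F i)) \<in> J ` W"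
      unfolding F J'(3)[OF a, symmetric] using fun_subspaceD(3)[OF W a] by (rule imageI)
  qed
  moreover have JV: "J ` W \<subseteq> V" using J'(1) by blast
  moreover have "isomorphic_nspace (fun_nspace smul (J ` W) N) (fun_nspace smul' W N')"
    unfolding isomorphic_nspace_def
  proof (intro exI[of _ P] exI[of _ J] conjI)
    show "bounded_operator (fun_nspace smul (J ` W) N) (fun_nspace smul' W N') P"
      using P JV unfolding bounded_operator_fun_nspace by blast
    show "bounded_operator (fun_nspace smul' W N') (fun_nspace smul (J ` W) N) J"
      using J unfolding bounded_operator_fun_nspace by blast
  qed (auto simp: PJ)
  moreover have "bounded_operator (fun_nspace smul V N) (fun_nspace smul V N) (J \<circ> P)"
    unfolding bounded_operator_fun_nspace
  proof (intro conjI ballI allI)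
    obtain C where C: "\<And>a. a \<in> W \<Longrightarrow> N (J a) \<le> C * N' a" using J'(4) by blast
    obtain D where D: "\<And>F. F \<in> V \<Longrightarrow> N' (P F) \<le> D * N F" using P'(4) by blast
    have "N ((J \<circ> P) F) \<le> (\<bar>C\<bar> * \<bar>D\<bar>) * N F" if "F \<in> V" for F
    proof -
      have PF: "P F \<in> W" using P'(1) that .
      have "N (J (P F)) \<le> \<bar>C\<bar> * N' (P F)"
        using C[OF PF] nonneg(2)[OF PF] by (meson abs_ge_self mult_right_mono order_trans)
      also have "\<dots> \<le> \<bar>C\<bar> * (\<bar>D\<bar> * N F)"
        using D[OF that] nonneg(1)[OF that]
        by (intro mult_left_mono) (meson abs_ge_self mult_right_mono order_trans, simp)
      finally show ?thesis by (simp add: mult.assoc)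
    qed
    then show "\<exists>C. \<forall>F\<in>V. N ((J \<circ> P) F) \<le> C * N F" by blast
  qed (use J'(1-3) P'(1-3) in auto)
  moreover have "\<forall>F\<in>V. (J \<circ> P) ((J \<circ> P) F) = (J \<circ> P) F"
    using P'(1) PJ by auto
  moreover have "(J \<circ> P) ` V = J ` W"
  proof (intro equalityI subsetI)
    fix F assume "F \<in> J ` W"
    then obtain a where "a \<in> W" "F = J a" by blast
    then have "F = (J \<circ> P) F" "F \<in> V" using PJ J'(1) by auto
    then show "F \<in> (J \<circ> P) ` V" by (rule image_eqI)
  qed (use P'(1) in auto)
  ultimately show ?thesis
    unfolding contains_complemented_copy_def
    by (intro exI[of _ "J ` W"] exI[of _ "J \<circ> P"]) (simp add: linear_subspace_fun_nspace)
qed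

text \<open>
  The elements of the quotient by the kernel are exactly the fibres of \<open>T\<close>. Since norms lift
  boundedly, the quotient norm of a fibre is comparable to the norm of its image in \<open>W\<close>.
\<close>

locale quotient_operator =
  fixes smul :: "'k::real_or_complex \<Rightarrow> 'x::ab_group_add \<Rightarrow> 'x" and smul' :: "'k \<Rightarrow> 'y::ab_group_add \<Rightarrow> 'y"
    and V :: "('i \<Rightarrow> 'x) set" and N and W :: "('j \<Rightarrow> 'y) set" and N' and T and C :: real
  assumes vs: "vector_space smul" and vs': "vector_space smul'"
    and V: "fun_subspace smul V" and W: "fun_subspace smul' W"
    and T: "bounded_operator (fun_nspace smul V N) (fun_nspace smul' W N') T"
    and lift: "\<And>z. z \<in> W \<Longrightarrow> \<exists>F\<in>V. T F = z \<and> N F \<le> C * N' z"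
    and nonneg: "\<And>F. F \<in> V \<Longrightarrow> N F \<ge> 0"
    and definite: "\<And>z. z \<in> W \<Longrightarrow> N' z \<le> 0 \<Longrightarrow> z = (\<lambda>i. 0)"
begin

definition "ker = {F\<in>V. T F = (\<lambda>i. 0)}"

definition "fibre z = {F\<in>V. T F = z}"

definition "Q = quotient_nspace (fun_nspace smul V N) ker"

lemma T_simps:
  "F \<in> V \<Longrightarrow> T F \<in> W"
  "F \<in> V \<Longrightarrow> G \<in> V \<Longrightarrow> T (\<lambda>i. F i + G i) = (\<lambda>i. T F i + T G i)"
  "F \<in> V \<Longrightarrow> T (\<lambda>i. smul c (F i)) = (\<lambda>i. smul' c (T F i))"
  using bounded_operator_funD[OF T] by blast+

lemma T_minus:
  assumes "F \<in> V" "G \<in> V"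
  shows "(\<lambda>i. F i - G i) \<in> V" "T (\<lambda>i. F i - G i) = (\<lambda>i. T F i - T G i)"
proof -
  interpret A: vector_space smul by (rule vs)
  interpret B: vector_space smul' by (rule vs')
  have eq: "(\<lambda>i. F i - G i) = (\<lambda>i. F i + smul (- 1) (G i))" by simp
  have G': "(\<lambda>i. smul (- 1) (G i)) \<in> V" using V assms(2) by (rule fun_subspaceD)
  show "(\<lambda>i. F i - G i) \<in> V" unfolding eq using V assms(1) G' by (rule fun_subspaceD)
  show "T (\<lambda>i. F i - G i) = (\<lambda>i. T F i - T G i)"
    unfolding eq T_simps(2)[OF assms(1) G'] T_simps(3)[OF assms(2)] by simp
qed

lemma fun_subspace_ker: "fun_subspace smul ker"
proof -
  interpret A: vector_space smul by (rule vs)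
  interpret B: vector_space smul' by (rule vs')
  have "T (\<lambda>i. 0) = (\<lambda>i. 0)" using T_simps(3)[OF fun_subspaceD(1)[OF V], of 0] by simp
  then show ?thesis
    using fun_subspaceD[OF V] unfolding fun_subspace_def ker_def by (auto simp: T_simps)
qed

lemma coset_eq_fibre: "F \<in> V \<Longrightarrow> (\<lambda>G i. F i + G i) ` ker = fibre (T F)"
proof (intro set_eqI iffI)
  fix G assume F: "F \<in> V" and "G \<in> fibre (T F)"
  then have G: "G \<in> V" "T G = T F" by (auto simp: fibre_def)
  have "(\<lambda>i. G i - F i) \<in> ker"
    using T_minus[OF G(1) F] G(2) by (simp add: ker_def)
  then have "(\<lambda>i. F i + (G i - F i)) \<in> (\<lambda>G i. F i + G i) ` ker" by (rule imageI)
  then show "G \<in> (\<lambda>G i. F i + G i) ` ker" by simp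
next
  fix G assume "F \<in> V" "G \<in> (\<lambda>G i. F i + G i) ` ker"
  then show "G \<in> fibre (T F)"
    using fun_subspaceD(2)[OF V] by (auto simp: fibre_def ker_def T_simps)
qed

lemma fibre_nonempty: "z \<in> W \<Longrightarrow> \<exists>F\<in>V. T F = z"
  using lift by blast

lemma carrier_Q: "vcarrier Q = fibre ` W"
proof -
  have "vcarrier Q = (\<lambda>F. fibre (T F)) ` V"
    by (simp add: Q_def quotient_nspace_def coset_eq_fibre cong: image_cong_simp)
  also have "\<dots> = fibre ` T ` V" by (simp add: image_image)
  also have "T ` V = W" using fibre_nonempty T_simps(1) by blast
  finally show ?thesis .
qed

lemma zero_Q: "vzero Q = fibre (\<lambda>i. 0)"
  by (simp add: Q_def quotient_nspace_def fibre_def ker_def)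

lemma add_Q:
  assumes "y \<in> W" "z \<in> W"
  shows "vadd Q (fibre y) (fibre z) = fibre (\<lambda>i. y i + z i)"
proof -
  have "{\<lambda>i. a i + b i |a b. a \<in> fibre y \<and> b \<in> fibre z} = fibre (\<lambda>i. y i + z i)" (is "?L = _")
  proof (intro set_eqI iffI)
    fix F assume "F \<in> ?L"
    then show "F \<in> fibre (\<lambda>i. y i + z i)"
      using fun_subspaceD(2)[OF V] by (auto simp: fibre_def T_simps)
  next
    fix F assume "F \<in> fibre (\<lambda>i. y i + z i)"
    then have F: "F \<in> V" "T F = (\<lambda>i. y i + z i)" by (auto simp: fibre_def)
    obtain G where G: "G \<in> V" "T G = y" using fibre_nonempty assms by blast
    have "(\<lambda>i. F i - G i) \<in> fibre z" using T_minus[OF F(1) G(1)] F G by (simp add: fibre_def)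
    moreover have "F = (\<lambda>i. G i + (F i - G i))" by simp
    ultimately show "F \<in> ?L" using G by (fastforce simp: fibre_def)
  qed
  then show ?thesis by (simp add: Q_def quotient_nspace_def)
qed

lemma scale_Q:
  assumes "z \<in> W"
  shows "vscale Q c (fibre z) = fibre (\<lambda>i. smul' c (z i))"
proof -
  interpret B: vector_space smul' by (rule vs')
  have "{\<lambda>i. smul c (a i) + m i |a m. a \<in> fibre z \<and> m \<in> ker} = fibre (\<lambda>i. smul' c (z i))" (is "?L = _")
  proof (intro set_eqI iffI)
    fix F assume "F \<in> ?L"
    then show "F \<in> fibre (\<lambda>i. smul' c (z i))"
      using fun_subspaceD(2,3)[OF V] by (auto simp: fibre_def ker_def T_simps)
  next
    fix F assume "F \<in> fibre (\<lambda>i. smul' c (z i))"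
    then have F: "F \<in> V" "T F = (\<lambda>i. smul' c (z i))" by (auto simp: fibre_def)
    obtain G where G: "G \<in> V" "T G = z" using fibre_nonempty assms by blast
    have cG: "(\<lambda>i. smul c (G i)) \<in> V" using V G(1) by (rule fun_subspaceD)
    have "(\<lambda>i. F i - smul c (G i)) \<in> ker"
      using T_minus[OF F(1) cG] F G by (simp add: ker_def T_simps)
    moreover have "F = (\<lambda>i. smul c (G i) + (F i - smul c (G i)))" by simp
    ultimately show "F \<in> ?L" using G by (fastforce simp: fibre_def)
  qed
  then show ?thesis by (simp add: Q_def quotient_nspace_def)
qed

lemma norm_Q_le: "F \<in> fibre z \<Longrightarrow> vnorm Q (fibre z) \<le> N F"
  unfolding Q_def quotient_nspace_def
  by (auto intro!: cINF_lower bdd_belowI2[of _ 0] nonneg simp: fibre_def)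

lemma le_norm_Q:
  assumes "z \<in> W" "\<And>F. F \<in> fibre z \<Longrightarrow> m \<le> N F"
  shows "m \<le> vnorm Q (fibre z)"
  unfolding Q_def quotient_nspace_def
  using assms fibre_nonempty[of z] by (auto intro!: cINF_greatest simp: fibre_def)

lemma norm_Q_lift: "z \<in> W \<Longrightarrow> vnorm Q (fibre z) \<le> C * N' z"
  using lift[of z] norm_Q_le[of _ z] by (force simp: fibre_def)

lemma closed_subspace_ker: "closed_subspace (fun_nspace smul V N) ker"
  unfolding closed_subspace_def
proof (intro conjI ballI impI)
  interpret A: vector_space smul by (rule vs)
  show "linear_subspace (fun_nspace smul V N) ker"
    using fun_subspace_ker by (auto simp: linear_subspace_fun_nspace ker_def)
  obtain D where D: "\<And>F. F \<in> V \<Longrightarrow> N' (T F) \<le> D * N F"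
    using T unfolding bounded_operator_fun_nspace by blast
  fix F assume "F \<in> vcarrier (fun_nspace smul V N)"
  then have F: "F \<in> V" by simp
  assume near: "\<forall>e>0. \<exists>m\<in>ker. vdist (fun_nspace smul V N) F m < e"
  have "N' (T F) \<le> 0"
  proof (rule field_le_epsilon)
    fix e :: real assume "e > 0"
    then have "e / (\<bar>D\<bar> + 1) > 0" by (simp add: divide_pos_pos)
    then obtain m where m: "m \<in> ker" "vdist (fun_nspace smul V N) F m < e / (\<bar>D\<bar> + 1)"
      using near by blast
    have mV: "m \<in> V" "T m = (\<lambda>i. 0)" using m by (auto simp: ker_def)
    have Nm: "N (\<lambda>i. F i - m i) < e / (\<bar>D\<bar> + 1)" using m(2) by (simp add: vdist_def)
    have "N' (T F) = N' (T (\<lambda>i. F i - m i))" using T_minus(2)[OF F mV(1)] mV(2) by simp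
    also have "\<dots> \<le> D * N (\<lambda>i. F i - m i)" using T_minus(1)[OF F mV(1)] by (rule D)
    also have "\<dots> \<le> (\<bar>D\<bar> + 1) * N (\<lambda>i. F i - m i)"
      using nonneg[OF T_minus(1)[OF F mV(1)]] by (intro mult_right_mono) auto
    also have "\<dots> \<le> (\<bar>D\<bar> + 1) * (e / (\<bar>D\<bar> + 1))" using Nm by (intro mult_left_mono) auto
    also have "\<dots> = e" by (simp add: abs_add_one_gt_zero less_imp_neq[symmetric])
    finally show "N' (T F) \<le> 0 + e" by simp
  qed
  then have "T F = (\<lambda>i. 0)" using definite T_simps(1)[OF F] by blast
  then show "F \<in> ker" using F by (simp add: ker_def)
qed

definition "image_of A = (THE z. z \<in> W \<and> A = fibre z)"

lemma image_of_fibre: "z \<in> W \<Longrightarrow> image_of (fibre z) = z"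
  unfolding image_of_def using fibre_nonempty by (fastforce simp: fibre_def)

lemma bounded_operator_fibre: "bounded_operator (fun_nspace smul' W N') Q fibre"
  unfolding bounded_operator_def using norm_Q_lift by (auto simp: carrier_Q add_Q scale_Q)

lemma bounded_operator_image_of: "bounded_operator Q (fun_nspace smul' W N') image_of"
proof -
  obtain D where D: "\<And>F. F \<in> V \<Longrightarrow> N' (T F) \<le> D * N F"
    using T unfolding bounded_operator_fun_nspace by blast
  have "N' z \<le> (\<bar>D\<bar> + 1) * vnorm Q (fibre z)" if "z \<in> W" for z
  proof -
    have pos: "\<bar>D\<bar> + 1 > 0" by linarith
    have "N' z / (\<bar>D\<bar> + 1) \<le> N F" if "F \<in> fibre z" for F
    proof -
      have F: "F \<in> V" "T F = z" using that by (auto simp: fibre_def)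
      then have "N' z \<le> D * N F" using D by blast
      also have "\<dots> \<le> (\<bar>D\<bar> + 1) * N F" using nonneg[OF F(1)] by (intro mult_right_mono) auto
      finally show ?thesis using pos by (simp add: field_simps)
    qed
    then have "N' z / (\<bar>D\<bar> + 1) \<le> vnorm Q (fibre z)" using that by (intro le_norm_Q)
    then show ?thesis using pos by (simp add: field_simps)
  qed
  then show ?thesis
    unfolding bounded_operator_def
    using fun_subspaceD(2,3)[OF W] by (auto simp: carrier_Q add_Q scale_Q image_of_fibre)
qed

theorem has_quotient_isomorphic_to_image:
  "has_quotient_isomorphic_to (fun_nspace smul V N) (fun_nspace smul' W N')"
  unfolding has_quotient_isomorphic_to_def isomorphic_nspace_def
  using closed_subspace_ker bounded_operator_fibre bounded_operator_image_of
  by (intro exI[of _ ker] conjI exI[of _ image_of] exI[of _ fibre])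
     (auto simp: Q_def[symmetric] carrier_Q image_of_fibre)

text \<open>
  Both properties pass from \<open>W\<close> to the quotient: a finite spanning set of cosets maps to a finite
  spanning set of \<open>W\<close>, and the fibres over a countable dense set are dense.
\<close>

theorem has_separable_quotient_if_image:
  assumes inf: "infinite_dimensional (fun_nspace smul' W N')"
    and sep: "separable (fun_nspace smul' W N')" and nonneg': "\<And>z. z \<in> W \<Longrightarrow> N' z \<ge> 0"
  shows "has_separable_quotient (fun_nspace smul V N)"
proof -
  have "infinite_dimensional Q"
    unfolding infinite_dimensional_def
  proof clarify
    fix B assume B: "finite B" "B \<subseteq> vcarrier Q" "lin_span Q B = vcarrier Q"
    have fibre_image: "A \<in> fibre ` W \<Longrightarrow> image_of A \<in> W \<and> fibre (image_of A) = A" for A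
      by (auto simp: image_of_fibre)
    have "z \<in> M" if M: "linear_subspace (fun_nspace smul' W N') M" "image_of ` B \<subseteq> M" and "z \<in> W" for z M
    proof -
      have M': "M \<subseteq> W" "fun_subspace smul' M" using M by (auto simp: linear_subspace_fun_nspace)
      have "linear_subspace Q (fibre ` M)"
        unfolding linear_subspace_def
      proof (intro conjI ballI allI)
        show "fibre ` M \<subseteq> vcarrier Q" using M' by (auto simp: carrier_Q)
        show "vzero Q \<in> fibre ` M" using fun_subspaceD(1)[OF M'(2)] by (simp add: zero_Q)
      next
        fix A A' assume "A \<in> fibre ` M" "A' \<in> fibre ` M"
        then obtain y z where "y \<in> M" "z \<in> M" "A = fibre y" "A' = fibre z" by blast
        then show "vadd Q A A' \<in> fibre ` M"
          using fun_subspaceD(2)[OF M'(2), of y z] M'(1) by (auto simp: add_Q subset_iff)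
      next
        fix c A assume "A \<in> fibre ` M"
        then obtain y where "y \<in> M" "A = fibre y" by blast
        then show "vscale Q c A \<in> fibre ` M"
          using fun_subspaceD(3)[OF M'(2), of y c] M'(1) by (auto simp: scale_Q subset_iff)
      qed
      moreover have "B \<subseteq> fibre ` M"
      proof
        fix A assume "A \<in> B"
        then have "A = fibre (image_of A)" "image_of A \<in> M"
          using M(2) B(2) fibre_image unfolding carrier_Q by auto
        then show "A \<in> fibre ` M" by blast
      qed
      ultimately have "lin_span Q B \<subseteq> fibre ` M" unfolding lin_span_def by blast
      then have "fibre z \<in> fibre ` M" using B(3) \<open>z \<in> W\<close> by (auto simp: carrier_Q)
      then obtain y where "y \<in> M" "fibre z = fibre y" by blast
      then show ?thesis using M'(1) \<open>z \<in> W\<close> image_of_fibre by (metis subsetD)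
    qed
    then have "W \<subseteq> lin_span (fun_nspace smul' W N') (image_of ` B)" unfolding lin_span_def by blast
    moreover have BW: "image_of ` B \<subseteq> W" using B(2) fibre_image by (auto simp: carrier_Q)
    then have "lin_span (fun_nspace smul' W N') (image_of ` B) \<subseteq> W"
      unfolding lin_span_def using W by (intro Inter_lower) (simp add: linear_subspace_fun_nspace)
    ultimately show False
      using inf B(1) BW unfolding infinite_dimensional_def
      by (metis finite_imageI fun_nspace_simps(1) subset_antisym)
  qed
  moreover have "separable Q"
  proof -
    obtain D where D: "countable D" "D \<subseteq> W"
        "\<And>z e. z \<in> W \<Longrightarrow> e > 0 \<Longrightarrow> \<exists>d\<in>D. vdist (fun_nspace smul' W N') z d < e"
      using sep unfolding separable_def by auto
    have "\<exists>d\<in>fibre ` D. vdist Q A d < e" if A: "A \<in> vcarrier Q" and "e > 0" for A e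
    proof -
      obtain z where z: "z \<in> W" "A = fibre z" using A by (auto simp: carrier_Q)
      have pos: "\<bar>C\<bar> + 1 > 0" by linarith
      have "e / (\<bar>C\<bar> + 1) > 0" using \<open>e > 0\<close> pos by simp
      then obtain d where d: "d \<in> D" "vdist (fun_nspace smul' W N') z d < e / (\<bar>C\<bar> + 1)"
        using D(3)[OF z(1)] by blast
      let ?w = "\<lambda>i. z i + smul' (- 1) (d i)"
      have d': "d \<in> W" "(\<lambda>i. smul' (- 1) (d i)) \<in> W" using d D fun_subspaceD(3)[OF W] by auto
      have w: "?w \<in> W" using fun_subspaceD(2)[OF W z(1) d'(2)] .
      have "vdist Q A (fibre d) = vnorm Q (fibre ?w)"
        unfolding vdist_def z(2) scale_Q[OF d'(1)] add_Q[OF z(1) d'(2)] ..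
      also have "\<dots> \<le> C * N' ?w" using w by (rule norm_Q_lift)
      also have "\<dots> \<le> (\<bar>C\<bar> + 1) * N' ?w"
        using nonneg'[OF w] by (intro mult_right_mono) auto
      also have "\<dots> < (\<bar>C\<bar> + 1) * (e / (\<bar>C\<bar> + 1))"
        using d(2) pos by (intro mult_strict_left_mono) (simp_all add: vdist_def)
      also have "\<dots> = e" using pos by simp
      finally show ?thesis using d(1) by blast
    qed
    moreover have "fibre ` D \<subseteq> vcarrier Q" using D(2) by (auto simp: carrier_Q)
    ultimately show ?thesis
      unfolding separable_def using D(1) by (intro exI[of _ "fibre ` D"]) auto
  qed
  ultimately show ?thesis
    unfolding has_separable_quotient_def using closed_subspace_ker Q_def by metis
qed

end


section \<open>The sequence spaces\<close>

lemma vector_space_scalars: "vector_space ((*) :: 'k::real_or_complex \<Rightarrow> 'k \<Rightarrow> 'k)"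
  by unfold_locales (auto simp: algebra_simps)

definition c0_seqs :: "(nat \<Rightarrow> 'k::real_or_complex) set" where
  "c0_seqs = {x. x \<longlonglongrightarrow> 0}"

definition l1_seqs :: "(nat \<Rightarrow> 'k::real_or_complex) set" where
  "l1_seqs = {x. summable (\<lambda>n. norm (x n))}"

definition l2_seqs :: "(nat \<Rightarrow> 'k::real_or_complex) set" where
  "l2_seqs = {x. summable (\<lambda>n. (norm (x n))\<^sup>2)}"

definition linf_seqs :: "(nat \<Rightarrow> 'k::real_or_complex) set" where
  "linf_seqs = {x. bounded (range x)}"

definition sup_norm :: "(nat \<Rightarrow> 'k::real_or_complex) \<Rightarrow> real" where
  "sup_norm x = (SUP n. norm (x n))"

definition l1_norm :: "(nat \<Rightarrow> 'k::real_or_complex) \<Rightarrow> real" where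
  "l1_norm x = (\<Sum>n. norm (x n))"

definition l2_norm :: "(nat \<Rightarrow> 'k::real_or_complex) \<Rightarrow> real" where
  "l2_norm x = sqrt (\<Sum>n. (norm (x n))\<^sup>2)"

lemma sequence_spaces:
  "c0_space = fun_nspace (*) c0_seqs sup_norm"
  "l1_space = fun_nspace (*) l1_seqs l1_norm"
  "l2_space = fun_nspace (*) l2_seqs l2_norm"
  "linf_space = fun_nspace (*) linf_seqs sup_norm"
  by (simp_all add: c0_space_def l1_space_def l2_space_def linf_space_def c0_seqs_def l1_seqs_def
      l2_seqs_def linf_seqs_def sup_norm_def[abs_def] l1_norm_def[abs_def] l2_norm_def[abs_def])

lemma fun_subspace_c0: "fun_subspace (*) c0_seqs"
  unfolding fun_subspace_def c0_seqs_def
  by (auto intro: tendsto_add_zero tendsto_mult_right_zero)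

lemma fun_subspace_l1: "fun_subspace (*) l1_seqs"
  unfolding fun_subspace_def l1_seqs_def
proof safe
  fix F G :: "nat \<Rightarrow> 'a"
  assume "summable (\<lambda>n. norm (F n))" "summable (\<lambda>n. norm (G n))"
  then have "summable (\<lambda>n. norm (F n) + norm (G n))" by (rule summable_add)
  then show "summable (\<lambda>n. norm (F n + G n))"
    by (rule summable_comparison_test'[where N=0]) (simp add: norm_triangle_ineq)
qed (simp_all add: norm_mult summable_mult)

lemma fun_subspace_l2: "fun_subspace (*) l2_seqs"
  unfolding fun_subspace_def l2_seqs_def
proof safe
  fix F G :: "nat \<Rightarrow> 'a"
  assume "summable (\<lambda>n. (norm (F n))\<^sup>2)" "summable (\<lambda>n. (norm (G n))\<^sup>2)"
  then have sum: "summable (\<lambda>n. 2 * (norm (F n))\<^sup>2 + 2 * (norm (G n))\<^sup>2)"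
    by (intro summable_add summable_mult)
  have "(norm (F n + G n))\<^sup>2 \<le> 2 * (norm (F n))\<^sup>2 + 2 * (norm (G n))\<^sup>2" for n
  proof -
    have "(norm (F n + G n))\<^sup>2 \<le> (norm (F n) + norm (G n))\<^sup>2"
      by (intro power_mono norm_triangle_ineq) simp
    also have "\<dots> \<le> 2 * (norm (F n))\<^sup>2 + 2 * (norm (G n))\<^sup>2"
      using zero_le_power2[of "norm (F n) - norm (G n)"] by (simp add: power2_eq_square algebra_simps)
    finally show ?thesis .
  qed
  then show "summable (\<lambda>n. (norm (F n + G n))\<^sup>2)"
    by (intro summable_comparison_test'[OF sum, where N=0]) simp
qed (simp_all add: norm_mult power_mult_distrib summable_mult)

lemma bdd_above_norm: "x \<in> linf_seqs \<Longrightarrow> bdd_above (range (\<lambda>n. norm (x n)))"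
  unfolding linf_seqs_def bounded_iff by (auto simp: bdd_above_def)

lemma c0_subset_linf: "(c0_seqs :: (nat \<Rightarrow> 'k::real_or_complex) set) \<subseteq> linf_seqs"
proof
  fix x :: "nat \<Rightarrow> 'k" assume "x \<in> c0_seqs"
  then have "x \<longlonglongrightarrow> 0" by (simp add: c0_seqs_def)
  then have "bounded (range x)" by (rule convergent_imp_bounded)
  then show "x \<in> linf_seqs" by (simp add: linf_seqs_def)
qed

lemma linf_seqsI: "(\<And>n. norm (x n) \<le> B) \<Longrightarrow> x \<in> linf_seqs"
  unfolding linf_seqs_def bounded_iff by blast

lemma norm_le_sup_norm: "x \<in> linf_seqs \<Longrightarrow> norm (x n) \<le> sup_norm x"
  unfolding sup_norm_def using bdd_above_norm by (rule cSUP_upper[OF UNIV_I])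

lemma sup_norm_le: "(\<And>n. norm (x n) \<le> B) \<Longrightarrow> sup_norm x \<le> B"
  unfolding sup_norm_def by (intro cSUP_least) auto

lemma sup_norm_nonneg: "x \<in> linf_seqs \<Longrightarrow> sup_norm x \<ge> 0"
  using norm_le_sup_norm[of x 0] norm_ge_zero[of "x 0"] by linarith

lemma norm_le_l1_norm: "x \<in> l1_seqs \<Longrightarrow> norm (x n) \<le> l1_norm x"
  unfolding l1_norm_def l1_seqs_def using sum_le_suminf[of "\<lambda>n. norm (x n)" "{n}"] by simp

lemma l1_norm_nonneg: "x \<in> l1_seqs \<Longrightarrow> l1_norm x \<ge> 0"
  unfolding l1_norm_def l1_seqs_def by (simp add: suminf_nonneg)

lemma l1_norm_definite:
  assumes "x \<in> l1_seqs" "l1_norm x \<le> 0"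
  shows "x = (\<lambda>i. 0)"
proof
  have "norm (x n) \<le> 0" for n using norm_le_l1_norm[OF assms(1), of n] assms(2) by linarith
  then show "x n = 0" for n by simp
qed

lemma l2_norm_definite: "x \<in> l2_seqs \<Longrightarrow> l2_norm x \<le> 0 \<Longrightarrow> x = (\<lambda>i. 0)"
proof
  fix n assume x: "x \<in> l2_seqs" "l2_norm x \<le> 0"
  have "(norm (x n))\<^sup>2 \<le> (\<Sum>n. (norm (x n))\<^sup>2)"
    using x sum_le_suminf[of "\<lambda>n. (norm (x n))\<^sup>2" "{n}"] by (simp add: l2_seqs_def)
  then have "(norm (x n))\<^sup>2 \<le> 0" using x(2) unfolding l2_norm_def by (meson order_trans real_sqrt_le_0_iff)
  then show "x n = 0" by simp
qed

text \<open>
  The unit vectors are independent, so no finite set spans them.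
\<close>

lemma infinite_dimensional_l1: "infinite_dimensional (l1_space :: ('k::real_or_complex, nat \<Rightarrow> 'k) nspace)"
  unfolding infinite_dimensional_def
proof clarify
  let ?s = "\<lambda>(c::'k) (f::nat \<Rightarrow> 'k) i. c * f i"
  interpret vs: vector_space ?s
    by unfold_locales (auto simp: algebra_simps fun_eq_iff)
  fix B :: "(nat \<Rightarrow> 'k) set"
  assume B: "finite B" "B \<subseteq> vcarrier l1_space" "lin_span l1_space B = vcarrier l1_space"
  define e :: "nat \<Rightarrow> nat \<Rightarrow> 'k" where "e n = (\<lambda>i. if i = n then 1 else 0)" for n
  have e1: "e n \<in> l1_seqs" for n
    unfolding l1_seqs_def e_def by (auto intro!: summable_finite[of "{n}"] split: if_splits)
  have B1: "B \<subseteq> l1_seqs" using B(2) by (simp add: sequence_spaces)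
  have "vs.subspace (vs.span B \<inter> l1_seqs)"
    using fun_subspace_l1 by (intro vs.subspace_inter vs.subspace_span)
      (auto simp: vs.subspace_def fun_subspace_def plus_fun_def zero_fun_def)
  then have "linear_subspace l1_space (vs.span B \<inter> l1_seqs)"
    unfolding sequence_spaces linear_subspace_fun_nspace fun_subspace_def vs.subspace_def
    by (simp add: plus_fun_def zero_fun_def)
  then have "lin_span l1_space B \<subseteq> vs.span B \<inter> l1_seqs"
    unfolding lin_span_def using B1 by (intro Inter_lower) (auto intro: vs.span_base)
  then have "range e \<subseteq> vs.span B" using B(3) e1 by (auto simp: sequence_spaces)
  moreover have "inj e" by (auto simp: inj_def e_def fun_eq_iff split: if_splits)
  moreover have "vs.independent (range e)"
    unfolding vs.independent_explicit_module
  proof (intro allI impI)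
    fix A u v assume A: "finite A" "A \<subseteq> range e" "(\<Sum>w\<in>A. ?s (u w) w) = 0" "v \<in> A"
    then obtain n where n: "v = e n" by blast
    have fin: "(\<Sum>w\<in>A. ?s (u w) w) i = (\<Sum>w\<in>A. u w * w i)" for i
      using A(1) by (induction A rule: finite_induct) (auto simp: plus_fun_def zero_fun_def)
    have "(\<Sum>w\<in>A. u w * w n) = (\<Sum>w\<in>{v}. u w * w n)"
    proof (rule sum.mono_neutral_right)
      show "\<forall>w\<in>A - {v}. u w * w n = 0"
      proof
        fix w assume "w \<in> A - {v}"
        then obtain m where "w = e m" "w \<noteq> e n" using A(2) n by blast
        then have "w n = 0" by (auto simp: e_def)
        then show "u w * w n = 0" by simp
      qed
    qed (use A in auto)
    then have "u v = 0" using A(3) fin[of n] n by (simp add: e_def zero_fun_def)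
    then show "u v = 0" .
  qed
  ultimately show False
    using vs.independent_span_bound[OF B(1)] by (metis finite_imageD infinite_UNIV_nat inj_on_subset)
qed

text \<open>
  Sequences of finite support with entries from a countable dense set of scalars are dense.
\<close>

lemma separable_l1: "separable (l1_space :: ('k::real_or_complex, nat \<Rightarrow> 'k) nspace)"
proof -
  obtain D :: "'k set" where D: "countable D" "0 \<in> D" "\<And>x e. e > 0 \<Longrightarrow> \<exists>d\<in>D. norm (x - d) < e"
    using countable_dense_scalars by blast
  let ?f = "\<lambda>l i. if i < length l then l ! i else (0::'k)"
  let ?C = "?f ` lists D"
  have "countable ?C" using D(1) by (intro countable_image countable_lists)
  moreover have l1: "?f l \<in> l1_seqs" for l
    unfolding l1_seqs_def by (auto intro!: summable_finite[of "{..<length l}"] split: if_splits)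
  moreover have "\<exists>d\<in>?C. l1_norm (\<lambda>i. x i - d i) < e" if x: "x \<in> l1_seqs" and e: "e > 0" for x e
  proof -
    have sx: "summable (\<lambda>n. norm (x n))" using x by (simp add: l1_seqs_def)
    obtain N where N: "norm (\<Sum>i. norm (x (i + N))) < e / 2"
      using suminf_exist_split[of "e / 2" "\<lambda>n. norm (x n)"] e sx by auto
    obtain d where d: "\<And>i. d i \<in> D" "\<And>i. norm (x i - d i) < e / 2 / (N + 1)"
    proof -
      have "e / 2 / (N + 1) > 0" using e by simp
      then have "\<forall>i. \<exists>d. d \<in> D \<and> norm (x i - d) < e / 2 / (N + 1)" using D(3) by blast
      then have "\<exists>d. \<forall>i. d i \<in> D \<and> norm (x i - d i) < e / 2 / (N + 1)" by (rule choice)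
      then show thesis using that by blast
    qed
    let ?l = "map d [0..<N]"
    have s: "summable (\<lambda>i. norm (x i - ?f ?l i))"
    proof -
      have "(\<lambda>i. x i + (- 1) * ?f ?l i) \<in> l1_seqs"
        by (intro fun_subspaceD(2)[OF fun_subspace_l1 x] fun_subspaceD(3)[OF fun_subspace_l1 l1])
      then show ?thesis by (simp add: l1_seqs_def)
    qed
    have "l1_norm (\<lambda>i. x i - ?f ?l i) =
        (\<Sum>i. norm (x (i + N) - ?f ?l (i + N))) + (\<Sum>i<N. norm (x i - ?f ?l i))"
      unfolding l1_norm_def using s by (rule suminf_split_initial_segment)
    also have "(\<Sum>i. norm (x (i + N) - ?f ?l (i + N))) = (\<Sum>i. norm (x (i + N)))" by simp
    also have "\<dots> < e / 2" using N by (simp add: abs_less_iff)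
    also have "(\<Sum>i<N. norm (x i - ?f ?l i)) \<le> (\<Sum>i<N. e / 2 / (N + 1))"
      using d(2) by (intro sum_mono) (auto intro: less_imp_le)
    also have "\<dots> \<le> e / 2" using e by (simp add: field_simps)
    finally have "l1_norm (\<lambda>i. x i - ?f ?l i) < e" by simp
    moreover have "?l \<in> lists D" using d(1) by auto
    ultimately show ?thesis by (intro bexI[of _ "?f ?l"] imageI)
  qed
  ultimately show ?thesis
    unfolding separable_def sequence_spaces by (intro exI[of _ ?C]) (auto simp: vdist_def)
qed


section \<open>Spaces of vector measures\<close>

lemma compact_closureI_finite_nets:
  fixes R :: "'x::banach set"
  assumes "\<And>e. e > 0 \<Longrightarrow> \<exists>K. finite K \<and> R \<subseteq> (\<Union>k\<in>K. cball k e)"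
  shows "compact (closure R)"
  unfolding compact_eq_totally_bounded
proof (intro conjI allI impI)
  show "complete (closure R)" by (simp add: complete_eq_closed)
  fix e :: real assume "e > 0"
  then obtain K where K: "finite K" "R \<subseteq> (\<Union>k\<in>K. cball k (e / 2))"
    using assms[of "e / 2"] by auto
  then have "closure R \<subseteq> (\<Union>k\<in>K. cball k (e / 2))"
    by (intro closure_minimal closed_UN) auto
  also have "\<dots> \<subseteq> (\<Union>k\<in>K. ball k e)" using \<open>e > 0\<close> by (force simp: mem_ball mem_cball)
  finally show "\<exists>k. finite k \<and> closure R \<subseteq> (\<Union>x\<in>k. ball x e)" using K(1) by blast
qed

lemma compact_closure_subset:
  fixes R :: "'x::metric_space set"
  assumes "compact K" "R \<subseteq> K"
  shows "compact (closure R)"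
proof -
  have "closure R \<subseteq> K" using assms by (intro closure_minimal compact_imp_closed)
  then have "closure R = K \<inter> closure R" by blast
  then show ?thesis using compact_Int_closed[OF assms(1) closed_closure, of R] by simp
qed

locale vector_measures = banach_space_over smul + A: sigma_algebra \<Omega> S
  for smul :: "'k::real_or_complex \<Rightarrow> 'x::banach \<Rightarrow> 'x" and \<Omega> :: "'a set" and S :: "'a set set"
begin

lemma vector_space: "vector_space smul"
  by unfold_locales

lemma ba_measuresD:
  assumes "F \<in> ba_measures S"
  shows "E \<notin> S \<Longrightarrow> F E = (0::'x)" "A \<in> S \<Longrightarrow> B \<in> S \<Longrightarrow> A \<inter> B = {} \<Longrightarrow> F (A \<union> B) = F A + F B"
    "bounded (F ` S)" "F {} = 0"
proof -
  show add: "A \<in> S \<Longrightarrow> B \<in> S \<Longrightarrow> A \<inter> B = {} \<Longrightarrow> F (A \<union> B) = F A + F B" for A B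
    using assms unfolding ba_measures_def by blast
  show "F {} = 0" using add[of "{}" "{}"] by simp
qed (use assms in \<open>auto simp: ba_measures_def\<close>)

lemma ba_measures_UN:
  assumes F: "F \<in> ba_measures S" and "finite I" "\<And>i. i \<in> I \<Longrightarrow> A i \<in> S" "disjoint_family_on A I"
  shows "F (\<Union>i\<in>I. A i) = (\<Sum>i\<in>I. F (A i) :: 'x)"
  using assms(2-)
proof (induction I rule: finite_induct)
  case (insert i I)
  have "F (\<Union>i\<in>insert i I. A i) = F (A i \<union> (\<Union>i\<in>I. A i))" by simp
  also have "\<dots> = F (A i) + F (\<Union>i\<in>I. A i)"
    using insert by (intro ba_measuresD(2)[OF F]) (auto simp: disjoint_family_on_def)
  also have "F (\<Union>i\<in>I. A i) = (\<Sum>i\<in>I. F (A i))"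
    using insert by (intro insert.IH) (auto simp: disjoint_family_on_def)
  finally show ?case using insert by simp
qed (simp add: ba_measuresD(4)[OF F])

lemma dual_unit_ballD:
  assumes "\<phi> \<in> dual_unit_ball smul"
  shows "\<phi> (x + y) = \<phi> x + \<phi> y" "\<phi> (smul c x) = c * \<phi> x" "norm (\<phi> x) \<le> norm x" "\<phi> 0 = 0"
    "\<phi> (sum f I) = (\<Sum>i\<in>I. \<phi> (f i))" "\<phi> (x - y) = \<phi> x - \<phi> y"
proof -
  interpret L: Vector_Spaces.linear smul "(*)" \<phi>
    using assms by (simp add: dual_unit_ball_def)
  show "\<phi> (x + y) = \<phi> x + \<phi> y" "\<phi> (smul c x) = c * \<phi> x" "\<phi> 0 = 0"
    "\<phi> (sum f I) = (\<Sum>i\<in>I. \<phi> (f i))" "\<phi> (x - y) = \<phi> x - \<phi> y"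
    by (simp_all add: L.add L.scale L.zero L.sum L.diff)
  show "norm (\<phi> x) \<le> norm x" using assms by (simp add: dual_unit_ball_def)
qed

lemma variation_leI:
  assumes "\<And>P. finite P \<Longrightarrow> P \<subseteq> S \<Longrightarrow> disjoint P \<Longrightarrow> (\<Sum>A\<in>P. norm (G A)) \<le> B"
  shows "variation S G E \<le> ennreal B"
  unfolding variation_def
proof (rule SUP_least)
  fix P assume "P \<in> {P. finite P \<and> P \<subseteq> S \<and> partition_on E P}"
  then have "(\<Sum>A\<in>P. norm (G A)) \<le> B" by (intro assms) (auto simp: partition_on_def)
  then show "(\<Sum>A\<in>P. ennreal (norm (G A))) \<le> ennreal B" by (simp add: ennreal_leI)
qed

text \<open>
  A disjoint family becomes a partition of \<open>E\<close> once the rest of \<open>E\<close> is added and the empty set,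
  which contributes nothing, is removed.
\<close>

lemma sum_le_variation:
  assumes P: "finite P" "P \<subseteq> S" "disjoint P" and G: "G {} = 0" and E: "\<Union>P \<subseteq> E" "E \<in> S"
  shows "ennreal (\<Sum>A\<in>P. norm (G A)) \<le> variation S G E"
proof -
  let ?R = "insert (E - \<Union>P) P - {{}}"
  have "ennreal (\<Sum>A\<in>P. norm (G A)) = ennreal (\<Sum>A\<in>P - {{}}. norm (G A))"
    using P(1) G by (intro arg_cong[of _ _ ennreal] sum.mono_neutral_right) auto
  also have "\<dots> \<le> ennreal (\<Sum>A\<in>?R. norm (G A))"
    using P(1) by (intro ennreal_leI sum_mono2) auto
  also have "\<dots> = (\<Sum>A\<in>?R. ennreal (norm (G A)))" by simp
  also have "\<dots> \<le> variation S G E"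
    unfolding variation_def
  proof (rule SUP_upper)
    have "\<Union>P \<in> S" using P by (intro A.finite_Union) auto
    then have "?R \<subseteq> S" using P E by auto
    moreover have "disjoint ?R"
      using P(3) unfolding pairwise_def disjnt_iff by blast
    then have "partition_on E ?R"
      using E(1) by (auto simp: partition_on_def)
    ultimately show "?R \<in> {P. finite P \<and> P \<subseteq> S \<and> partition_on E P}" using P(1) by auto
  qed
  finally show ?thesis .
qed

text \<open>
  The values over some subfamily have a sum of modulus at least a quarter of the sum of the moduli, and
  by additivity that sum is the single value at the union. This bounds the semivariation by \<open>4\<close> times
  the supremum.
\<close>

lemma sum_functional_le:
  assumes F: "F \<in> ba_measures S" and B: "\<And>E. E \<in> S \<Longrightarrow> norm (F E) \<le> B"
    and \<phi>: "\<phi> \<in> dual_unit_ball smul"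
    and I: "finite I" "\<And>i. i \<in> I \<Longrightarrow> A i \<in> S" "disjoint_family_on A I"
  shows "(\<Sum>i\<in>I. norm (\<phi> (F (A i)))) \<le> 4 * B"
proof -
  obtain J where J: "J \<subseteq> I" "(\<Sum>i\<in>I. norm (\<phi> (F (A i)))) \<le> 4 * norm (\<Sum>i\<in>J. \<phi> (F (A i)))"
    using ex_subset_sum_norm_le[OF I(1), of "\<lambda>i. \<phi> (F (A i))"] by blast
  have fin: "finite J" using finite_subset[OF J(1) I(1)] .
  have "F (\<Union>i\<in>J. A i) = (\<Sum>i\<in>J. F (A i))"
    using J(1) I(2) fin by (intro ba_measures_UN[OF F] disjoint_family_on_mono[OF _ I(3)]) auto
  then have *: "(\<Sum>i\<in>J. \<phi> (F (A i))) = \<phi> (F (\<Union>i\<in>J. A i))"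
    using dual_unit_ballD(5)[OF \<phi>, of "\<lambda>i. F (A i)" J] by simp
  have "(\<Union>i\<in>J. A i) \<in> S" using fin I(2) J(1) by (intro A.finite_UN) auto
  then have "norm (\<phi> (F (\<Union>i\<in>J. A i))) \<le> B"
    using B[of "\<Union>i\<in>J. A i"] dual_unit_ballD(3)[OF \<phi>, of "F (\<Union>i\<in>J. A i)"] by linarith
  then show ?thesis using J(2) unfolding * by linarith
qed

definition ba_norm :: "('a set \<Rightarrow> 'x) \<Rightarrow> real" where
  "ba_norm F = enn2real (semivariation smul S F \<Omega>)"

lemma measure_spaces:
  "ba_space smul \<Omega> S = fun_nspace smul (ba_measures S) ba_norm"
  "ca_space smul \<Omega> S = fun_nspace smul (ca_measures S) ba_norm"
  "cca_space smul \<Omega> S = fun_nspace smul (cca_measures S) ba_norm"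
  by (simp_all add: ba_space_def ca_space_def cca_space_def ba_norm_def[abs_def])

lemma ba_norm_nonneg: "ba_norm F \<ge> 0"
  by (simp add: ba_norm_def)

lemma semivariation_le:
  assumes "F \<in> ba_measures S" "\<And>E. E \<in> S \<Longrightarrow> norm (F E) \<le> B"
  shows "semivariation smul S F \<Omega> \<le> ennreal (4 * B)"
  unfolding semivariation_def
proof (intro SUP_least variation_leI)
  fix \<phi> P assume "\<phi> \<in> dual_unit_ball smul" "finite P" "P \<subseteq> S" "disjoint P"
  then show "(\<Sum>A\<in>P. norm ((\<phi> \<circ> F) A)) \<le> 4 * B"
    using sum_functional_le[OF assms, of \<phi> P "\<lambda>A. A"]
    by (auto simp: disjoint_family_on_def dest: disjointD)
qed

lemma ba_norm_le:
  assumes "F \<in> ba_measures S" "\<And>E. E \<in> S \<Longrightarrow> norm (F E) \<le> B"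
  shows "ba_norm F \<le> 4 * B"
proof -
  have "B \<ge> 0" using assms(2)[of "{}"] norm_ge_zero order_trans by blast
  then show ?thesis
    unfolding ba_norm_def using semivariation_le[OF assms] by (intro enn2real_leI) auto
qed

lemma sum_functional_le_ba_norm:
  assumes F: "F \<in> ba_measures S" and \<phi>: "\<phi> \<in> dual_unit_ball smul"
    and P: "finite P" "P \<subseteq> S" "disjoint P"
  shows "(\<Sum>A\<in>P. norm (\<phi> (F A))) \<le> ba_norm F"
proof -
  obtain B where B: "\<And>E. E \<in> S \<Longrightarrow> norm (F E) \<le> B"
    using ba_measuresD(3)[OF F] unfolding bounded_iff by blast
  have "ennreal (\<Sum>A\<in>P. norm ((\<phi> \<circ> F) A)) \<le> variation S (\<phi> \<circ> F) \<Omega>"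
    using P A.sets_into_space
    by (intro sum_le_variation) (auto simp: ba_measuresD(4)[OF F] dual_unit_ballD(4)[OF \<phi>])
  also have "\<dots> \<le> semivariation smul S F \<Omega>"
    unfolding semivariation_def using \<phi> by (rule SUP_upper)
  finally have le: "ennreal (\<Sum>A\<in>P. norm (\<phi> (F A))) \<le> semivariation smul S F \<Omega>" by simp
  moreover have "semivariation smul S F \<Omega> < top"
    using semivariation_le[OF F B] by (metis ennreal_less_top le_less_trans)
  ultimately have "enn2real (ennreal (\<Sum>A\<in>P. norm (\<phi> (F A)))) \<le> ba_norm F"
    unfolding ba_norm_def by (intro enn2real_mono)
  then show ?thesis by (simp add: sum_nonneg)
qed

lemma norm_functional_le_ba_norm:
  assumes "F \<in> ba_measures S" "\<phi> \<in> dual_unit_ball smul" "A \<in> S"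
  shows "norm (\<phi> (F A)) \<le> ba_norm F"
  using sum_functional_le_ba_norm[OF assms(1,2), of "{A}"] assms(3) by simp

lemma continuous_smul: "continuous_on UNIV (\<lambda>x. smul c x)"
proof -
  have "bounded_linear (\<lambda>x. smul c x)"
    by (rule bounded_linear_intro[where K = "norm c"])
      (auto simp: scale_right_distrib smul_scaleR norm_scale mult.commute)
  then show ?thesis by (rule linear_continuous_on)
qed

lemma tendsto_smul:
  assumes "(f \<longlongrightarrow> l) F"
  shows "((\<lambda>x. smul c (f x)) \<longlongrightarrow> smul c l) F"
  by (rule tendsto_compose[OF _ assms])
    (use continuous_smul in \<open>simp add: continuous_on_eq_continuous_at isCont_def\<close>)

lemma fun_subspace_ba: "fun_subspace smul (ba_measures S)"
  unfolding fun_subspace_def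
proof (intro conjI ballI allI)
  show "(\<lambda>i. 0) \<in> (ba_measures S :: ('a set \<Rightarrow> 'x) set)" by (auto simp: ba_measures_def bounded_iff)
next
  fix F G :: "'a set \<Rightarrow> 'x" assume FG: "F \<in> ba_measures S" "G \<in> ba_measures S"
  then have "bounded ((\<lambda>E. F E + G E) ` S)"
    unfolding ba_measures_def by (auto intro: bounded_plus_comp)
  then show "(\<lambda>i. F i + G i) \<in> ba_measures S"
    using FG by (auto simp: ba_measures_def)
next
  fix c and F :: "'a set \<Rightarrow> 'x" assume F: "F \<in> ba_measures S"
  then obtain B where B: "\<And>E. E \<in> S \<Longrightarrow> norm (F E) \<le> B"
    using ba_measuresD(3)[OF F] unfolding bounded_iff by blast
  have "norm (smul c (F E)) \<le> norm c * B" if "E \<in> S" for E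
    using B[OF that] by (simp add: norm_scale mult_left_mono)
  then have "bounded ((\<lambda>E. smul c (F E)) ` S)" unfolding bounded_iff by blast
  then show "(\<lambda>i. smul c (F i)) \<in> ba_measures S"
    using F by (auto simp: ba_measures_def scale_right_distrib)
qed

lemma sums_smul:
  assumes "f sums s"
  shows "(\<lambda>n. smul c (f n)) sums smul c s"
  using tendsto_smul[OF assms[unfolded sums_def], of c] by (simp add: sums_def scale_sum_right)

lemma fun_subspace_ca: "fun_subspace smul (ca_measures S)"
  using fun_subspaceD[OF fun_subspace_ba] unfolding fun_subspace_def ca_measures_def
  by (auto intro: sums_add sums_smul)

lemma fun_subspace_cca: "fun_subspace smul (cca_measures S)"
  unfolding fun_subspace_def
proof (intro conjI ballI allI)
  show "(\<lambda>i. 0) \<in> (cca_measures S :: ('a set \<Rightarrow> 'x) set)"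
    using fun_subspaceD(1)[OF fun_subspace_ca] A.empty_sets by (auto simp: cca_measures_def image_constant_conv)
next
  fix F G :: "'a set \<Rightarrow> 'x" assume FG: "F \<in> cca_measures S" "G \<in> cca_measures S"
  then have c: "compact (closure (F ` S))" "compact (closure (G ` S))" by (auto simp: cca_measures_def)
  let ?K = "{x + y |x y. x \<in> closure (F ` S) \<and> y \<in> closure (G ` S)}"
  have "compact ?K" using c by (rule compact_sums)
  moreover have "(\<lambda>i. F i + G i) ` S \<subseteq> ?K"
  proof (rule image_subsetI)
    fix E assume "E \<in> S"
    then have "F E \<in> closure (F ` S)" "G E \<in> closure (G ` S)"
      using closure_subset[of "F ` S"] closure_subset[of "G ` S"] by auto
    then show "F E + G E \<in> ?K" by blast
  qed
  ultimately have "compact (closure ((\<lambda>i. F i + G i) ` S))"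
    by (rule compact_closure_subset)
  then show "(\<lambda>i. F i + G i) \<in> cca_measures S"
    using FG fun_subspaceD(2)[OF fun_subspace_ca] by (simp add: cca_measures_def)
next
  fix c and F :: "'a set \<Rightarrow> 'x" assume F: "F \<in> cca_measures S"
  let ?K = "(\<lambda>x. smul c x) ` closure (F ` S)"
  have "compact ?K"
    using F continuous_smul by (intro compact_continuous_image)
      (auto simp: cca_measures_def intro: continuous_on_subset)
  moreover have "(\<lambda>i. smul c (F i)) ` S \<subseteq> ?K" using closure_subset[of "F ` S"] by auto
  ultimately have "compact (closure ((\<lambda>i. smul c (F i)) ` S))"
    by (rule compact_closure_subset)
  then show "(\<lambda>i. smul c (F i)) \<in> cca_measures S"
    using F fun_subspaceD(3)[OF fun_subspace_ca] by (simp add: cca_measures_def)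
qed

text \<open>
  Countable additivity is continuity at the empty set: the tails of a disjoint sequence decrease to
  the empty set.
\<close>

lemma ca_measuresI:
  assumes F: "F \<in> ba_measures S"
    and cont: "\<And>B. range B \<subseteq> S \<Longrightarrow> decseq B \<Longrightarrow> (\<Inter>n. B n) = {} \<Longrightarrow> (\<lambda>n::nat. F (B n)) \<longlonglongrightarrow> (0::'x)"
  shows "F \<in> ca_measures S"
  unfolding ca_measures_def
proof (intro CollectI conjI allI impI)
  fix A :: "nat \<Rightarrow> 'a set" assume A: "range A \<subseteq> S" "disjoint_family A"
  let ?B = "\<lambda>n. (\<Union>i\<in>{n..}. A i)"
  have UN: "(\<Union>n. A n) \<in> S" "?B n \<in> S" "(\<Union>i<n. A i) \<in> S" for n using A(1) by auto
  have "(\<Inter>n. ?B n) = {}"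
  proof safe
    fix x assume "x \<in> (\<Inter>n. ?B n)"
    then obtain i where i: "x \<in> A i" by blast
    moreover have "x \<in> ?B (Suc i)" using \<open>x \<in> (\<Inter>n. ?B n)\<close> by blast
    then obtain j where "j \<ge> Suc i" "x \<in> A j" by blast
    moreover from this have "A i \<inter> A j = {}" using A(2) by (auto simp: disjoint_family_on_def)
    ultimately show "x \<in> {}" by blast
  qed
  moreover have "decseq ?B" unfolding decseq_def by force
  ultimately have "(\<lambda>n. F (?B n)) \<longlonglongrightarrow> 0" using UN by (intro cont) auto
  moreover have "F (?B n) = F (\<Union>n. A n) - (\<Sum>i<n. F (A i))" for n
  proof -
    have "(\<Union>n. A n) = ?B n \<union> (\<Union>i<n. A i)"
      unfolding UN_Un[symmetric] by (intro arg_cong[of _ _ "\<lambda>I. \<Union>i\<in>I. A i"]) auto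
    moreover have "F (?B n \<union> (\<Union>i<n. A i)) = F (?B n) + F (\<Union>i<n. A i)"
    proof (rule ba_measuresD(2)[OF F UN(2,3)])
      have "A i \<inter> A j = {}" if "i \<ge> n" "j < n" for i j
        using A(2) that by (auto simp: disjoint_family_on_def)
      then show "?B n \<inter> (\<Union>i<n. A i) = {}" by (auto simp: disjoint_iff)
    qed
    moreover have "F (\<Union>i<n. A i) = (\<Sum>i<n. F (A i))"
      using A by (intro ba_measures_UN[OF F]) (auto simp: disjoint_family_on_def)
    ultimately show ?thesis by simp
  qed
  ultimately have "(\<lambda>n. F (\<Union>n. A n) - (\<Sum>i<n. F (A i))) \<longlonglongrightarrow> 0" by simp
  then have "(\<lambda>n. F (\<Union>n. A n) - (F (\<Union>n. A n) - (\<Sum>i<n. F (A i)))) \<longlonglongrightarrow> F (\<Union>n. A n) - 0"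
    by (intro tendsto_diff tendsto_const)
  then show "(\<lambda>n. F (A n)) sums F (\<Union>n. A n)" by (simp add: sums_def)
qed (rule F)

lemma ca_subset_ba: "ca_measures S \<subseteq> ba_measures S"
  and cca_subset_ca: "cca_measures S \<subseteq> ca_measures S"
  by (auto simp: ca_measures_def cca_measures_def)

text \<open>
  The measure obtained by putting the mass \<open>G {n}\<close> at the point \<open>w n\<close>. Smallness of \<open>G\<close> on sets of
  large indices gives both countable additivity and relative compactness of the range.
\<close>

definition point_masses :: "(nat \<Rightarrow> 'a) \<Rightarrow> (nat set \<Rightarrow> 'x) \<Rightarrow> 'a set \<Rightarrow> 'x" where
  "point_masses w G E = (if E \<in> S then G {n. w n \<in> E} else 0)"

lemma point_masses_cca:
  assumes add: "\<And>A B. A \<inter> B = {} \<Longrightarrow> G (A \<union> B) = G A + G B"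
    and tail: "\<And>e. e > 0 \<Longrightarrow> \<exists>N. \<forall>A\<subseteq>{N..}. norm (G A) < e"
  shows "point_masses w G \<in> cca_measures S"
proof -
  have range: "point_masses w G ` S \<subseteq> range G" by (auto simp: point_masses_def)
  have comp: "compact (closure (range G))"
  proof (rule compact_closureI_finite_nets)
    fix e :: real assume "e > 0"
    then obtain N where N: "\<And>A. A \<subseteq> {N..} \<Longrightarrow> norm (G A) < e" using tail by blast
    have "G A \<in> cball (G (A \<inter> {..<N})) e" for A
    proof -
      have "(A \<inter> {..<N}) \<union> (A \<inter> {N..}) = A" by auto
      moreover have "(A \<inter> {..<N}) \<inter> (A \<inter> {N..}) = {}" by auto
      ultimately have "G A = G (A \<inter> {..<N}) + G (A \<inter> {N..})"
        using add[of "A \<inter> {..<N}" "A \<inter> {N..}"] by (simp only:)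
      moreover have "norm (G (A \<inter> {N..})) < e" by (rule N) simp
      ultimately have "norm (G A - G (A \<inter> {..<N})) < e" by (simp only: add_diff_cancel_left')
      then show ?thesis by (simp add: dist_norm norm_minus_commute)
    qed
    moreover have "G (A \<inter> {..<N}) \<in> G ` Pow {..<N}" for A by (intro imageI) simp
    ultimately have "range G \<subseteq> (\<Union>k\<in>G ` Pow {..<N}. cball k e)" by (intro image_subsetI UN_I)
    then show "\<exists>K. finite K \<and> range G \<subseteq> (\<Union>k\<in>K. cball k e)" 
      by (intro exI[of _ "G ` Pow {..<N}"]) simp
  qed
  then have "compact (closure (point_masses w G ` S))"
    using range closure_subset by (intro compact_closure_subset[OF comp]) blast
  moreover have "bounded (point_masses w G ` S)"
    using comp range by (meson bounded_subset closure_subset compact_imp_bounded order_trans)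
  then have ba: "point_masses w G \<in> ba_measures S"
    unfolding ba_measures_def
  proof (intro CollectI conjI ballI allI impI)
    fix A B assume AB: "A \<in> S" "B \<in> S" "A \<inter> B = {}"
    have "{n. w n \<in> A \<union> B} = {n. w n \<in> A} \<union> {n. w n \<in> B}" by blast
    moreover have "{n. w n \<in> A} \<inter> {n. w n \<in> B} = {}" using AB(3) by blast
    ultimately show "point_masses w G (A \<union> B) = point_masses w G A + point_masses w G B"
      using AB A.Un[OF AB(1,2)] by (simp add: point_masses_def add)
  qed (simp add: point_masses_def)
  have "point_masses w G \<in> ca_measures S"
  proof (rule ca_measuresI[OF ba])
    fix B :: "nat \<Rightarrow> 'a set" assume B: "range B \<subseteq> S" "decseq B" "(\<Inter>n. B n) = {}"
    show "(\<lambda>n. point_masses w G (B n)) \<longlonglongrightarrow> 0"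
    proof (rule LIMSEQ_I)
      fix e :: real assume "e > 0"
      then obtain N where N: "\<And>A. A \<subseteq> {N..} \<Longrightarrow> norm (G A) < e" using tail by blast
      have "\<exists>m. w k \<notin> B m" for k using B(3) by blast
      then obtain m where m: "\<And>k. w k \<notin> B (m k)" by metis
      let ?M = "Max (m ` {..<N} \<union> {0})"
      have "{k. w k \<in> B n} \<subseteq> {N..}" if "n \<ge> ?M" for n
      proof
        fix k assume "k \<in> {k. w k \<in> B n}"
        then have k: "w k \<in> B n" by simp
        show "k \<in> {N..}"
        proof (rule ccontr)
          assume "k \<notin> {N..}"
          then have "m k \<le> ?M" by (intro Max_ge) auto
          then have "B n \<subseteq> B (m k)" using that by (intro decseqD[OF B(2)]) (rule order_trans)
          then show False using k m by blast
        qed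
      qed
      then show "\<exists>no. \<forall>n\<ge>no. norm (point_masses w G (B n) - 0) < e"
        using N \<open>e > 0\<close> by (intro exI[of _ ?M]) (auto simp: point_masses_def)
    qed
  qed
  ultimately show ?thesis by (simp add: cca_measures_def)
qed

lemma ex_separated_points:
  assumes "nontrivial_sigma_algebra S"
  obtains D :: "nat \<Rightarrow> 'a set" and w where "\<And>n. D n \<in> S" "disjoint_family D" "\<And>n m. w n \<in> D m \<longleftrightarrow> n = m"
proof -
  obtain \<D> where \<D>: "\<D> \<subseteq> S" "infinite \<D>" "disjoint \<D>" "{} \<notin> \<D>"
    using assms unfolding nontrivial_sigma_algebra_def by blast
  then obtain D :: "nat \<Rightarrow> 'a set" where D: "inj D" "range D \<subseteq> \<D>"
    using infinite_countable_subset by blast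
  have dis: "disjoint_family D"
    unfolding disjoint_family_on_def using D \<D>(3) by (metis disjointD injD range_subsetD)
  have "\<exists>x. x \<in> D n" for n using D \<D>(4) by (metis ex_in_conv range_subsetD)
  then obtain w where "\<And>n. w n \<in> D n" by metis
  then have "w n \<in> D m \<longleftrightarrow> n = m" for n m
    using dis by (auto simp: disjoint_family_on_def)
  then show thesis using that D \<D>(1) dis by blast
qed

end


section \<open>Quotients isomorphic to \<open>\<ell>\<^sub>1\<close> and complemented copies of \<open>c\<^sub>0\<close>\<close>

definition restrict_seq :: "nat set \<Rightarrow> (nat \<Rightarrow> 'k::real_or_complex) \<Rightarrow> nat \<Rightarrow> 'k" where
  "restrict_seq A a n = (if n \<in> A then a n else 0)"

lemma restrict_seq_add:
  assumes "A \<inter> B = {}"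
  shows "restrict_seq (A \<union> B) a = (\<lambda>n. restrict_seq A a n + restrict_seq B a n)"
  using assms by (auto simp: restrict_seq_def fun_eq_iff)

lemma norm_restrict_seq_le: "norm (restrict_seq A a n) \<le> norm (a n)"
  by (simp add: restrict_seq_def)

lemma restrict_seq_l1: "a \<in> l1_seqs \<Longrightarrow> restrict_seq A a \<in> l1_seqs"
  unfolding l1_seqs_def mem_Collect_eq
  by (erule summable_comparison_test'[where N = 0]) (simp add: norm_restrict_seq_le)

lemma restrict_seq_c0: "a \<in> c0_seqs \<Longrightarrow> restrict_seq A a \<in> c0_seqs"
  unfolding c0_seqs_def mem_Collect_eq
  by (erule Lim_null_comparison[rotated, OF tendsto_norm_zero]) (simp add: norm_restrict_seq_le)

context vector_measures
begin

text \<open>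
  Placed at points \<open>w n\<close>, these masses form the scalar measure \<open>\<Sum>n a n \<delta>\<^bsub>w n\<^esub>\<close> in the direction \<open>u\<close>. It
  lies in every space of measures considered here, which is why all of them have \<open>\<ell>\<^sub>1\<close> as a quotient.
\<close>

definition l1_mass :: "'x \<Rightarrow> (nat \<Rightarrow> 'k) \<Rightarrow> nat set \<Rightarrow> 'x" where
  "l1_mass u a A = smul (\<Sum>n. restrict_seq A a n) u"

lemma norm_suminf_restrict_le:
  assumes "a \<in> l1_seqs" "A \<subseteq> {N..}"
  shows "norm (\<Sum>n. restrict_seq A a n) \<le> (\<Sum>n. norm (a (n + N)))"
proof -
  have s: "summable (\<lambda>n. norm (restrict_seq A a n))" "summable (\<lambda>n. norm (a n))"
    using assms restrict_seq_l1 by (auto simp: l1_seqs_def)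
  have "norm (\<Sum>n. restrict_seq A a n) \<le> (\<Sum>n. norm (restrict_seq A a n))"
    using s(1) by (rule summable_norm)
  also have "\<dots> = (\<Sum>n. norm (restrict_seq A a (n + N))) + (\<Sum>n<N. norm (restrict_seq A a n))"
    using s(1) by (rule suminf_split_initial_segment)
  also have "(\<Sum>n<N. norm (restrict_seq A a n)) = 0"
    using assms(2) by (intro sum.neutral) (auto simp: restrict_seq_def)
  also have "(\<Sum>n. norm (restrict_seq A a (n + N))) \<le> (\<Sum>n. norm (a (n + N)))"
    using summable_ignore_initial_segment[OF s(1), of N] summable_ignore_initial_segment[OF s(2), of N]
    by (intro suminf_le norm_restrict_seq_le)
  finally show ?thesis by simp
qed

lemma norm_l1_mass_le:
  assumes "a \<in> l1_seqs"
  shows "norm (l1_mass u a A) \<le> norm u * l1_norm a"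
  using mult_left_mono[OF norm_suminf_restrict_le[OF assms, of A 0] norm_ge_zero[of u]]
  by (simp add: l1_mass_def norm_scale l1_norm_def mult.commute)

lemma l1_mass_add:
  assumes "a \<in> l1_seqs" "A \<inter> B = {}"
  shows "l1_mass u a (A \<union> B) = l1_mass u a A + l1_mass u a B"
proof -
  have "summable (restrict_seq A a)" for A
    using restrict_seq_l1[OF assms(1)] by (simp add: l1_seqs_def summable_norm_cancel)
  then have "(\<Sum>n. restrict_seq (A \<union> B) a n) = (\<Sum>n. restrict_seq A a n) + (\<Sum>n. restrict_seq B a n)"
    unfolding restrict_seq_add[OF assms(2)] by (intro suminf_add[symmetric])
  then show ?thesis by (simp add: l1_mass_def scale_left_distrib)
qed

lemma point_masses_l1_cca:
  assumes "a \<in> l1_seqs"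
  shows "point_masses w (l1_mass u a) \<in> cca_measures S"
proof (rule point_masses_cca)
  fix e :: real assume e: "e > 0"
  have "\<exists>N. \<forall>n\<ge>N. norm (\<Sum>i. norm (a (i + n))) < e / (norm u + 1)"
    using assms e by (intro suminf_exist_split) (auto simp: l1_seqs_def add_nonneg_pos)
  then obtain N where N: "(\<Sum>i. norm (a (i + N))) < e / (norm u + 1)"
    by (auto simp: abs_less_iff)
  have pos: "norm u + 1 > 0" by (simp add: add_nonneg_pos)
  have "norm (l1_mass u a A) < e" if "A \<subseteq> {N..}" for A
  proof -
    have "norm (l1_mass u a A) \<le> norm (\<Sum>n. restrict_seq A a n) * (norm u + 1)"
      by (simp add: l1_mass_def norm_scale mult_left_mono)
    also have "\<dots> \<le> (\<Sum>i. norm (a (i + N))) * (norm u + 1)"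
      using norm_suminf_restrict_le[OF assms that] pos by (intro mult_right_mono) auto
    also have "\<dots> < e" using N pos by (simp add: field_simps)
    finally show ?thesis .
  qed
  then show "\<exists>N. \<forall>A\<subseteq>{N..}. norm (l1_mass u a A) < e" by blast
qed (rule l1_mass_add[OF assms])

text \<open>
  Evaluation at the disjoint sets \<open>D n\<close> lands in \<open>\<ell>\<^sub>1\<close> since scalar measures have finite variation,
  and point masses in the \<open>D n\<close> provide bounded preimages.
\<close>

lemma quotient_operator_l1:
  assumes D: "\<And>n. D n \<in> S" "disjoint_family D" "\<And>n m. w n \<in> D m \<longleftrightarrow> n = m"
    and \<phi>: "\<phi> \<in> dual_unit_ball smul" "\<phi> u = 1"
    and V: "fun_subspace smul V" and nonneg: "\<And>F. F \<in> V \<Longrightarrow> N F \<ge> 0"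
    and bound: "\<And>F P. F \<in> V \<Longrightarrow> finite P \<Longrightarrow> P \<subseteq> S \<Longrightarrow> disjoint P \<Longrightarrow> (\<Sum>A\<in>P. norm (\<phi> (F A))) \<le> N F"
    and mass: "\<And>a. a \<in> l1_seqs \<Longrightarrow> point_masses w (l1_mass u a) \<in> V"
      "\<And>a. a \<in> l1_seqs \<Longrightarrow> N (point_masses w (l1_mass u a)) \<le> C * l1_norm a"
  shows "quotient_operator smul (*) V N l1_seqs l1_norm (\<lambda>F n. \<phi> (F (D n))) C"
proof
  interpret sc: vector_space "(*) :: 'k \<Rightarrow> 'k \<Rightarrow> 'k" by (rule vector_space_scalars)
  have D0: "D n \<noteq> {}" for n using D(3)[of n n] by blast
  have injD: "inj D"
    using D(2) D0 by (auto simp: inj_def disjoint_family_on_def) (metis Int_absorb)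
  have fin_bound: "(\<Sum>n<m. norm (\<phi> (F (D n)))) \<le> N F" if "F \<in> V" for F m
  proof -
    have "(\<Sum>n<m. norm (\<phi> (F (D n)))) = (\<Sum>A\<in>D ` {..<m}. norm (\<phi> (F A)))"
      by (subst sum.reindex) (auto intro: inj_on_subset[OF injD])
    also have "\<dots> \<le> N F"
      using D(1) disjoint_family_on_disjoint_image[OF disjoint_family_on_mono[OF _ D(2)]]
      by (intro bound that) auto
    finally show ?thesis .
  qed
  have summable: "summable (\<lambda>n. norm (\<phi> (F (D n))))" if "F \<in> V" for F
    using fin_bound[OF that] by (intro summableI_nonneg_bounded) auto
  show "bounded_operator (fun_nspace smul V N) (fun_nspace (*) l1_seqs l1_norm) (\<lambda>F n. \<phi> (F (D n)))"
    unfolding bounded_operator_fun_nspace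
  proof (intro conjI ballI allI)
    show "(\<lambda>n. \<phi> (F (D n))) \<in> l1_seqs" if "F \<in> V" for F
      using summable[OF that] by (simp add: l1_seqs_def)
    show "\<exists>C. \<forall>F\<in>V. l1_norm (\<lambda>n. \<phi> (F (D n))) \<le> C * N F"
      unfolding l1_norm_def using summable fin_bound by (intro exI[of _ 1]) (auto intro!: suminf_le_const)
  qed (auto simp: dual_unit_ballD[OF \<phi>(1)])
  fix a :: "nat \<Rightarrow> 'k" assume a: "a \<in> l1_seqs"
  have "\<phi> (point_masses w (l1_mass u a) (D n)) = a n" for n
  proof -
    have "(\<Sum>m. restrict_seq {n} a m) = (\<Sum>m\<in>{n}. restrict_seq {n} a m)"
      by (rule suminf_finite) (auto simp: restrict_seq_def)
    then have "(\<Sum>m. restrict_seq {n} a m) = a n" by (simp add: restrict_seq_def)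
    then show ?thesis using D by (simp add: point_masses_def l1_mass_def dual_unit_ballD[OF \<phi>(1)] \<phi>(2))
  qed
  then show "\<exists>F\<in>V. (\<lambda>n. \<phi> (F (D n))) = a \<and> N F \<le> C * l1_norm a"
    using mass[OF a] by (intro bexI[of _ "point_masses w (l1_mass u a)"]) auto
qed (use V fun_subspace_l1 l1_norm_definite nonneg vector_space vector_space_scalars in auto)

lemma ex_functional_eq_1:
  assumes "x \<noteq> (0::'x)"
  shows "\<exists>\<phi>\<in>dual_unit_ball smul. \<exists>u. \<phi> u = 1"
proof -
  obtain \<phi> where \<phi>: "\<phi> \<in> dual_unit_ball smul" "\<phi> x = of_real (norm x)"
    using ex_norming_functional by blast
  then have "\<phi> (smul (inverse (\<phi> x)) x) = 1" using assms by (simp add: dual_unit_ballD[OF \<phi>(1)])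
  then show ?thesis using \<phi>(1) by blast
qed

text \<open>
  In the semivariation norm, the values of \<open>\<phi> \<circ> F\<close> on disjoint sets are summable with sum at most
  \<open>ba_norm F\<close>, which makes the evaluation operator bounded into \<open>\<ell>\<^sub>1\<close>.
\<close>

lemma quotient_operator_l1_ba:
  assumes "nontrivial_sigma_algebra S" "(x::'x) \<noteq> 0"
    and V: "cca_measures S \<subseteq> V" "V \<subseteq> ba_measures S" "fun_subspace smul V"
  shows "\<exists>T C. quotient_operator smul (*) V ba_norm l1_seqs l1_norm T C"
proof -
  obtain D and w where D: "\<And>n. D n \<in> S" "disjoint_family D" "\<And>n m. w n \<in> D m \<longleftrightarrow> n = (m::nat)"
    using ex_separated_points[OF assms(1)] by metis
  obtain \<phi> u where \<phi>: "\<phi> \<in> dual_unit_ball smul" "\<phi> u = 1"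
    using ex_functional_eq_1[OF assms(2)] by blast
  have mass: "point_masses w (l1_mass u a) \<in> V"
    "ba_norm (point_masses w (l1_mass u a)) \<le> (4 * norm u) * l1_norm a" if "a \<in> l1_seqs" for a
  proof -
    show 1: "point_masses w (l1_mass u a) \<in> V" using point_masses_l1_cca[OF that] V(1) by blast
    have "norm (point_masses w (l1_mass u a) E) \<le> norm u * l1_norm a" for E
      using norm_l1_mass_le[OF that, of u] l1_norm_nonneg[OF that] by (simp add: point_masses_def)
    then have "ba_norm (point_masses w (l1_mass u a)) \<le> 4 * (norm u * l1_norm a)"
      using 1 V(2) by (intro ba_norm_le) auto
    then show "ba_norm (point_masses w (l1_mass u a)) \<le> (4 * norm u) * l1_norm a" by simp
  qed
  have "quotient_operator smul (*) V ba_norm l1_seqs l1_norm (\<lambda>F n. \<phi> (F (D n))) (4 * norm u)"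
    using D \<phi> V(3) ba_norm_nonneg _ mass
  proof (rule quotient_operator_l1)
    show "(\<Sum>A\<in>P. norm (\<phi> (F A))) \<le> ba_norm F"
      if "F \<in> V" "finite P" "P \<subseteq> S" "disjoint P" for F P
      using that V(2) \<phi>(1) by (intro sum_functional_le_ba_norm) auto
  qed
  then show ?thesis by blast
qed

end

text \<open>
  A copy of \<open>c\<^sub>0\<close> is used through the isomorphism \<open>J\<close> onto it and Hahn-Banach extensions \<open>\<psi> n\<close> of the
  coordinate functionals; \<open>J\<close> is scaled so that the \<open>\<psi> n\<close> lie in the dual unit ball.
\<close>

locale vector_measures_c0 = vector_measures smul \<Omega> S
  for smul :: "'k::real_or_complex \<Rightarrow> 'x::banach \<Rightarrow> 'x" and \<Omega> :: "'a set" and S :: "'a set set" +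
  fixes J :: "(nat \<Rightarrow> 'k) \<Rightarrow> 'x" and \<psi> :: "nat \<Rightarrow> 'x \<Rightarrow> 'k" and C :: real
  assumes J_add: "\<And>a b. a \<in> c0_seqs \<Longrightarrow> b \<in> c0_seqs \<Longrightarrow> J (\<lambda>i. a i + b i) = J a + J b"
    and J_scale: "\<And>a c. a \<in> c0_seqs \<Longrightarrow> J (\<lambda>i. c * a i) = smul c (J a)"
    and J_bound: "\<And>a. a \<in> c0_seqs \<Longrightarrow> norm (J a) \<le> C * sup_norm a" and C_nonneg: "C \<ge> 0"
    and \<psi>: "\<And>n. \<psi> n \<in> dual_unit_ball smul" and \<psi>_J: "\<And>a n. a \<in> c0_seqs \<Longrightarrow> \<psi> n (J a) = a n"

lemma (in vector_measures) ex_vector_measures_c0: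
  assumes "contains_copy (type_nspace smul) (c0_space :: ('k, nat \<Rightarrow> 'k) nspace)"
  shows "\<exists>J \<psi> C. vector_measures_c0 smul \<Omega> S J \<psi> C"
proof -
  obtain M T I where M: "linear_subspace (type_nspace smul) M"
      and T: "bounded_operator ((type_nspace smul)\<lparr>vcarrier := M\<rparr>) (c0_space :: ('k, nat \<Rightarrow> 'k) nspace) T"
      and I: "bounded_operator (c0_space :: ('k, nat \<Rightarrow> 'k) nspace) ((type_nspace smul)\<lparr>vcarrier := M\<rparr>) I"
      and TI: "\<And>a :: nat \<Rightarrow> 'k. a \<in> c0_seqs \<Longrightarrow> T (I a) = a"
    using assms unfolding contains_copy_def isomorphic_nspace_def by (auto simp: sequence_spaces)
  have sub: "subspace M"
    using M by (simp add: linear_subspace_def type_nspace_def subspace_def)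
  have T1: "T x \<in> c0_seqs" if "x \<in> M" for x
    using T that by (simp add: bounded_operator_def type_nspace_def sequence_spaces)
  have T2: "T (x + y) = (\<lambda>i. T x i + T y i)" if "x \<in> M" "y \<in> M" for x y
    using T that by (simp add: bounded_operator_def type_nspace_def sequence_spaces)
  have T3: "T (smul c x) = (\<lambda>i. c * T x i)" if "x \<in> M" for c x
    using T that by (simp add: bounded_operator_def type_nspace_def sequence_spaces)
  have "\<exists>K. \<forall>x\<in>M. sup_norm (T x) \<le> K * norm x"
    using T by (simp add: bounded_operator_def type_nspace_def sequence_spaces)
  then obtain K where K: "\<And>x. x \<in> M \<Longrightarrow> sup_norm (T x) \<le> K * norm x" by blast
  have I1: "I a \<in> M" if "a \<in> c0_seqs" for a
    using I that by (simp add: bounded_operator_def type_nspace_def sequence_spaces)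
  have I2: "I (\<lambda>i. a i + b i) = I a + I b" if "a \<in> c0_seqs" "b \<in> c0_seqs" for a b
    using I that by (simp add: bounded_operator_def type_nspace_def sequence_spaces)
  have I3: "I (\<lambda>i. c * a i) = smul c (I a)" if "a \<in> c0_seqs" for a c
    using I that by (simp add: bounded_operator_def type_nspace_def sequence_spaces)
  have "\<exists>C. \<forall>a\<in>c0_seqs. norm (I a) \<le> C * sup_norm a"
    using I by (simp add: bounded_operator_def type_nspace_def sequence_spaces)
  then obtain C where C: "\<And>a. a \<in> c0_seqs \<Longrightarrow> norm (I a) \<le> C * sup_norm a" by blast
  define L where "L = \<bar>K\<bar> + 1"
  have L: "L > 0" unfolding L_def by linarith
  have "\<exists>g. Vector_Spaces.linear smul (*) g \<and> (\<forall>x\<in>M. g x = T x n / of_real L) \<and>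
      (\<forall>x. norm (g x) \<le> 1 * norm x)" for n
  proof (rule hahn_banach[OF sub])
    fix x assume x: "x \<in> M"
    have "norm (T x n) \<le> sup_norm (T x)" using T1[OF x] c0_subset_linf by (intro norm_le_sup_norm) auto
    also have "\<dots> \<le> K * norm x" using K x .
    also have "\<dots> \<le> L * norm x" unfolding L_def by (intro mult_right_mono) auto
    finally show "norm (T x n / of_real L) \<le> 1 * norm x"
      using L by (simp add: norm_divide field_simps)
  qed (auto simp: T2 T3 add_divide_distrib)
  then have "\<exists>g. g \<in> dual_unit_ball smul \<and> (\<forall>x\<in>M. g x = T x n / of_real L)" for n
    unfolding dual_unit_ball_def mem_Collect_eq mult_1_left by meson
  then obtain \<psi> where \<psi>: "\<And>n. \<psi> n \<in> dual_unit_ball smul" "\<And>n x. x \<in> M \<Longrightarrow> \<psi> n x = T x n / of_real L"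
    by metis
  have "vector_measures_c0 smul \<Omega> S (\<lambda>a. smul (of_real L) (I a)) \<psi> (L * \<bar>C\<bar>)"
  proof
    fix a :: "nat \<Rightarrow> 'k" assume a: "a \<in> c0_seqs"
    have "norm (I a) \<le> \<bar>C\<bar> * sup_norm a"
      using C[OF a] sup_norm_nonneg[of a] a c0_subset_linf
      by (meson abs_ge_self mult_right_mono order_trans subsetD)
    then show "norm (smul (of_real L) (I a)) \<le> L * \<bar>C\<bar> * sup_norm a"
      using L by (simp add: norm_scale mult.assoc)
    show "\<psi> n (smul (of_real L) (I a)) = a n" for n
      using \<psi>(2)[OF I1[OF a], of n] TI[OF a] L by (simp add: dual_unit_ballD[OF \<psi>(1)])
    show "smul (of_real L) (I (\<lambda>i. c * a i)) = smul c (smul (of_real L) (I a))" for c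
      by (simp add: I3[OF a] mult.commute)
  qed (use L \<psi>(1) in \<open>auto simp: I2 scale_right_distrib\<close>)
  then show ?thesis by blast
qed

context vector_measures_c0
begin

lemma sup_norm_restrict_le: "a \<in> linf_seqs \<Longrightarrow> sup_norm (restrict_seq A a) \<le> sup_norm a"
  using norm_restrict_seq_le norm_le_sup_norm order_trans by (intro sup_norm_le) blast

text \<open>
  The measures \<open>\<Sum>n a n J(e n) \<delta>\<^bsub>w n\<^esub>\<close> form a copy of \<open>c\<^sub>0\<close>, and the functionals \<open>F \<mapsto> \<psi> n (F (D n))\<close>
  project onto it as soon as the values on disjoint sets tend to zero.
\<close>

lemma complemented_c0:
  assumes "nontrivial_sigma_algebra S"
    and V: "cca_measures S \<subseteq> V" "V \<subseteq> ba_measures S"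
    and null: "\<And>F D. F \<in> V \<Longrightarrow> range D \<subseteq> S \<Longrightarrow> disjoint_family D \<Longrightarrow> (\<lambda>n::nat. F (D n)) \<longlonglongrightarrow> 0"
  shows "contains_complemented_copy (fun_nspace smul V ba_norm) (c0_space :: ('k, nat \<Rightarrow> 'k) nspace)"
proof -
  obtain D and w where D: "\<And>n. D n \<in> S" "disjoint_family D" "\<And>n m. w n \<in> D m \<longleftrightarrow> n = (m::nat)"
    using ex_separated_points[OF assms(1)] by metis
  let ?G = "\<lambda>a A. J (restrict_seq A a)"
  let ?J = "\<lambda>a. point_masses w (?G a)" and ?P = "\<lambda>F n. \<psi> n (F (D n))"
  have J_le: "norm (?G a A) \<le> C * sup_norm a" if "a \<in> c0_seqs" for a A
  proof -
    have "norm (?G a A) \<le> C * sup_norm (restrict_seq A a)"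
      using that by (intro J_bound restrict_seq_c0)
    also have "\<dots> \<le> C * sup_norm a"
      using that c0_subset_linf C_nonneg by (intro mult_left_mono sup_norm_restrict_le) auto
    finally show ?thesis .
  qed
  have J_cca: "?J a \<in> cca_measures S" if a: "a \<in> c0_seqs" for a
  proof (rule point_masses_cca)
    show "?G a (A \<union> B) = ?G a A + ?G a B" if "A \<inter> B = {}" for A B
      unfolding restrict_seq_add[OF that] using a by (intro J_add restrict_seq_c0)
    fix e :: real assume e: "e > 0"
    have "a \<longlonglongrightarrow> 0" using a by (simp add: c0_seqs_def)
    moreover have pos: "e / (C + 1) > 0" using e C_nonneg by simp
    ultimately obtain N where N: "\<And>n. n \<ge> N \<Longrightarrow> norm (a n) < e / (C + 1)"
      by (metis LIMSEQ_D diff_zero)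
    have "norm (?G a A) < e" if A: "A \<subseteq> {N..}" for A
    proof -
      have "sup_norm (restrict_seq A a) \<le> e / (C + 1)"
        using A N pos by (intro sup_norm_le) (auto simp: restrict_seq_def intro: less_imp_le)
      then have "C * sup_norm (restrict_seq A a) \<le> C * (e / (C + 1))" using C_nonneg by (rule mult_left_mono)
      also have "\<dots> < e" using e C_nonneg by (simp add: field_simps)
      finally show ?thesis using J_bound[OF restrict_seq_c0[OF a], of A] by linarith
    qed
    then show "\<exists>N. \<forall>A\<subseteq>{N..}. norm (?G a A) < e" by blast
  qed
  show ?thesis
    unfolding sequence_spaces
  proof (rule contains_complemented_copyI[OF fun_subspace_c0])
    show "bounded_operator (fun_nspace (*) c0_seqs sup_norm) (fun_nspace smul V ba_norm) ?J"
      unfolding bounded_operator_fun_nspace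
    proof (intro conjI ballI allI)
      show "?J a \<in> V" if "a \<in> c0_seqs" for a using J_cca[OF that] V(1) by blast
      show "?J (\<lambda>i. a i + b i) = (\<lambda>i. ?J a i + ?J b i)" if "a \<in> c0_seqs" "b \<in> c0_seqs" for a b
      proof -
        have "restrict_seq A (\<lambda>i. a i + b i) = (\<lambda>i. restrict_seq A a i + restrict_seq A b i)" for A
          by (auto simp: restrict_seq_def)
        then show ?thesis
          using that by (intro ext) (simp add: point_masses_def J_add restrict_seq_c0)
      qed
      show "?J (\<lambda>i. c * a i) = (\<lambda>i. smul c (?J a i))" if "a \<in> c0_seqs" for a c
      proof -
        have "restrict_seq A (\<lambda>i. c * a i) = (\<lambda>i. c * restrict_seq A a i)" for A
          by (auto simp: restrict_seq_def)
        then show ?thesis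
          using that by (intro ext) (simp add: point_masses_def J_scale restrict_seq_c0)
      qed
      have "ba_norm (?J a) \<le> 4 * (C * sup_norm a)" if "a \<in> c0_seqs" for a
        using J_cca[OF that] cca_subset_ca ca_subset_ba J_le[OF that]
        by (intro ba_norm_le) (auto simp: point_masses_def)
      then have "ba_norm (?J a) \<le> (4 * C) * sup_norm a" if "a \<in> c0_seqs" for a
        using that by (simp add: mult.assoc)
      then show "\<exists>C. \<forall>a\<in>c0_seqs. ba_norm (?J a) \<le> C * sup_norm a" by blast
    qed
    show "bounded_operator (fun_nspace smul V ba_norm) (fun_nspace (*) c0_seqs sup_norm) ?P"
      unfolding bounded_operator_fun_nspace
    proof (intro conjI ballI allI)
      fix F assume F: "F \<in> V"
      have "(\<lambda>n. F (D n)) \<longlonglongrightarrow> 0" using D by (intro null F) auto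
      then have "(\<lambda>n. norm (F (D n))) \<longlonglongrightarrow> 0" by (rule tendsto_norm_zero)
      then show "?P F \<in> c0_seqs"
        unfolding c0_seqs_def mem_Collect_eq
        by (rule Lim_null_comparison[rotated]) (simp add: dual_unit_ballD(3)[OF \<psi>])
    next
      have "sup_norm (?P F) \<le> 1 * ba_norm F" if "F \<in> V" for F
        unfolding mult_1_left
        using that V(2) D(1) \<psi> by (intro sup_norm_le norm_functional_le_ba_norm) auto
      then show "\<exists>C. \<forall>F\<in>V. sup_norm (?P F) \<le> C * ba_norm F" by blast
    qed (simp_all add: dual_unit_ballD[OF \<psi>])
    show "?P (?J a) = a" if "a \<in> c0_seqs" for a
    proof
      fix n
      have "?P (?J a) n = restrict_seq {n} a n"
        using D \<psi>_J[OF restrict_seq_c0[OF that]] by (simp add: point_masses_def)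
      then show "?P (?J a) n = a n" by (simp add: restrict_seq_def)
    qed
    show "sup_norm a \<ge> 0" if "a \<in> c0_seqs" for a :: "nat \<Rightarrow> 'k"
      using that c0_subset_linf by (intro sup_norm_nonneg) auto
  qed (rule ba_norm_nonneg)
qed

end

lemma (in vector_measures) ca_disjoint_null:
  assumes "F \<in> ca_measures S" "range D \<subseteq> S" "disjoint_family D"
  shows "(\<lambda>n::nat. F (D n)) \<longlonglongrightarrow> (0::'x)"
  using assms unfolding ca_measures_def by (intro summable_LIMSEQ_zero) (auto simp: summable_def)


section \<open>Finitely additive measures that do not vanish along disjoint sets\<close>

text \<open>
  Rosenthal's disjointification. Split \<open>M\<close> into infinitely many infinite pieces. If no piece works,
  each piece \<open>N p\<close> contains some \<open>n p\<close> charging the rest of \<open>N p\<close> with at least \<open>e\<close>; the set of the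
  \<open>n p\<close> misses all these rests, so on it the total masses have dropped by \<open>e\<close>.
\<close>

lemma rosenthal_disjointification:
  fixes v :: "nat \<Rightarrow> nat set \<Rightarrow> real"
  assumes nonneg: "\<And>n A. v n A \<ge> 0" and mono: "\<And>n A B. A \<subseteq> B \<Longrightarrow> v n A \<le> v n B"
    and super: "\<And>n A B. A \<inter> B = {} \<Longrightarrow> v n A + v n B \<le> v n (A \<union> B)" and e: "e > 0"
  shows "infinite M \<Longrightarrow> (\<And>n. n \<in> M \<Longrightarrow> v n M \<le> real k * e) \<Longrightarrow>
    \<exists>M'. infinite M' \<and> (\<forall>n\<in>M'. v n (M' - {n}) < e)"
proof (induction k arbitrary: M)
  case 0
  have "v n (M - {n}) < e" if "n \<in> M" for n
    using 0(2)[OF that] mono[of "M - {n}" M n] e by auto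
  then show ?case using 0(1) by blast
next
  case (Suc k)
  let ?f = "\<lambda>p q. enumerate M (prod_encode (p, q))"
  let ?N = "\<lambda>p. range (?f p)"
  have injf: "?f p q = ?f p' q' \<longleftrightarrow> p = p' \<and> q = q'" for p q p' q'
    using Suc.prems(1) by (simp add: inj_on_eq_iff[OF inj_enumerate] prod_encode_eq)
  have N: "?N p \<subseteq> M" "infinite (?N p)" for p
    using Suc.prems(1) by (auto simp: enumerate_in_set injf intro!: range_inj_infinite injI)
  show ?case
  proof (cases "\<exists>p. \<forall>n\<in>?N p. v n (?N p - {n}) < e")
    case True
    then obtain p where "\<forall>n\<in>?N p. v n (?N p - {n}) < e" by blast
    then show ?thesis using N(2) by (intro exI[of _ "?N p"] conjI)
  next
    case False
    then have "\<forall>p. \<exists>n\<in>?N p. e \<le> v n (?N p - {n})" by (metis not_le)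
    then obtain n where n: "\<And>p. n p \<in> ?N p" "\<And>p. e \<le> v (n p) (?N p - {n p})" by metis
    have eq: "n p \<in> ?N q \<longleftrightarrow> p = q" for p q using n(1)[of p] injf by auto
    have "inj n" using eq n(1) by (metis injI)
    then have "infinite (range n)" by (rule range_inj_infinite)
    moreover have "v m (range n) \<le> real k * e" if m: "m \<in> range n" for m
    proof -
      obtain p where p: "m = n p" using m by blast
      have "range n \<inter> (?N p - {n p}) = {}"
      proof (rule equals0I)
        fix x assume x: "x \<in> range n \<inter> (?N p - {n p})"
        then obtain q where "x = n q" by blast
        then show False using x eq[of q p] by auto
      qed
      then have "v m (range n) + v m (?N p - {n p}) \<le> v m (range n \<union> (?N p - {n p}))"
        by (rule super)
      also have "\<dots> \<le> v m M" using n(1) N(1) by (intro mono) blast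
      also have "\<dots> \<le> real (Suc k) * e" using n(1) N(1) p by (intro Suc.prems) blast
      finally show ?thesis using n(2)[of p] p by (simp add: algebra_simps)
    qed
    ultimately show ?thesis by (rule Suc.IH)
  qed
qed

locale nat_set_function = banach_space_over smul
  for smul :: "'k::real_or_complex \<Rightarrow> 'x::banach \<Rightarrow> 'x" +
  fixes G :: "nat set \<Rightarrow> 'x" and B :: real
  assumes G_Un: "\<And>A A'. A \<inter> A' = {} \<Longrightarrow> G (A \<union> A') = G A + G A'"
    and G_bound: "\<And>A. norm (G A) \<le> B"
begin

sublocale vector_measures smul UNIV "UNIV :: nat set set"
proof -
  have "sigma_algebra UNIV (UNIV :: nat set set)" using sigma_algebra_Pow[of UNIV] by simp
  then show "vector_measures smul UNIV (UNIV :: nat set set)"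
    by (intro vector_measures.intro banach_space_over_axioms)
qed

lemma G_ba: "G \<in> ba_measures UNIV"
  using G_Un G_bound by (auto simp: ba_measures_def bounded_iff)

text \<open>The integral of a sequence with finitely many values with respect to \<open>G\<close>.\<close>

definition simple_int :: "(nat \<Rightarrow> 'k) \<Rightarrow> 'x" where
  "simple_int s = (\<Sum>c\<in>range s. smul c (G (s -` {c})))"

lemma B_nonneg: "B \<ge> 0"
  using G_bound[of "{}"] norm_ge_zero order_trans by blast

lemma disjoint_fibres: "disjoint_family_on (\<lambda>c. s -` {c} - A) I"
  by (auto simp: disjoint_family_on_def)

lemma simple_int_compose:
  fixes h :: "nat \<Rightarrow> 'b" and g :: "'b \<Rightarrow> 'k"
  assumes fin: "finite (range h)"
  shows "simple_int (\<lambda>n. g (h n)) = (\<Sum>b\<in>range h. smul (g b) (G (h -` {b})))"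
proof -
  have *: "G ((\<lambda>n. g (h n)) -` {c}) = (\<Sum>b\<in>{b\<in>range h. g b = c}. G (h -` {b}))" for c
  proof -
    have "(\<lambda>n. g (h n)) -` {c} = (\<Union>b\<in>{b\<in>range h. g b = c}. h -` {b})" by auto
    moreover have "G (\<Union>b\<in>{b\<in>range h. g b = c}. h -` {b}) = (\<Sum>b\<in>{b\<in>range h. g b = c}. G (h -` {b}))"
      using fin by (intro ba_measures_UN[OF G_ba]) (auto simp: disjoint_family_on_def)
    ultimately show ?thesis by simp
  qed
  have "simple_int (\<lambda>n. g (h n)) = (\<Sum>c\<in>g ` range h. \<Sum>b\<in>{b\<in>range h. g b = c}. smul (g b) (G (h -` {b})))"
    unfolding simple_int_def * scale_sum_right by (simp add: image_image)
  also have "\<dots> = (\<Sum>b\<in>range h. smul (g b) (G (h -` {b})))"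
    using fin by (intro sum.group) auto
  finally show ?thesis .
qed

lemma simple_int_add:
  assumes "finite (range s)" "finite (range t)"
  shows "simple_int (\<lambda>n. s n + t n) = simple_int s + simple_int t"
proof -
  have fin: "finite (range (\<lambda>n. (s n, t n)))"
    by (rule finite_subset[of _ "range s \<times> range t"]) (use assms in auto)
  show ?thesis
    using simple_int_compose[OF fin, of "\<lambda>(x, y). x + y"] simple_int_compose[OF fin, of fst]
      simple_int_compose[OF fin, of snd]
    by (simp add: case_prod_unfold scale_left_distrib sum.distrib)
qed

lemma simple_int_scale:
  assumes "finite (range s)"
  shows "simple_int (\<lambda>n. c * s n) = smul c (simple_int s)"
  using simple_int_compose[OF assms, of "\<lambda>x. c * x"] simple_int_compose[OF assms, of "\<lambda>x. x"]
  by (simp add: scale_sum_right)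

lemma simple_int_diff:
  assumes "finite (range s)" "finite (range t)"
  shows "simple_int (\<lambda>n. s n - t n) = simple_int s - simple_int t"
proof -
  have "finite (range (\<lambda>n. - 1 * t n))"
    using finite_imageI[OF assms(2), of "\<lambda>x. - 1 * x"] by (simp add: image_image)
  then show ?thesis
    using simple_int_add[OF assms(1), of "\<lambda>n. - 1 * t n"] simple_int_scale[OF assms(2), of "- 1"] by simp
qed

lemma norm_sum_functional_le:
  fixes s :: "nat \<Rightarrow> 'k"
  assumes "finite (range s)" "\<And>n. norm (s n) \<le> m"
    "(\<Sum>c\<in>range s. norm (\<phi> (G (s -` {c} - A)))) \<le> r"
  shows "norm (\<Sum>c\<in>range s. c * \<phi> (G (s -` {c} - A))) \<le> m * r"
proof -
  have m: "m \<ge> 0" using assms(2)[of 0] norm_ge_zero order_trans by blast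
  have "norm (\<Sum>c\<in>range s. c * \<phi> (G (s -` {c} - A))) \<le> (\<Sum>c\<in>range s. m * norm (\<phi> (G (s -` {c} - A))))"
  proof (rule sum_norm_le)
    fix c assume "c \<in> range s"
    then have "norm c \<le> m" using assms(2) by blast
    then show "norm (c * \<phi> (G (s -` {c} - A))) \<le> m * norm (\<phi> (G (s -` {c} - A)))"
      unfolding norm_mult by (rule mult_right_mono) simp
  qed
  also have "\<dots> \<le> m * r"
    unfolding sum_distrib_left[symmetric] using assms(3) m by (rule mult_left_mono)
  finally show ?thesis .
qed

lemma functional_simple_int:
  assumes "\<phi> \<in> dual_unit_ball smul"
  shows "\<phi> (simple_int s) = (\<Sum>c\<in>range s. c * \<phi> (G (s -` {c})))"
  by (simp add: simple_int_def dual_unit_ballD[OF assms])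

lemma norm_simple_int_le:
  assumes "finite (range s)" "\<And>n. norm (s n) \<le> m"
  shows "norm (simple_int s) \<le> 4 * B * m"
proof -
  obtain \<phi> where \<phi>: "\<phi> \<in> dual_unit_ball smul" "\<phi> (simple_int s) = of_real (norm (simple_int s))"
    using ex_norming_functional by blast
  have "(\<Sum>c\<in>range s. norm (\<phi> (G (s -` {c} - {})))) \<le> 4 * B"
    using assms(1) G_bound \<phi>(1) disjoint_fibres[of s "{}"]
    by (intro sum_functional_le[OF G_ba]) auto
  then have "norm (\<phi> (simple_int s)) \<le> m * (4 * B)"
    using norm_sum_functional_le[OF assms, of \<phi> "{}"] by (simp add: functional_simple_int[OF \<phi>(1)])
  then show ?thesis using \<phi>(2) by (simp add: mult.commute)
qed

lemma ex_finite_range_approx: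
  assumes "a \<in> linf_seqs" "d > 0"
  shows "\<exists>s. finite (range s) \<and> (\<forall>n. norm (a n - s n) \<le> d)"
proof -
  have "compact (closure (range a))" using assms(1) by (simp add: linf_seqs_def compact_closure)
  then obtain K where K: "finite K" "closure (range a) \<subseteq> (\<Union>x\<in>K. ball x d)"
    unfolding compact_eq_totally_bounded using assms(2) by blast
  have "\<forall>n. \<exists>x. x \<in> K \<and> norm (a n - x) \<le> d"
  proof
    fix n
    have "a n \<in> closure (range a)" using closure_subset by (rule subsetD) simp
    then obtain x where "x \<in> K" "a n \<in> ball x d" using K(2) by blast
    then show "\<exists>x. x \<in> K \<and> norm (a n - x) \<le> d"
      by (intro exI[of _ x]) (simp add: dist_norm norm_minus_commute)
  qed
  then obtain s where s: "\<And>n. s n \<in> K" "\<And>n. norm (a n - s n) \<le> d" by metis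
  have "range s \<subseteq> K" using s(1) by auto
  then show ?thesis using s(2) finite_subset[OF _ K(1)] by blast
qed

text \<open>
  This property pins down the integral of a bounded sequence as the limit of the integrals of uniform
  approximations, with an explicit rate; linearity of the integral follows from it.
\<close>

definition represents_integral :: "(nat \<Rightarrow> 'k) \<Rightarrow> 'x \<Rightarrow> bool" where
  "represents_integral a x \<longleftrightarrow> (\<forall>s d. finite (range s) \<longrightarrow> (\<forall>n. norm (a n - s n) \<le> d) \<longrightarrow>
     norm (x - simple_int s) \<le> 4 * B * d)"

lemma represents_integralD:
  assumes "represents_integral a x" "finite (range s)" "\<And>n. norm (a n - s n) \<le> d"
  shows "norm (x - simple_int s) \<le> 4 * B * d"
  using assms unfolding represents_integral_def by blast

lemma ex_represents_integral:
  assumes "a \<in> linf_seqs"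
  shows "\<exists>x. represents_integral a x"
proof -
  have "\<forall>k. \<exists>s. finite (range s) \<and> (\<forall>n. norm (a n - s n) \<le> inverse (real (Suc k)))"
    using ex_finite_range_approx[OF assms] by simp
  then obtain s where s: "\<And>k. finite (range (s k))" "\<And>k n. norm (a n - s k n) \<le> inverse (real (Suc k))"
    by metis
  have diff: "norm (simple_int (s k) - simple_int t) \<le> 4 * B * (inverse (real (Suc k)) + d)"
    if t: "finite (range t)" "\<And>n. norm (a n - t n) \<le> d" for t d k
  proof -
    have fin: "finite (range (\<lambda>n. s k n - t n))"
      by (rule finite_subset[of _ "(\<lambda>(x, y). x - y) ` (range (s k) \<times> range t)"]) (use s(1) t(1) in auto)
    have "norm (s k n - t n) \<le> inverse (real (Suc k)) + d" for n
    proof -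
      have "norm (s k n - t n) \<le> norm (a n - s k n) + norm (a n - t n)"
        using norm_triangle_ineq4[of "a n - t n" "a n - s k n"] by (simp add: norm_minus_commute)
      then show ?thesis using s(2)[of n k] t(2)[of n] by linarith
    qed
    then show ?thesis
      using norm_simple_int_le[OF fin] simple_int_diff[OF s(1) t(1), of k] by simp
  qed
  have lim0: "(\<lambda>k. 4 * B * inverse (real (Suc k))) \<longlonglongrightarrow> 0"
    by (rule tendsto_mult_right_zero[OF LIMSEQ_inverse_real_of_nat])
  have "Cauchy (\<lambda>k. simple_int (s k))"
  proof (rule metric_CauchyI)
    fix e :: real assume "e > 0"
    then have "\<forall>\<^sub>F k in sequentially. 4 * B * inverse (real (Suc k)) < e / 2"
      using lim0 by (intro order_tendstoD(2)) auto
    then obtain N where N: "\<And>k. k \<ge> N \<Longrightarrow> 4 * B * inverse (real (Suc k)) < e / 2"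
      by (auto simp: eventually_sequentially)
    have "dist (simple_int (s k)) (simple_int (s l)) < e" if "k \<ge> N" "l \<ge> N" for k l
      using diff[OF s(1) s(2), of k l] N[OF that(1)] N[OF that(2)]
      by (simp add: dist_norm distrib_left)
    then show "\<exists>N. \<forall>k\<ge>N. \<forall>l\<ge>N. dist (simple_int (s k)) (simple_int (s l)) < e" by blast
  qed
  then obtain x where x: "(\<lambda>k. simple_int (s k)) \<longlonglongrightarrow> x" by (meson Cauchy_convergent convergent_def)
  have "norm (x - simple_int t) \<le> 4 * B * d"
    if t: "finite (range t)" "\<And>n. norm (a n - t n) \<le> d" for t d
  proof (rule LIMSEQ_le)
    show "(\<lambda>k. norm (simple_int (s k) - simple_int t)) \<longlonglongrightarrow> norm (x - simple_int t)"
      using x by (intro tendsto_norm tendsto_diff tendsto_const)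
    show "(\<lambda>k. 4 * B * inverse (real (Suc k)) + 4 * B * d) \<longlonglongrightarrow> 4 * B * d"
      using tendsto_add[OF lim0 tendsto_const, of "4 * B * d"] by simp
    show "\<exists>N. \<forall>k\<ge>N. norm (simple_int (s k) - simple_int t) \<le> 4 * B * inverse (real (Suc k)) + 4 * B * d"
      using diff[OF t] by (simp add: distrib_left)
  qed
  then show ?thesis unfolding represents_integral_def by blast
qed

definition integral_seq :: "(nat \<Rightarrow> 'k) \<Rightarrow> 'x" where
  "integral_seq a = (SOME x. represents_integral a x)"

lemma integral_seq_approx:
  assumes "a \<in> linf_seqs" "finite (range s)" "\<And>n. norm (a n - s n) \<le> d"
  shows "norm (integral_seq a - simple_int s) \<le> 4 * B * d"
  using someI_ex[OF ex_represents_integral[OF assms(1)]] assms(2,3)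
  unfolding integral_seq_def[symmetric] by (rule represents_integralD)

lemma eq_if_norm_diff_le:
  assumes "\<And>d. d > 0 \<Longrightarrow> norm (x - y) \<le> K * d"
  shows "x = (y :: 'x)"
proof (rule ccontr)
  assume "x \<noteq> y"
  then have n: "norm (x - y) > 0" by simp
  let ?d = "norm (x - y) / (2 * (\<bar>K\<bar> + 1))"
  have "norm (x - y) \<le> K * ?d" using n by (intro assms) (auto intro!: divide_pos_pos)
  also have "\<dots> \<le> (\<bar>K\<bar> + 1) * ?d" by (intro mult_right_mono) auto
  also have "\<dots> = norm (x - y) / 2" by (simp add: field_simps)
  finally show False using n by simp
qed

lemma integral_seq_add:
  assumes "a \<in> linf_seqs" "b \<in> linf_seqs" "(\<lambda>n. a n + b n) \<in> linf_seqs"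
  shows "integral_seq (\<lambda>n. a n + b n) = integral_seq a + integral_seq b"
proof (rule eq_if_norm_diff_le[where K = "16 * B"])
  fix d :: real assume "d > 0"
  obtain s where s: "finite (range s)" "\<And>n. norm (a n - s n) \<le> d"
    using ex_finite_range_approx[OF assms(1) \<open>d > 0\<close>] by blast
  obtain t where t: "finite (range t)" "\<And>n. norm (b n - t n) \<le> d"
    using ex_finite_range_approx[OF assms(2) \<open>d > 0\<close>] by blast
  have "finite (range (\<lambda>n. s n + t n))"
    by (rule finite_subset[of _ "(\<lambda>(x, y). x + y) ` (range s \<times> range t)"]) (use s(1) t(1) in auto)
  moreover have "norm (a n + b n - (s n + t n)) \<le> 2 * d" for n
    using norm_triangle_ineq[of "a n - s n" "b n - t n"] s(2)[of n] t(2)[of n]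
    by (simp add: algebra_simps)
  ultimately have 1: "norm (integral_seq (\<lambda>n. a n + b n) - simple_int (\<lambda>n. s n + t n)) \<le> 4 * B * (2 * d)"
    using assms(3) by (intro integral_seq_approx)
  have 2: "norm (integral_seq a - simple_int s) \<le> 4 * B * d"
    using assms(1) s by (rule integral_seq_approx)
  have 3: "norm (integral_seq b - simple_int t) \<le> 4 * B * d"
    using assms(2) t by (rule integral_seq_approx)
  have triangle3: "norm (x - y - z) \<le> norm x + norm y + norm z" for x y z :: 'x
    using norm_triangle_ineq4[of "x - y" z] norm_triangle_ineq4[of x y] by linarith
  have "integral_seq (\<lambda>n. a n + b n) - (integral_seq a + integral_seq b) =
      (integral_seq (\<lambda>n. a n + b n) - simple_int (\<lambda>n. s n + t n))
      - (integral_seq a - simple_int s) - (integral_seq b - simple_int t)"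
    using simple_int_add[OF s(1) t(1)] by simp
  then have "norm (integral_seq (\<lambda>n. a n + b n) - (integral_seq a + integral_seq b)) \<le>
      norm (integral_seq (\<lambda>n. a n + b n) - simple_int (\<lambda>n. s n + t n))
      + norm (integral_seq a - simple_int s) + norm (integral_seq b - simple_int t)"
    by (simp only: triangle3)
  also have "\<dots> \<le> 16 * B * d" using 1 2 3 by linarith
  finally show "norm (integral_seq (\<lambda>n. a n + b n) - (integral_seq a + integral_seq b)) \<le> 16 * B * d" .
qed

lemma integral_seq_scale:
  assumes "a \<in> linf_seqs" "(\<lambda>n. c * a n) \<in> linf_seqs"
  shows "integral_seq (\<lambda>n. c * a n) = smul c (integral_seq a)"
proof (rule eq_if_norm_diff_le[where K = "8 * B * norm c"])
  fix d :: real assume "d > 0"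
  obtain s where s: "finite (range s)" "\<And>n. norm (a n - s n) \<le> d"
    using ex_finite_range_approx[OF assms(1) \<open>d > 0\<close>] by blast
  have "finite (range (\<lambda>n. c * s n))"
    using finite_imageI[OF s(1), of "\<lambda>x. c * x"] by (simp add: image_image)
  moreover have "norm (c * a n - c * s n) \<le> norm c * d" for n
    using mult_left_mono[OF s(2)[of n] norm_ge_zero[of c]]
    by (simp add: right_diff_distrib[symmetric] norm_mult del: right_diff_distrib)
  ultimately have "norm (integral_seq (\<lambda>n. c * a n) - simple_int (\<lambda>n. c * s n)) \<le> 4 * B * (norm c * d)"
    using assms(2) by (intro integral_seq_approx)
  moreover have "norm (integral_seq a - simple_int s) \<le> 4 * B * d"
    using assms(1) s by (rule integral_seq_approx)
  then have "norm (smul c (integral_seq a - simple_int s)) \<le> norm c * (4 * B * d)"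
    by (simp add: norm_scale mult_left_mono)
  moreover have "integral_seq (\<lambda>n. c * a n) - smul c (integral_seq a) =
      (integral_seq (\<lambda>n. c * a n) - simple_int (\<lambda>n. c * s n)) - smul c (integral_seq a - simple_int s)"
    using simple_int_scale[OF s(1)] by (simp add: scale_right_diff_distrib)
  then have "norm (integral_seq (\<lambda>n. c * a n) - smul c (integral_seq a)) \<le>
      norm (integral_seq (\<lambda>n. c * a n) - simple_int (\<lambda>n. c * s n))
      + norm (smul c (integral_seq a - simple_int s))"
    by (metis norm_triangle_ineq4)
  ultimately show "norm (integral_seq (\<lambda>n. c * a n) - smul c (integral_seq a)) \<le> 8 * B * norm c * d"
    by (simp add: algebra_simps)
qed

lemma norm_integral_seq_le:
  assumes "a \<in> linf_seqs"
  shows "norm (integral_seq a) \<le> 4 * B * sup_norm a"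
proof -
  have "simple_int (\<lambda>n. 0) = 0" by (simp add: simple_int_def)
  then show ?thesis
    using integral_seq_approx[OF assms, of "\<lambda>n. 0" "sup_norm a"] norm_le_sup_norm[OF assms]
    by (simp add: image_constant_conv)
qed

text \<open>
  Apply \<open>\<phi> n\<close> to the integral: the entry at \<open>n\<close> contributes at least \<open>e \<bar>a n\<bar>\<close>, all other entries
  together at most \<open>e / 2\<close> times the supremum norm. Then let \<open>n\<close> approach the supremum.
\<close>

lemma norm_integral_seq_ge:
  assumes a: "a \<in> linf_seqs"
    and \<phi>: "\<And>n. \<phi> n \<in> dual_unit_ball smul" "\<And>n. norm (\<phi> n (G {n})) \<ge> e"
    and small: "\<And>n (P :: nat set set). finite P \<Longrightarrow> disjoint P \<Longrightarrow> n \<notin> \<Union>P \<Longrightarrow> (\<Sum>A\<in>P. norm (\<phi> n (G A))) \<le> e / 2"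
    and e: "e > 0"
  shows "e / 2 * sup_norm a \<le> norm (integral_seq a)"
proof -
  \<comment> \<open>The last term is the error of replacing \<open>a\<close> by a sequence with finitely many values.\<close>
  have ge: "e * norm (a n) - e / 2 * sup_norm a \<le> norm (integral_seq a) + (2 * e + 4 * B) * d"
    if "d > 0" for n d
  proof -
    obtain s where s: "finite (range s)" "\<And>n. norm (a n - s n) \<le> d"
      using ex_finite_range_approx[OF a \<open>d > 0\<close>] by blast
    have s_le: "norm (s n) \<le> sup_norm a + d" for n
      using norm_triangle_ineq4[of "a n" "a n - s n"] norm_le_sup_norm[OF a, of n] s(2)[of n] by simp
    let ?r = "\<Sum>c\<in>range s. c * \<phi> n (G (s -` {c} - {n}))"
    have split: "\<phi> n (G (s -` {c})) = (if c = s n then \<phi> n (G {n}) else 0) + \<phi> n (G (s -` {c} - {n}))" for c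
    proof (cases "c = s n")
      case True
      then have "s -` {c} = {n} \<union> (s -` {c} - {n})" by auto
      then have "G (s -` {c}) = G {n} + G (s -` {c} - {n})"
        using G_Un[of "{n}" "s -` {c} - {n}"] by (simp only: Diff_disjoint)
      then show ?thesis using True dual_unit_ballD(1)[OF \<phi>(1)] by simp
    next
      case False
      then have "s -` {c} - {n} = s -` {c}" by auto
      then show ?thesis using False by simp
    qed
    have "\<phi> n (simple_int s) = (\<Sum>c\<in>range s. (if c = s n then s n * \<phi> n (G {n}) else 0)) + ?r"
      unfolding functional_simple_int[OF \<phi>(1)] sum.distrib[symmetric]
      by (subst split, intro sum.cong refl) (simp add: distrib_left)
    also have "(\<Sum>c\<in>range s. (if c = s n then s n * \<phi> n (G {n}) else 0)) = s n * \<phi> n (G {n})"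
      using s(1) by (subst sum.delta) auto
    finally have eq: "\<phi> n (simple_int s) = s n * \<phi> n (G {n}) + ?r" .
    have "(\<Sum>c\<in>range s. norm (\<phi> n (G (s -` {c} - {n})))) \<le> e / 2"
    proof -
      let ?I = "{c \<in> range s. s -` {c} - {n} \<noteq> {}}"
      have inj: "inj_on (\<lambda>c. s -` {c} - {n}) ?I"
      proof (rule inj_onI)
        fix c c' assume c: "c \<in> ?I" "s -` {c} - {n} = s -` {c'} - {n}"
        then obtain m where "m \<in> s -` {c} - {n}" by blast
        moreover from this have "m \<in> s -` {c'} - {n}" using c(2) by blast
        ultimately show "c = c'" by simp
      qed
      have "(\<Sum>c\<in>range s. norm (\<phi> n (G (s -` {c} - {n})))) = (\<Sum>c\<in>?I. norm (\<phi> n (G (s -` {c} - {n}))))"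
      proof (rule sum.mono_neutral_right)
        show "\<forall>c\<in>range s - ?I. norm (\<phi> n (G (s -` {c} - {n}))) = 0"
        proof
          fix c assume "c \<in> range s - ?I"
          then have "s -` {c} - {n} = {}" by blast
          then show "norm (\<phi> n (G (s -` {c} - {n}))) = 0"
            by (simp only: ba_measuresD(4)[OF G_ba] dual_unit_ballD(4)[OF \<phi>(1)] norm_zero)
        qed
      qed (use s(1) in auto)
      also have "\<dots> = (\<Sum>A\<in>(\<lambda>c. s -` {c} - {n}) ` ?I. norm (\<phi> n (G A)))"
        using inj by (subst sum.reindex) auto
      also have "\<dots> \<le> e / 2"
        using s(1) disjoint_fibres by (intro small disjoint_family_on_disjoint_image) auto
      finally show ?thesis .
    qed
    then have "norm ?r \<le> (sup_norm a + d) * (e / 2)"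
      using s(1) s_le by (intro norm_sum_functional_le)
    moreover have "norm (s n * \<phi> n (G {n})) \<ge> norm (s n) * e"
      using \<phi>(2)[of n] by (simp add: norm_mult mult_left_mono)
    moreover have "norm (s n * \<phi> n (G {n})) \<le> norm (\<phi> n (simple_int s)) + norm ?r"
      using eq norm_triangle_ineq4[of "\<phi> n (simple_int s)" ?r] by simp
    moreover have "norm (\<phi> n (simple_int s)) \<le> norm (simple_int s)"
      by (rule dual_unit_ballD(3)[OF \<phi>(1)])
    moreover have "norm (simple_int s) \<le> norm (integral_seq a) + 4 * B * d"
      using integral_seq_approx[OF a s(1) s(2)]
        norm_triangle_ineq4[of "integral_seq a" "integral_seq a - simple_int s"] by simp
    moreover have "e * norm (a n) \<le> e * (norm (s n) + d)"
      using norm_triangle_ineq[of "s n" "a n - s n"] s(2)[of n] e by (intro mult_left_mono) auto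
    moreover have "e * d > 0" using e \<open>d > 0\<close> by simp
    ultimately show ?thesis by (simp add: algebra_simps)
  qed
  have "e * norm (a n) - e / 2 * sup_norm a \<le> norm (integral_seq a)" for n
  proof (rule field_le_epsilon)
    fix d :: real assume "d > 0"
    have pos: "2 * e + 4 * B > 0" using e B_nonneg by simp
    then show "e * norm (a n) - e / 2 * sup_norm a \<le> norm (integral_seq a) + d"
      using ge[of "d / (2 * e + 4 * B)" n] \<open>d > 0\<close> by simp
  qed
  then have "norm (a n) \<le> (norm (integral_seq a) + e / 2 * sup_norm a) / e" for n
    using e by (simp add: field_simps)
  then have "sup_norm a \<le> (norm (integral_seq a) + e / 2 * sup_norm a) / e" by (rule sup_norm_le)
  then show ?thesis using e by (simp add: field_simps)
qed

lemma contains_linf_if_separated: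
  assumes \<phi>: "\<And>n. \<phi> n \<in> dual_unit_ball smul" "\<And>n. norm (\<phi> n (G {n})) \<ge> e"
    and small: "\<And>n (P :: nat set set). finite P \<Longrightarrow> disjoint P \<Longrightarrow> n \<notin> \<Union>P \<Longrightarrow> (\<Sum>A\<in>P. norm (\<phi> n (G A))) \<le> e / 2"
    and e: "e > 0"
  shows "contains_copy (type_nspace smul) (linf_space :: ('k, nat \<Rightarrow> 'k) nspace)"
proof -
  have linf: "fun_subspace (*) (linf_seqs :: (nat \<Rightarrow> 'k) set)"
    unfolding fun_subspace_def
  proof (intro conjI ballI allI)
    show "(\<lambda>i. 0) \<in> (linf_seqs :: (nat \<Rightarrow> 'k) set)" by (rule linf_seqsI[of _ 0]) simp
    show "(\<lambda>i. a i + b i) \<in> linf_seqs" if "a \<in> linf_seqs" "b \<in> linf_seqs" for a b :: "nat \<Rightarrow> 'k"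
      using norm_le_sup_norm[OF that(1)] norm_le_sup_norm[OF that(2)]
      by (intro linf_seqsI[of _ "sup_norm a + sup_norm b"]) (meson add_mono norm_triangle_ineq order_trans)
    show "(\<lambda>i. c * a i) \<in> linf_seqs" if "a \<in> linf_seqs" for c and a :: "nat \<Rightarrow> 'k"
      using norm_le_sup_norm[OF that]
      by (intro linf_seqsI[of _ "norm c * sup_norm a"]) (simp add: norm_mult mult_left_mono)
  qed
  let ?T = integral_seq and ?M = "integral_seq ` linf_seqs"
  note add = integral_seq_add[OF _ _ fun_subspaceD(2)[OF linf]]
  note scale = integral_seq_scale[OF _ fun_subspaceD(3)[OF linf]]
  have ge: "e / 2 * sup_norm a \<le> norm (?T a)" if "a \<in> linf_seqs" for a
    using that \<phi> small e by (rule norm_integral_seq_ge)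
  have diff: "(\<lambda>n. a n - b n) \<in> linf_seqs" "?T (\<lambda>n. a n - b n) = ?T a - ?T b"
    if "a \<in> linf_seqs" "b \<in> linf_seqs" for a b
  proof -
    have b: "(\<lambda>n. - 1 * b n) \<in> linf_seqs" using linf that(2) by (rule fun_subspaceD)
    have eq: "(\<lambda>n. a n - b n) = (\<lambda>n. a n + (- 1 * b n))" by simp
    show "(\<lambda>n. a n - b n) \<in> linf_seqs" unfolding eq using linf that(1) b by (rule fun_subspaceD)
    show "?T (\<lambda>n. a n - b n) = ?T a - ?T b"
      unfolding eq add[OF that(1) b that(1) b] scale[OF that(2) that(2)] by simp
  qed
  have inj: "a = b" if "a \<in> linf_seqs" "b \<in> linf_seqs" "?T a = ?T b" for a b
  proof
    fix n
    have "e / 2 * sup_norm (\<lambda>n. a n - b n) \<le> 0"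
      using ge[OF diff(1)[OF that(1,2)]] diff(2)[OF that(1,2)] that(3) by simp
    then have "sup_norm (\<lambda>n. a n - b n) \<le> 0" using e by (simp add: mult_le_0_iff)
    then have "norm (a n - b n) \<le> 0" using norm_le_sup_norm[OF diff(1)[OF that(1,2)], of n] by linarith
    then show "a n = b n" by simp
  qed
  let ?I = "the_inv_into linf_seqs ?T"
  have injT: "inj_on ?T linf_seqs" using inj by (auto simp: inj_on_def)
  have IT: "?I (?T a) = a" if "a \<in> linf_seqs" for a using injT that by (rule the_inv_into_f_f)
  have Tadd: "?T a + ?T b = ?T (\<lambda>i. a i + b i)" if "a \<in> linf_seqs" "b \<in> linf_seqs" for a b
    using add[OF that that] by simp
  have Tscale: "smul c (?T a) = ?T (\<lambda>i. c * a i)" if "a \<in> linf_seqs" for c a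
    using scale[OF that that] by simp
  have sum_in: "(\<lambda>i. a i + b i) \<in> linf_seqs" if "a \<in> linf_seqs" "b \<in> linf_seqs" for a b :: "nat \<Rightarrow> 'k"
    using linf that by (rule fun_subspaceD)
  have scale_in: "(\<lambda>i. c * a i) \<in> linf_seqs" if "a \<in> linf_seqs" for c and a :: "nat \<Rightarrow> 'k"
    using linf that by (rule fun_subspaceD)
  have "linear_subspace (type_nspace smul) ?M"
    unfolding linear_subspace_def type_nspace_def
  proof (simp, intro conjI ballI allI)
    have "?T (\<lambda>i. 0 * 0) = smul 0 (?T (\<lambda>i. 0))"
      using scale[OF fun_subspaceD(1)[OF linf] fun_subspaceD(1)[OF linf], of 0] .
    then show "0 \<in> ?M" using fun_subspaceD(1)[OF linf] by force
  qed (auto simp: Tadd Tscale sum_in scale_in)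
  moreover have "isomorphic_nspace ((type_nspace smul)\<lparr>vcarrier := ?M\<rparr>) linf_space"
    unfolding isomorphic_nspace_def
  proof (intro exI[of _ ?I] exI[of _ ?T] conjI)
    have "sup_norm (?I (?T a)) \<le> 2 / e * norm (?T a)" if "a \<in> linf_seqs" for a
      using ge[OF that] e by (simp add: IT[OF that] field_simps)
    then have "\<forall>x\<in>?M. sup_norm (?I x) \<le> 2 / e * norm x" by blast
    then have "\<exists>C. \<forall>x\<in>?M. sup_norm (?I x) \<le> C * norm x" by blast
    then show "bounded_operator ((type_nspace smul)\<lparr>vcarrier := ?M\<rparr>) linf_space ?I"
      unfolding bounded_operator_def sequence_spaces type_nspace_def
      by (auto simp: IT Tadd Tscale sum_in scale_in)
    have "\<exists>C. \<forall>a\<in>linf_seqs. norm (?T a) \<le> C * sup_norm a" using norm_integral_seq_le by blast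
    then show "bounded_operator linf_space ((type_nspace smul)\<lparr>vcarrier := ?M\<rparr>) ?T"
      unfolding bounded_operator_def sequence_spaces type_nspace_def
      by (auto simp: Tadd Tscale)
    show "\<forall>x\<in>vcarrier ((type_nspace smul)\<lparr>vcarrier := ?M\<rparr>). ?T (?I x) = x" by (auto simp: IT)
    show "\<forall>a\<in>vcarrier linf_space. ?I (?T a) = a" by (simp add: sequence_spaces IT)
  qed
  ultimately show ?thesis unfolding contains_copy_def by blast
qed

text \<open>
  The variation of \<open>\<phi> \<circ> G\<close> inside \<open>A\<close>, as a real supremum: for functionals in the dual unit ball, the
  sums are bounded by \<open>4 * B\<close>.
\<close>

definition mass_on :: "('x \<Rightarrow> 'k) \<Rightarrow> nat set \<Rightarrow> real" where
  "mass_on \<phi> A = Sup ((\<lambda>P. \<Sum>E\<in>P. norm (\<phi> (G E))) ` {P. finite P \<and> disjoint P \<and> \<Union>P \<subseteq> A})"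

lemma sum_le_mass_on:
  assumes \<phi>: "\<phi> \<in> dual_unit_ball smul"
  shows "finite P \<Longrightarrow> disjoint P \<Longrightarrow> \<Union>P \<subseteq> A \<Longrightarrow> (\<Sum>E\<in>P. norm (\<phi> (G E))) \<le> mass_on \<phi> A"
    and "finite P \<Longrightarrow> disjoint P \<Longrightarrow> (\<Sum>E\<in>P. norm (\<phi> (G E))) \<le> 4 * B"
proof -
  show le: "(\<Sum>E\<in>P. norm (\<phi> (G E))) \<le> 4 * B" if "finite P" "disjoint P" for P
    using that by (intro sum_functional_le[OF G_ba G_bound \<phi>]) (auto simp: disjoint_family_on_def dest: disjointD)
  show "finite P \<Longrightarrow> disjoint P \<Longrightarrow> \<Union>P \<subseteq> A \<Longrightarrow> (\<Sum>E\<in>P. norm (\<phi> (G E))) \<le> mass_on \<phi> A"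
    unfolding mass_on_def using le by (intro cSUP_upper bdd_aboveI2[of _ _ "4 * B"]) auto
qed

lemma mass_on_le:
  assumes "\<And>P. finite P \<Longrightarrow> disjoint P \<Longrightarrow> \<Union>P \<subseteq> A \<Longrightarrow> (\<Sum>E\<in>P. norm (\<phi> (G E))) \<le> r"
  shows "mass_on \<phi> A \<le> r"
  unfolding mass_on_def
proof (rule cSUP_least)
  show "{P. finite P \<and> disjoint P \<and> \<Union>P \<subseteq> A} \<noteq> {}"
    by (intro ex_in_conv[THEN iffD1] exI[of _ "{}"]) simp
qed (simp add: assms)

lemma mass_on_super:
  assumes \<phi>: "\<phi> \<in> dual_unit_ball smul" and disj: "A \<inter> A' = {}"
  shows "mass_on \<phi> A + mass_on \<phi> A' \<le> mass_on \<phi> (A \<union> A')"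
proof -
  let ?s = "\<lambda>P. \<Sum>E\<in>P. norm (\<phi> (G E))"
  have sum: "?s P + ?s Q \<le> mass_on \<phi> (A \<union> A')"
    if P: "finite P" "disjoint P" "\<Union>P \<subseteq> A" and Q: "finite Q" "disjoint Q" "\<Union>Q \<subseteq> A'" for P Q
  proof -
    have "P \<inter> Q \<subseteq> {{}}" using P(3) Q(3) disj by blast
    then have "?s (P \<inter> Q) = 0"
      by (intro sum.neutral) (auto simp: ba_measuresD(4)[OF G_ba] dual_unit_ballD(4)[OF \<phi>])
    then have "?s P + ?s Q = ?s (P \<union> Q)" using sum.union_inter[OF P(1) Q(1), of "\<lambda>E. norm (\<phi> (G E))"] by simp
    also have "disjoint (P \<union> Q)" using P Q disj by (intro disjoint_union) auto
    then have "?s (P \<union> Q) \<le> mass_on \<phi> (A \<union> A')"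
      using P Q by (intro sum_le_mass_on[OF \<phi>]) auto
    finally show ?thesis .
  qed
  have "?s P \<le> mass_on \<phi> (A \<union> A') - mass_on \<phi> A'"
    if P: "finite P" "disjoint P" "\<Union>P \<subseteq> A" for P
  proof -
    have "mass_on \<phi> A' \<le> mass_on \<phi> (A \<union> A') - ?s P"
      by (rule mass_on_le) (use sum[OF P] in \<open>force simp: algebra_simps\<close>)
    then show ?thesis by simp
  qed
  then have "mass_on \<phi> A \<le> mass_on \<phi> (A \<union> A') - mass_on \<phi> A'" by (rule mass_on_le)
  then show ?thesis by simp
qed

text \<open>
  Choose norming functionals for the values at the points, and pass to an infinite set of points on
  which each functional hardly charges the other points.
\<close>

theorem contains_linf_if_points_bounded_below:
  assumes e: "e > 0" and G_ge: "\<And>n. norm (G {n}) \<ge> e"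
  shows "contains_copy (type_nspace smul) (linf_space :: ('k, nat \<Rightarrow> 'k) nspace)"
proof -
  obtain \<phi> where \<phi>: "\<And>n. \<phi> n \<in> dual_unit_ball smul" "\<And>n. \<phi> n (G {n}) = of_real (norm (G {n}))"
  proof -
    have "\<forall>n. \<exists>\<phi>. \<phi> \<in> dual_unit_ball smul \<and> \<phi> (G {n}) = of_real (norm (G {n}))"
      using ex_norming_functional by blast
    then have "\<exists>\<phi>. \<forall>n. \<phi> n \<in> dual_unit_ball smul \<and> \<phi> n (G {n}) = of_real (norm (G {n}))"
      by (rule choice)
    then show thesis using that by blast
  qed
  obtain k :: nat where "4 * B / (e / 2) \<le> real k" using real_arch_simple by blast
  then have k: "4 * B \<le> real k * (e / 2)" using e by (simp add: field_simps)
  have "\<exists>M. infinite M \<and> (\<forall>n\<in>M. mass_on (\<phi> n) (M - {n}) < e / 2)"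
  proof (rule rosenthal_disjointification)
    show "mass_on (\<phi> n) A \<ge> 0" for n A using sum_le_mass_on(1)[OF \<phi>(1), of "{}"] by simp
    show "mass_on (\<phi> n) A \<le> mass_on (\<phi> n) A'" if "A \<subseteq> A'" for n A A'
      using that by (intro mass_on_le sum_le_mass_on(1)[OF \<phi>(1)]) auto
    show "mass_on (\<phi> n) UNIV \<le> real k * (e / 2)" for n
      using k sum_le_mass_on(2)[OF \<phi>(1)] by (intro mass_on_le) (meson order_trans)
  qed (use e mass_on_super[OF \<phi>(1)] infinite_UNIV_nat in auto)
  then obtain M where M: "infinite M" "\<And>n. n \<in> M \<Longrightarrow> mass_on (\<phi> n) (M - {n}) < e / 2" by blast
  let ?\<epsilon> = "enumerate M"
  have inj: "inj ?\<epsilon>" using M(1) by (rule inj_enumerate)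
  have mem: "?\<epsilon> n \<in> M" for n using M(1) by (rule enumerate_in_set)
  interpret sub: nat_set_function smul "\<lambda>A. G (?\<epsilon> ` A)" B
  proof
    show "G (?\<epsilon> ` (A \<union> A')) = G (?\<epsilon> ` A) + G (?\<epsilon> ` A')" if "A \<inter> A' = {}" for A A'
      using that inj by (simp add: image_Un G_Un image_Int[symmetric])
  qed (rule G_bound)
  show ?thesis
  proof (rule sub.contains_linf_if_separated[where \<phi> = "\<lambda>n. \<phi> (?\<epsilon> n)" and e = e])
    show "norm (\<phi> (?\<epsilon> n) (G (?\<epsilon> ` {n}))) \<ge> e" for n
      using G_ge[of "?\<epsilon> n"] by (simp add: \<phi>(2))
    fix n and P :: "nat set set"
    assume P: "finite P" "disjoint P" "n \<notin> \<Union>P"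
    have "(\<Sum>A\<in>P. norm (\<phi> (?\<epsilon> n) (G (?\<epsilon> ` A)))) = (\<Sum>E\<in>(`) ?\<epsilon> ` P. norm (\<phi> (?\<epsilon> n) (G E)))"
      using inj by (subst sum.reindex) (auto simp: inj_on_def inj_image_eq_iff)
    also have "\<dots> \<le> mass_on (\<phi> (?\<epsilon> n)) (M - {?\<epsilon> n})"
    proof (rule sum_le_mass_on(1)[OF \<phi>(1)])
      show "disjoint ((`) ?\<epsilon> ` P)"
        using P(2) inj by (auto simp: disjoint_def image_Int[symmetric])
      show "\<Union>((`) ?\<epsilon> ` P) \<subseteq> M - {?\<epsilon> n}"
        using P(3) mem inj by (auto simp: inj_eq)
    qed (use P(1) in simp)
    also have "\<dots> \<le> e / 2" using M(2)[OF mem] by (rule less_imp_le)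
    finally show "(\<Sum>A\<in>P. norm (\<phi> (?\<epsilon> n) (G (?\<epsilon> ` A)))) \<le> e / 2" .
  qed (use \<phi>(1) e in auto)
qed

end

text \<open>
  If \<open>F\<close> were bounded away from zero on a subsequence \<open>D (r n)\<close>, then integrating bounded sequences
  with respect to \<open>A \<mapsto> F (\<Union>n\<in>A. D (r n))\<close> would embed \<open>\<ell>\<^sub>\<infinity>\<close>; this is the theorem of Diestel and Faires.
\<close>

theorem (in vector_measures) ba_disjoint_null:
  assumes F: "F \<in> ba_measures S" and D: "range D \<subseteq> S" "disjoint_family D"
    and no_linf: "\<not> contains_copy (type_nspace smul) (linf_space :: ('k, nat \<Rightarrow> 'k) nspace)"
  shows "(\<lambda>n::nat. F (D n)) \<longlonglongrightarrow> (0::'x)"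
proof (rule ccontr)
  assume "\<not> (\<lambda>n. F (D n)) \<longlonglongrightarrow> 0"
  then obtain e where e: "e > 0" "\<And>N. \<exists>n\<ge>N. e \<le> norm (F (D n))"
    unfolding LIMSEQ_iff by (force simp: not_less)
  have "infinite {n. e \<le> norm (F (D n))}"
    unfolding infinite_nat_iff_unbounded_le using e(2) by blast
  then have en: "strict_mono (enumerate {n. e \<le> norm (F (D n))})"
      "\<And>n. e \<le> norm (F (D (enumerate {n. e \<le> norm (F (D n))} n)))"
    using strict_mono_enumerate enumerate_in_set by blast+
  define r where "r = enumerate {n. e \<le> norm (F (D n))}"
  have r: "inj r" "\<And>n. e \<le> norm (F (D (r n)))"
    using en strict_mono_imp_inj_on unfolding r_def by blast+
  obtain B where B: "\<And>E. E \<in> S \<Longrightarrow> norm (F E) \<le> B"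
    using ba_measuresD(3)[OF F] unfolding bounded_iff by blast
  have in_S: "(\<Union>n\<in>A. D (r n)) \<in> S" for A :: "nat set"
    using D(1) by (intro A.countable_UN) auto
  interpret G: nat_set_function smul "\<lambda>A. F (\<Union>n\<in>A. D (r n))" B
  proof
    show "F (\<Union>n\<in>A \<union> A'. D (r n)) = F (\<Union>n\<in>A. D (r n)) + F (\<Union>n\<in>A'. D (r n))" if "A \<inter> A' = {}" for A A'
    proof -
      have disj: "D (r n) \<inter> D (r m) = {}" if "n \<noteq> m" for n m
        using that D(2) r(1) by (auto simp: disjoint_family_on_def inj_eq)
      have "(\<Union>n\<in>A. D (r n)) \<inter> (\<Union>n\<in>A'. D (r n)) = {}"
      proof (rule equals0I)
        fix x assume "x \<in> (\<Union>n\<in>A. D (r n)) \<inter> (\<Union>n\<in>A'. D (r n))"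
        then obtain n m where "n \<in> A" "m \<in> A'" "x \<in> D (r n) \<inter> D (r m)" by blast
        then show False using disj[of n m] that by blast
      qed
      then show ?thesis unfolding UN_Un using in_S by (intro ba_measuresD(2)[OF F])
    qed
  qed (rule B[OF in_S])
  show False using G.contains_linf_if_points_bounded_below[OF e(1)] r(2) no_linf by simp
qed


section \<open>A bounded operator from bounded sequences onto \<open>\<ell>\<^sub>2\<close>\<close>

text \<open>
  The subsets of \<open>{..<m}\<close> are the points of the cube \<open>{-1, 1}\<^sup>m\<close>; membership of \<open>k\<close> is the coordinate
  with index \<open>k\<close>.
\<close>

definition rademacher :: "nat \<Rightarrow> nat set \<Rightarrow> real" where
  "rademacher k A = (if k \<in> A then 1 else - 1)"

definition cube_avg :: "nat \<Rightarrow> (nat set \<Rightarrow> 'v::real_vector) \<Rightarrow> 'v" where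
  "cube_avg m f = (\<Sum>A\<in>Pow {..<m}. f A) /\<^sub>R 2 ^ m"

lemma cube_avg_add: "cube_avg m (\<lambda>A. f A + g A) = cube_avg m f + cube_avg m g"
  by (simp add: cube_avg_def sum.distrib scaleR_add_right)

lemma cube_avg_mult:
  fixes c :: "'b::real_normed_algebra"
  shows "cube_avg m (\<lambda>A. c * f A) = c * cube_avg m f"
  by (simp add: cube_avg_def sum_distrib_left)

lemma cube_avg_scaleR: "cube_avg m (\<lambda>A. c *\<^sub>R f A) = c *\<^sub>R cube_avg m f"
  by (simp add: cube_avg_def scaleR_sum_right[symmetric] mult.commute)

lemma cube_avg_sum: "cube_avg m (\<lambda>A. \<Sum>i\<in>I. f i A) = (\<Sum>i\<in>I. cube_avg m (f i))"
  unfolding cube_avg_def by (subst sum.swap) (simp add: scaleR_sum_right)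

lemma linear_cube_avg:
  assumes "linear h"
  shows "h (cube_avg m f) = cube_avg m (\<lambda>A. h (f A))"
  by (simp add: cube_avg_def linear_scale[OF assms] linear_sum[OF assms])

lemma cube_avg_cong: "(\<And>A. A \<subseteq> {..<m} \<Longrightarrow> f A = g A) \<Longrightarrow> cube_avg m f = cube_avg m g"
  unfolding cube_avg_def by (intro arg_cong[of _ _ "\<lambda>x. x /\<^sub>R 2 ^ m"] sum.cong) auto

lemma norm_cube_avg_le:
  fixes f :: "nat set \<Rightarrow> 'v::real_normed_vector"
  shows "norm (cube_avg m f) \<le> cube_avg m (\<lambda>A. norm (f A))"
  unfolding cube_avg_def by (simp add: divide_right_mono norm_sum divide_inverse mult.commute)

lemma cube_avg_const: "cube_avg m (\<lambda>A. c) = c"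
  by (simp add: cube_avg_def card_Pow scaleR_scaleR[symmetric] sum_constant_scaleR del: scaleR_scaleR)
     (simp add: card_Pow)

lemma cube_avg_mono:
  fixes f :: "nat set \<Rightarrow> real"
  assumes "\<And>A. A \<subseteq> {..<m} \<Longrightarrow> f A \<le> g A"
  shows "cube_avg m f \<le> cube_avg m g"
  unfolding cube_avg_def using assms by (intro scaleR_left_mono sum_mono) auto

text \<open>The coordinates of a uniformly distributed subset are independent.\<close>

lemma cube_avg_prod:
  fixes h :: "nat \<Rightarrow> bool \<Rightarrow> 'b::{real_normed_field}"
  shows "cube_avg m (\<lambda>A. \<Prod>k<m. h k (k \<in> A)) = (\<Prod>k<m. (h k True + h k False) / 2)"
proof -
  have "(\<Prod>k<m. h k True + h k False) =
      (\<Sum>A\<in>Pow {..<m}. (\<Prod>k\<in>A. h k True) * (\<Prod>k\<in>{..<m} - A. h k False))"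
    by (rule prod_add) simp
  also have "\<dots> = (\<Sum>A\<in>Pow {..<m}. \<Prod>k<m. h k (k \<in> A))"
  proof (rule sum.cong[OF refl])
    fix A assume "A \<in> Pow {..<m}"
    then have A: "A \<subseteq> {..<m}" by simp
    have "(\<Prod>k<m. h k (k \<in> A)) = (\<Prod>k\<in>{..<m} - A. h k (k \<in> A)) * (\<Prod>k\<in>A. h k (k \<in> A))"
      using A by (intro prod.subset_diff) auto
    then show "(\<Prod>k\<in>A. h k True) * (\<Prod>k\<in>{..<m} - A. h k False) = (\<Prod>k<m. h k (k \<in> A))"
      by (simp add: mult.commute)
  qed
  finally have *: "(\<Sum>A\<in>Pow {..<m}. \<Prod>k<m. h k (k \<in> A)) = (\<Prod>k<m. h k True + h k False)" ..
  show ?thesis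
    unfolding cube_avg_def * prod_dividef by (simp add: scaleR_conv_of_real field_simps)
qed

lemma cube_avg_rademacher_mult:
  assumes "j < m" "k < m"
  shows "cube_avg m (\<lambda>A. rademacher j A * rademacher k A) = (if j = k then 1 else 0)"
proof (cases "j = k")
  case True
  then have "(\<lambda>A. rademacher j A * rademacher k A) = (\<lambda>A. 1)" by (auto simp: rademacher_def)
  then show ?thesis using True by (simp add: cube_avg_const)
next
  case False
  \<comment> \<open>The product of the two functions, written as a product over all coordinates.\<close>
  let ?h = "\<lambda>i b. if i = j \<or> i = k then (if b then 1 else - 1) else (1::real)"
  have "(\<Prod>i<m. ?h i (i \<in> A)) = rademacher j A * rademacher k A" for A
  proof -
    have "(\<Prod>i<m. ?h i (i \<in> A)) = (\<Prod>i\<in>{j, k}. ?h i (i \<in> A))"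
      using assms by (intro prod.mono_neutral_right) auto
    then show ?thesis using False by (simp add: rademacher_def)
  qed
  then have "cube_avg m (\<lambda>A. rademacher j A * rademacher k A) = (\<Prod>i<m. (?h i True + ?h i False) / 2)"
    using cube_avg_prod[of m ?h] by simp
  also have "\<dots> = 0" using assms by (intro prod_zero) auto
  finally show ?thesis using False by simp
qed

text \<open>
  The Riesz product \<open>\<Prod>k<m. (1 + \<i> a k r k)\<close> has Fourier coefficient \<open>\<i> a j\<close> at \<open>r j\<close>, and its modulus
  stays bounded because the factors have modulus \<open>sqrt (1 + (a k)\<^sup>2)\<close>. Its imaginary part is therefore a
  bounded function with prescribed square summable Rademacher coefficients.
\<close>

definition riesz :: "(nat \<Rightarrow> real) \<Rightarrow> nat \<Rightarrow> nat set \<Rightarrow> real" where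
  "riesz a m A = Im (\<Prod>k<m. 1 + \<i> * complex_of_real (a k * rademacher k A))"

text \<open>
  The squared modulus of the product is at most \<open>exp (\<Sum>k (a k)\<^sup>2) \<le> exp 1 \<le> 4\<close>.
\<close>

lemma abs_riesz_le:
  assumes "(\<Sum>k<m. (a k)\<^sup>2) \<le> 1"
  shows "\<bar>riesz a m A\<bar> \<le> 2"
proof -
  have "cmod (1 + \<i> * complex_of_real (a k * rademacher k A)) = sqrt (1 + (a k)\<^sup>2)" for k
    by (simp add: cmod_def rademacher_def)
  then have "cmod (\<Prod>k<m. 1 + \<i> * complex_of_real (a k * rademacher k A)) = (\<Prod>k<m. sqrt (1 + (a k)\<^sup>2))"
    by (simp add: prod_norm[symmetric])
  then have "(cmod (\<Prod>k<m. 1 + \<i> * complex_of_real (a k * rademacher k A)))\<^sup>2 = (\<Prod>k<m. 1 + (a k)\<^sup>2)"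
    by (simp add: prod_power_distrib)
  also have "\<dots> \<le> (\<Prod>k<m. exp ((a k)\<^sup>2))"
    by (intro prod_mono) (auto simp: exp_ge_add_one_self)
  also have "\<dots> = exp (\<Sum>k<m. (a k)\<^sup>2)" by (simp add: exp_sum)
  also have "\<dots> \<le> exp 1" using assms by simp
  also have "\<dots> \<le> 2\<^sup>2" using exp_le by simp
  finally have "cmod (\<Prod>k<m. 1 + \<i> * complex_of_real (a k * rademacher k A)) \<le> 2"
    by (rule power2_le_imp_le) simp
  then show ?thesis
    unfolding riesz_def using abs_Im_le_cmod order_trans by blast
qed

lemma cube_avg_riesz:
  assumes "j < m"
  shows "cube_avg m (\<lambda>A. rademacher j A * riesz a m A) = a j"
proof -
  \<comment> \<open>Only the factor at \<open>j\<close> is changed by the Rademacher function; the others have mean \<open>1\<close>.\<close>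
  let ?h = "\<lambda>i b. (if i = j then (if b then 1 else - 1) else 1) *
      (1 + \<i> * complex_of_real (a i * (if b then 1 else - 1)))"
  have prod: "(\<Prod>i<m. ?h i (i \<in> A)) =
      of_real (rademacher j A) * (\<Prod>k<m. 1 + \<i> * complex_of_real (a k * rademacher k A))" for A
  proof -
    have "(\<Prod>i<m. ?h i (i \<in> A)) = (\<Prod>i<m. if i = j then (if i \<in> A then 1 else - 1) else 1) *
        (\<Prod>i<m. 1 + \<i> * complex_of_real (a i * (if i \<in> A then 1 else - 1)))"
      by (rule prod.distrib)
    also have "(\<Prod>i<m. if i = j then (if i \<in> A then 1 else - 1) else (1::complex)) = of_real (rademacher j A)"
      using assms by (subst prod.delta) (auto simp: rademacher_def)
    finally show ?thesis by (simp add: rademacher_def)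
  qed
  have "cube_avg m (\<lambda>A. rademacher j A * riesz a m A) = cube_avg m (\<lambda>A. Im (\<Prod>i<m. ?h i (i \<in> A)))"
    unfolding prod by (simp add: riesz_def)
  also have "\<dots> = Im (cube_avg m (\<lambda>A. \<Prod>i<m. ?h i (i \<in> A)))"
    by (rule linear_cube_avg[symmetric]) (simp add: bounded_linear.linear[OF bounded_linear_Im])
  also have "cube_avg m (\<lambda>A. \<Prod>i<m. ?h i (i \<in> A)) = (\<Prod>i<m. (?h i True + ?h i False) / 2)"
    by (rule cube_avg_prod)
  also have "\<dots> = (\<Prod>i<m. if i = j then \<i> * complex_of_real (a j) else 1)"
    by (intro prod.cong) (auto simp: algebra_simps)
  also have "\<dots> = \<i> * complex_of_real (a j)" using assms by (subst prod.delta) auto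
  finally show ?thesis by simp
qed

text \<open>
  All cubes are laid out disjointly inside the index set of a sequence. The operator onto \<open>\<ell>\<^sub>2\<close> takes
  Rademacher coefficients on the \<open>m\<close>-th cube and passes to the limit in \<open>m\<close> along the ultrafilter.
\<close>

definition cube_index :: "nat \<Rightarrow> nat set \<Rightarrow> nat" where
  "cube_index m A = prod_encode (m, set_encode A)"

definition coef :: "(nat \<Rightarrow> 'k::real_or_complex) \<Rightarrow> nat \<Rightarrow> nat \<Rightarrow> 'k" where
  "coef u k m = cube_avg m (\<lambda>A. rademacher k A *\<^sub>R u (cube_index m A))"

definition to_l2 :: "(nat \<Rightarrow> 'k::real_or_complex) \<Rightarrow> nat \<Rightarrow> 'k" where
  "to_l2 u k = Lim free_ultrafilter (coef u k)"

lemma norm_coef_le: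
  assumes "\<And>n. norm (u n) \<le> B"
  shows "norm (coef u k m) \<le> B"
proof -
  have "norm (coef u k m) \<le> cube_avg m (\<lambda>A. norm (rademacher k A *\<^sub>R u (cube_index m A)))"
    unfolding coef_def by (rule norm_cube_avg_le)
  also have "\<dots> \<le> cube_avg m (\<lambda>A. B)"
    using assms by (intro cube_avg_mono) (simp add: rademacher_def)
  finally show ?thesis by (simp add: cube_avg_const)
qed

lemma tendsto_to_l2:
  assumes "u \<in> linf_seqs"
  shows "(coef u k \<longlongrightarrow> to_l2 u k) free_ultrafilter"
  unfolding to_l2_def
  by (rule bounded_tendsto_ultrafilter) (rule norm_coef_le, rule norm_le_sup_norm[OF assms])

lemma to_l2_eqI:
  assumes "eventually (\<lambda>m. coef u k m = c) sequentially"
  shows "to_l2 u k = c"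
proof -
  have "(coef u k \<longlongrightarrow> c) sequentially" using assms by (rule tendsto_eventually)
  then have "(coef u k \<longlongrightarrow> c) free_ultrafilter" using free_ultrafilter(1) by (rule tendsto_mono[rotated])
  then show ?thesis
    unfolding to_l2_def using free_ultrafilter(2) by (intro tendsto_Lim)
qed

lemma to_l2_add:
  assumes "u \<in> linf_seqs" "v \<in> linf_seqs"
  shows "to_l2 (\<lambda>n. u n + v n) k = to_l2 u k + to_l2 v k"
proof -
  have "coef (\<lambda>n. u n + v n) k = (\<lambda>m. coef u k m + coef v k m)"
    by (intro ext) (simp add: coef_def scaleR_add_right cube_avg_add)
  then have "(coef (\<lambda>n. u n + v n) k \<longlongrightarrow> to_l2 u k + to_l2 v k) free_ultrafilter"
    using tendsto_add[OF tendsto_to_l2[OF assms(1)] tendsto_to_l2[OF assms(2)]] by simp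
  then show ?thesis
    unfolding to_l2_def[of "\<lambda>n. u n + v n"] using free_ultrafilter(2) by (intro tendsto_Lim)
qed

lemma to_l2_scale:
  assumes "u \<in> linf_seqs"
  shows "to_l2 (\<lambda>n. c * u n) k = c * to_l2 u k"
proof -
  have "coef (\<lambda>n. c * u n) k = (\<lambda>m. c * coef u k m)"
    by (intro ext) (simp only: coef_def mult_scaleR_right[symmetric] cube_avg_mult)
  then have "(coef (\<lambda>n. c * u n) k \<longlongrightarrow> c * to_l2 u k) free_ultrafilter"
    using tendsto_mult_left[OF tendsto_to_l2[OF assms], of c] by simp
  then show ?thesis
    unfolding to_l2_def[of "\<lambda>n. c * u n"] using free_ultrafilter(2) by (intro tendsto_Lim)
qed

text \<open>
  Bessel's inequality: the average of \<open>\<bar>u - \<Sum>k c k r k\<bar>\<^sup>2\<close> over the cube is nonnegative.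
\<close>

lemma bessel_cube:
  fixes u :: "nat \<Rightarrow> 'k::real_or_complex"
  assumes "\<And>n. norm (u n) \<le> B" "N \<le> m"
  shows "(\<Sum>k<N. (norm (coef u k m))\<^sup>2) \<le> B\<^sup>2"
proof -
  let ?u = "\<lambda>A. to_complex (u (cube_index m A))"
  let ?c = "\<lambda>k. to_complex (coef u k m)"
  let ?p = "\<lambda>A. \<Sum>k<N. rademacher k A *\<^sub>R ?c k"
  have c: "?c k = cube_avg m (\<lambda>A. rademacher k A *\<^sub>R ?u A)" for k
    unfolding coef_def linear_cube_avg[OF linear_to_complex]
    by (simp add: linear_scale[OF linear_to_complex])
  let ?s = "\<Sum>k<N. (norm (coef u k m))\<^sup>2"
  have cc: "inner (?c k) (?c k) = (norm (coef u k m))\<^sup>2" for k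
    by (simp add: dot_square_norm)
  have lin: "linear (\<lambda>x. inner x y)" "linear (inner y)" for y :: complex
    by (simp_all add: bounded_linear.linear bounded_linear_inner_left bounded_linear_inner_right)
  have 1: "cube_avg m (\<lambda>A. inner (?u A) (?p A)) = ?s"
  proof -
    have "cube_avg m (\<lambda>A. inner (?u A) (?p A)) =
        cube_avg m (\<lambda>A. \<Sum>k<N. inner (rademacher k A *\<^sub>R ?u A) (?c k))"
      by (simp add: inner_sum_right)
    also have "\<dots> = (\<Sum>k<N. cube_avg m (\<lambda>A. inner (rademacher k A *\<^sub>R ?u A) (?c k)))"
      by (rule cube_avg_sum)
    also have "\<dots> = (\<Sum>k<N. inner (?c k) (?c k))"
      by (intro sum.cong refl) (subst (2) c, rule linear_cube_avg[OF lin(1), symmetric])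
    finally show ?thesis by (simp only: cc)
  qed
  have 2: "cube_avg m (\<lambda>A. inner (?p A) (?p A)) = ?s"
  proof -
    have "cube_avg m (\<lambda>A. inner (?p A) (?p A)) =
        cube_avg m (\<lambda>A. \<Sum>j<N. \<Sum>k<N. inner (?c j) (?c k) *\<^sub>R (rademacher j A * rademacher k A))"
      unfolding inner_sum_left unfolding inner_sum_right by (simp add: mult_ac)
    also have "\<dots> = (\<Sum>j<N. \<Sum>k<N. inner (?c j) (?c k) *\<^sub>R cube_avg m (\<lambda>A. rademacher j A * rademacher k A))"
      unfolding cube_avg_sum cube_avg_scaleR ..
    also have "\<dots> = (\<Sum>j<N. \<Sum>k<N. if j = k then inner (?c j) (?c k) else 0)"
      using assms(2) by (intro sum.cong refl) (simp add: cube_avg_rademacher_mult)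
    also have "\<dots> = (\<Sum>j<N. inner (?c j) (?c j))" by simp
    finally show ?thesis by (simp only: cc)
  qed
  have "0 \<le> cube_avg m (\<lambda>A. inner (?u A - ?p A) (?u A - ?p A))"
    using cube_avg_mono[of m "\<lambda>A. 0" "\<lambda>A. inner (?u A - ?p A) (?u A - ?p A)"] by (simp add: cube_avg_const)
  also have "\<dots> = cube_avg m (\<lambda>A. inner (?u A) (?u A) + (- 2) *\<^sub>R inner (?u A) (?p A) + inner (?p A) (?p A))"
    by (intro cube_avg_cong) (simp add: inner_diff inner_commute)
  also have "\<dots> = cube_avg m (\<lambda>A. inner (?u A) (?u A)) - ?s"
    unfolding cube_avg_add cube_avg_scaleR 1 2 by simp
  also have "cube_avg m (\<lambda>A. inner (?u A) (?u A)) \<le> cube_avg m (\<lambda>A. B\<^sup>2)"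
    using assms(1) by (intro cube_avg_mono) (simp add: dot_square_norm power_mono)
  finally show ?thesis by (simp add: cube_avg_const)
qed

lemma bessel_to_l2:
  fixes u :: "nat \<Rightarrow> 'k::real_or_complex"
  assumes "u \<in> linf_seqs"
  shows "to_l2 u \<in> l2_seqs" "l2_norm (to_l2 u) \<le> sup_norm u"
proof -
  have le: "(\<Sum>k<N. (norm (to_l2 u k))\<^sup>2) \<le> (sup_norm u)\<^sup>2" for N
  proof (rule tendsto_upperbound[OF _ _ free_ultrafilter(2)])
    show "((\<lambda>m. \<Sum>k<N. (norm (coef u k m))\<^sup>2) \<longlongrightarrow> (\<Sum>k<N. (norm (to_l2 u k))\<^sup>2)) free_ultrafilter"
      by (intro tendsto_sum tendsto_power tendsto_norm tendsto_to_l2 assms)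
    have "eventually (\<lambda>m. (\<Sum>k<N. (norm (coef u k m))\<^sup>2) \<le> (sup_norm u)\<^sup>2) sequentially"
      using bessel_cube[of u "sup_norm u" N] norm_le_sup_norm[OF assms]
      by (auto simp: eventually_sequentially)
    then show "eventually (\<lambda>m. (\<Sum>k<N. (norm (coef u k m))\<^sup>2) \<le> (sup_norm u)\<^sup>2) free_ultrafilter"
      using free_ultrafilter(1) by (simp add: le_filter_def)
  qed
  then have sum: "summable (\<lambda>k. (norm (to_l2 u k))\<^sup>2)"
    by (intro summableI_nonneg_bounded) auto
  then show "to_l2 u \<in> l2_seqs" by (simp add: l2_seqs_def)
  have "(\<Sum>k. (norm (to_l2 u k))\<^sup>2) \<le> (sup_norm u)\<^sup>2" using sum le by (rule suminf_le_const)
  then have "sqrt (\<Sum>k. (norm (to_l2 u k))\<^sup>2) \<le> sqrt ((sup_norm u)\<^sup>2)" by (rule real_sqrt_le_mono)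
  then show "l2_norm (to_l2 u) \<le> sup_norm u" using sup_norm_nonneg[OF assms] by (simp add: l2_norm_def)
qed

text \<open>
  The sequence that shows \<open>f m\<close> on the \<open>m\<close>-th cube. Indices outside all cubes receive some value of
  \<open>f\<close> that no average over a cube sees.
\<close>

definition cube_seq :: "(nat \<Rightarrow> nat set \<Rightarrow> 'v) \<Rightarrow> nat \<Rightarrow> 'v" where
  "cube_seq f n = (case prod_decode n of (m, j) \<Rightarrow> f m (set_decode j))"

lemma cube_seq_index: "A \<subseteq> {..<m} \<Longrightarrow> cube_seq f (cube_index m A) = f m A"
  by (simp add: cube_seq_def cube_index_def set_encode_inverse finite_subset)

lemma to_l2_real_lift:
  fixes a :: "nat \<Rightarrow> real"
  assumes "summable (\<lambda>n. (a n)\<^sup>2)" "(\<Sum>n. (a n)\<^sup>2) \<le> 1"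
  shows "\<exists>v. (\<forall>n. \<bar>v n\<bar> \<le> 2) \<and> (\<forall>k m. k < m \<longrightarrow> cube_avg m (\<lambda>A. rademacher k A * v (cube_index m A)) = a k)"
proof (intro exI conjI allI impI)
  let ?v = "cube_seq (riesz a)"
  show "\<bar>?v n\<bar> \<le> 2" for n
  proof -
    have "(\<Sum>k<m. (a k)\<^sup>2) \<le> 1" for m
      using sum_le_suminf[OF assms(1), of "{..<m}"] assms(2) by simp
    then show ?thesis unfolding cube_seq_def by (cases "prod_decode n") (simp add: abs_riesz_le)
  qed
  show "cube_avg m (\<lambda>A. rademacher k A * ?v (cube_index m A)) = a k" if "k < m" for k m
    using cube_avg_riesz[OF that, of a] cube_avg_cong[of m "\<lambda>A. rademacher k A * ?v (cube_index m A)"]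
    by (simp add: cube_seq_index)
qed

text \<open>The element \<open>i\<close> is the imaginary unit, or \<open>0\<close> if the scalars are real.\<close>

lemma scalar_parts:
  "\<exists>i :: 'k::real_or_complex. norm i \<le> 1 \<and>
     (\<forall>z. z = of_real (Re (to_complex z)) + of_real (Im (to_complex z)) * i)"
proof (cases "surj (to_complex :: 'k \<Rightarrow> complex)")
  case True
  then obtain i :: 'k where i: "to_complex i = \<i>" by (metis surjD)
  then have "norm i = 1" by (metis norm_ii to_complex_simps(4))
  moreover have "z = of_real (Re (to_complex z)) + of_real (Im (to_complex z)) * i" for z :: 'k
    by (subst to_complex_inj[symmetric]) (simp add: i complex_eq_iff)
  ultimately show ?thesis by (intro exI[of _ i]) auto
next
  case False
  then have "to_complex (z::'k) \<in> \<real>" for z using to_complex_real_or_surj by blast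
  then have "z = of_real (Re (to_complex z))" for z :: 'k
    by (metis of_real_Re to_complex_inj to_complex_simps(3))
  then show ?thesis by (intro exI[of _ 0]) auto
qed

text \<open>
  Scale to norm one and place the Riesz products of the real and of the imaginary parts on the cubes;
  each of the two has absolute value at most \<open>2\<close>.
\<close>

lemma to_l2_lift:
  fixes a :: "nat \<Rightarrow> 'k::real_or_complex"
  assumes a: "a \<in> l2_seqs"
  shows "\<exists>u\<in>linf_seqs. to_l2 u = a \<and> sup_norm u \<le> 4 * l2_norm a"
proof (cases "l2_norm a = 0")
  case True
  then have "a = (\<lambda>i. 0)" using l2_norm_definite[OF a] by simp
  moreover have "to_l2 (\<lambda>n. 0) = (\<lambda>k. 0 :: 'k)"
    by (intro ext to_l2_eqI) (simp add: coef_def cube_avg_const)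
  moreover have "(\<lambda>n. 0 :: 'k) \<in> linf_seqs" by (rule linf_seqsI[of _ 0]) simp
  moreover have "sup_norm (\<lambda>n. 0 :: 'k) \<le> 0" by (rule sup_norm_le) simp
  ultimately show ?thesis using True by (intro bexI[of _ "\<lambda>n. 0"]) auto
next
  case False
  let ?r = "l2_norm a"
  have sa: "summable (\<lambda>n. (norm (a n))\<^sup>2)" using a by (simp add: l2_seqs_def)
  then have r2: "?r\<^sup>2 = (\<Sum>n. (norm (a n))\<^sup>2)" by (simp add: l2_norm_def suminf_nonneg)
  have r: "?r > 0" using False sa by (simp add: l2_norm_def suminf_nonneg less_le)
  have parts: "summable (\<lambda>n. (p (to_complex (a n)) / ?r)\<^sup>2)" "(\<Sum>n. (p (to_complex (a n)) / ?r)\<^sup>2) \<le> 1"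
    if p: "\<And>z. \<bar>p z\<bar> \<le> cmod z" for p :: "complex \<Rightarrow> real"
  proof -
    have le: "(p (to_complex (a n)) / ?r)\<^sup>2 \<le> (norm (a n))\<^sup>2 / ?r\<^sup>2" for n
    proof -
      have "(p (to_complex (a n)))\<^sup>2 \<le> (norm (a n))\<^sup>2"
        using p[of "to_complex (a n)"] by (simp add: abs_le_square_iff[symmetric])
      then show ?thesis by (simp add: power_divide divide_right_mono)
    qed
    have s: "summable (\<lambda>n. (norm (a n))\<^sup>2 / ?r\<^sup>2)" using sa by (rule summable_divide)
    show sp: "summable (\<lambda>n. (p (to_complex (a n)) / ?r)\<^sup>2)"
      by (rule summable_comparison_test'[OF s, where N = 0]) (use le in simp)
    have "(\<Sum>n. (p (to_complex (a n)) / ?r)\<^sup>2) \<le> (\<Sum>n. (norm (a n))\<^sup>2 / ?r\<^sup>2)"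
      using le sp s by (rule suminf_le)
    also have "\<dots> = 1" using r by (simp add: suminf_divide[OF sa] r2[symmetric])
    finally show "(\<Sum>n. (p (to_complex (a n)) / ?r)\<^sup>2) \<le> 1" .
  qed
  obtain v where v: "\<And>n. \<bar>v n\<bar> \<le> 2"
      "\<And>k m. k < m \<Longrightarrow> cube_avg m (\<lambda>A. rademacher k A * v (cube_index m A)) = Re (to_complex (a k)) / ?r"
    using to_l2_real_lift[OF parts[OF abs_Re_le_cmod]] by blast
  obtain w where w: "\<And>n. \<bar>w n\<bar> \<le> 2"
      "\<And>k m. k < m \<Longrightarrow> cube_avg m (\<lambda>A. rademacher k A * w (cube_index m A)) = Im (to_complex (a k)) / ?r"
    using to_l2_real_lift[OF parts[OF abs_Im_le_cmod]] by blast
  obtain i :: 'k where i: "norm i \<le> 1"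
      "\<And>z. z = of_real (Re (to_complex z)) + of_real (Im (to_complex z)) * i"
    using scalar_parts by blast
  \<comment> \<open>Both parts are at most \<open>2\<close> in absolute value, which gives the factor \<open>4\<close>.\<close>
  let ?u = "\<lambda>n. of_real ?r * (of_real (v n) + of_real (w n) * i)"
  have u_le: "norm (?u n) \<le> 4 * ?r" for n
  proof -
    have "norm (of_real (v n) + of_real (w n) * i) \<le> \<bar>v n\<bar> + \<bar>w n\<bar> * norm i"
      by (rule order_trans[OF norm_triangle_ineq]) (simp add: norm_mult)
    also have "\<dots> \<le> 2 + 2 * 1" using v(1)[of n] w(1)[of n] i(1) by (intro add_mono mult_mono) auto
    finally have "?r * norm (of_real (v n) + of_real (w n) * i) \<le> ?r * 4"
      using r by (intro mult_left_mono) auto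
    then show ?thesis using r by (simp add: norm_mult)
  qed
  have lin: "linear (\<lambda>x::real. of_real x * c :: 'k)" for c
    by (rule linearI) (simp_all add: distrib_right scaleR_conv_of_real)
  have "coef ?u k m = a k" if km: "k < m" for k m
  proof -
    have "coef ?u k m = cube_avg m (\<lambda>A. of_real (rademacher k A * v (cube_index m A)) * of_real ?r
        + of_real (rademacher k A * w (cube_index m A)) * (of_real ?r * i))"
      by (simp add: coef_def scaleR_conv_of_real algebra_simps)
    also have "\<dots> = of_real (Re (to_complex (a k)) / ?r) * of_real ?r
        + of_real (Im (to_complex (a k)) / ?r) * (of_real ?r * i)"
      unfolding cube_avg_add linear_cube_avg[OF lin, symmetric] v(2)[OF km] w(2)[OF km] ..
    also have "\<dots> = of_real (Re (to_complex (a k))) + of_real (Im (to_complex (a k))) * i"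
      using r by (simp add: field_simps)
    finally show ?thesis using i(2)[of "a k"] by simp
  qed
  then have "eventually (\<lambda>m. coef ?u k m = a k) sequentially" for k
    unfolding eventually_sequentially by (intro exI[of _ "Suc k"]) auto
  then have "to_l2 ?u = a" by (intro ext to_l2_eqI)
  moreover have "?u \<in> linf_seqs" using u_le by (rule linf_seqsI)
  moreover have "sup_norm ?u \<le> 4 * ?r" using u_le by (rule sup_norm_le)
  ultimately show ?thesis by blast
qed

text \<open>The sets of positivity of the Rademacher functions, inside the index set of the sequences.\<close>

definition rademacher_set :: "nat \<Rightarrow> nat set" where
  "rademacher_set k = {n. cube_seq (\<lambda>m A. k \<in> A) n}"

text \<open>
  The indicator of the set of positivity is \<open>(1 + r k) / 2\<close>, and \<open>r k\<close> has mean zero.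
\<close>

lemma to_l2_rademacher_set:
  "to_l2 (\<lambda>n. if n \<in> rademacher_set k then 1 else 0) k = (of_real (1 / 2) :: 'k::real_or_complex)"
proof (rule to_l2_eqI)
  have "coef (\<lambda>n. if n \<in> rademacher_set k then 1 else 0) k m = (of_real (1 / 2) :: 'k)" if "k < m" for m
  proof -
    have "coef (\<lambda>n. if n \<in> rademacher_set k then 1 else 0) k m
        = cube_avg m (\<lambda>A. of_real (1 / 2 * (rademacher k A * rademacher k A) + 1 / 2 * rademacher k A) :: 'k)"
      unfolding coef_def by (rule cube_avg_cong) (auto simp: rademacher_set_def cube_seq_index rademacher_def)
    also have "\<dots> = of_real (cube_avg m (\<lambda>A. 1 / 2 * (rademacher k A * rademacher k A) + 1 / 2 * rademacher k A))"
      by (rule linear_cube_avg[symmetric]) (auto intro!: linearI simp: scaleR_conv_of_real)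
    also have "\<dots> = of_real (1 / 2 + 1 / 2 * cube_avg m (rademacher k))"
      using that by (simp only: cube_avg_add cube_avg_mult cube_avg_rademacher_mult) simp
    also have "cube_avg m (rademacher k) = 0"
    proof -
      let ?h = "\<lambda>i b. if i = k then (if b then 1 else - 1) else (1::real)"
      have "(\<Prod>i<m. ?h i (i \<in> A)) = rademacher k A" for A
        using that by (subst prod.delta) (auto simp: rademacher_def)
      then have "cube_avg m (rademacher k) = (\<Prod>i<m. (?h i True + ?h i False) / 2)"
        using cube_avg_prod[of m ?h] by simp
      also have "\<dots> = 0" using that by (intro prod_zero) auto
      finally show ?thesis .
    qed
    finally show ?thesis by simp
  qed
  then show "eventually (\<lambda>m. coef (\<lambda>n. if n \<in> rademacher_set k then 1 else 0) k m = (of_real (1 / 2) :: 'k)) sequentially"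
    unfolding eventually_sequentially by (intro exI[of _ "Suc k"]) auto
qed


section \<open>Quotients isomorphic to \<open>\<ell>\<^sub>2\<close>\<close>

lemma norm_le_l2_norm:
  assumes "x \<in> l2_seqs"
  shows "norm (x n) \<le> l2_norm x"
proof -
  have "(norm (x n))\<^sup>2 \<le> (\<Sum>n. (norm (x n))\<^sup>2)"
    using assms sum_le_suminf[of "\<lambda>n. (norm (x n))\<^sup>2" "{n}"] by (simp add: l2_seqs_def)
  then show ?thesis unfolding l2_norm_def by (rule real_le_rsqrt)
qed

lemma l2_subset_c0: "(l2_seqs :: (nat \<Rightarrow> 'k::real_or_complex) set) \<subseteq> c0_seqs"
proof
  fix x :: "nat \<Rightarrow> 'k" assume "x \<in> l2_seqs"
  then have "summable (\<lambda>n. (norm (x n))\<^sup>2)" by (simp add: l2_seqs_def)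
  then have "(\<lambda>n. (norm (x n))\<^sup>2) \<longlonglongrightarrow> 0" by (rule summable_LIMSEQ_zero)
  then have "(\<lambda>n. sqrt ((norm (x n))\<^sup>2)) \<longlonglongrightarrow> sqrt 0" by (rule tendsto_real_sqrt)
  then show "x \<in> c0_seqs" by (simp add: c0_seqs_def tendsto_norm_zero_iff)
qed

lemma linf_times_c0:
  assumes "a \<in> linf_seqs" "x \<in> c0_seqs"
  shows "(\<lambda>n. a n * x n) \<in> c0_seqs"
proof -
  have "x \<longlonglongrightarrow> 0" using assms(2) by (simp add: c0_seqs_def)
  then have "(\<lambda>n. sup_norm a * norm (x n)) \<longlonglongrightarrow> 0"
    by (intro tendsto_mult_right_zero tendsto_norm_zero)
  then have "(\<lambda>n. a n * x n) \<longlonglongrightarrow> 0"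
    by (rule Lim_null_comparison[rotated], intro always_eventually allI)
      (simp add: norm_mult mult_right_mono norm_le_sup_norm[OF assms(1)])
  then show ?thesis by (simp add: c0_seqs_def)
qed

context vector_measures_c0
begin

text \<open>The measure \<open>\<Sum>n a n \<nu> n J(e n)\<close>, written without a series.\<close>

definition diag_measure :: "(nat \<Rightarrow> 'a set \<Rightarrow> 'k) \<Rightarrow> (nat \<Rightarrow> 'k) \<Rightarrow> 'a set \<Rightarrow> 'x" where
  "diag_measure \<nu> a E = (if E \<in> S then J (\<lambda>n. a n * \<nu> n E) else 0)"

lemma norm_diag_measure_le:
  assumes a: "a \<in> linf_seqs" and c0: "(\<lambda>n. \<nu> n E) \<in> c0_seqs" and b: "\<And>n. norm (\<nu> n E) \<le> b"
  shows "norm (diag_measure \<nu> a E) \<le> C * (sup_norm a * b)"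
proof -
  have "norm (J (\<lambda>n. a n * \<nu> n E)) \<le> C * sup_norm (\<lambda>n. a n * \<nu> n E)"
    by (rule J_bound[OF linf_times_c0[OF a c0]])
  also have "sup_norm (\<lambda>n. a n * \<nu> n E) \<le> sup_norm a * b"
    using norm_le_sup_norm[OF a] sup_norm_nonneg[OF a] b
    by (intro sup_norm_le) (simp add: norm_mult mult_mono)
  then have "C * sup_norm (\<lambda>n. a n * \<nu> n E) \<le> C * (sup_norm a * b)"
    using C_nonneg by (rule mult_left_mono)
  finally have "norm (J (\<lambda>n. a n * \<nu> n E)) \<le> C * (sup_norm a * b)" .
  moreover have "0 \<le> b" using b[of 0] norm_ge_zero[of "\<nu> 0 E"] by linarith
  then have "0 \<le> C * (sup_norm a * b)" using C_nonneg sup_norm_nonneg[OF a] by simp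
  ultimately show ?thesis by (simp add: diag_measure_def)
qed

lemma diag_measure_ba:
  assumes a: "a \<in> linf_seqs"
    and c0: "\<And>E. E \<in> S \<Longrightarrow> (\<lambda>n. \<nu> n E) \<in> c0_seqs" and b: "\<And>n E. E \<in> S \<Longrightarrow> norm (\<nu> n E) \<le> b"
    and add: "\<And>n E E'. E \<in> S \<Longrightarrow> E' \<in> S \<Longrightarrow> E \<inter> E' = {} \<Longrightarrow> \<nu> n (E \<union> E') = \<nu> n E + \<nu> n E'"
  shows "diag_measure \<nu> a \<in> ba_measures S"
  unfolding ba_measures_def
proof (intro CollectI conjI ballI allI impI)
  fix E E' assume E: "E \<in> S" "E' \<in> S" "E \<inter> E' = {}"
  have "J (\<lambda>n. a n * \<nu> n (E \<union> E')) = J (\<lambda>n. a n * \<nu> n E + a n * \<nu> n E')"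
    by (simp add: add[OF E] distrib_left)
  also have "\<dots> = J (\<lambda>n. a n * \<nu> n E) + J (\<lambda>n. a n * \<nu> n E')"
    using E by (intro J_add linf_times_c0 a c0)
  finally show "diag_measure \<nu> a (E \<union> E') = diag_measure \<nu> a E + diag_measure \<nu> a E'"
    using E A.Un[OF E(1,2)] by (simp add: diag_measure_def)
next
  show "bounded (diag_measure \<nu> a ` S)"
    unfolding bounded_iff
    by (intro exI[of _ "C * (sup_norm a * b)"]) (auto intro!: norm_diag_measure_le a c0 b)
qed (simp add: diag_measure_def)

text \<open>
  Measures \<open>\<nu> n\<close> that tend to zero at every set, while staying away from zero at suitable sets \<open>A n\<close>,
  embed the bounded sequences as diagonal operators; evaluation at the \<open>A n\<close> recovers the sequence.
  Composing it with the operator onto \<open>\<ell>\<^sub>2\<close> gives the quotient.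
\<close>

lemma quotient_operator_l2:
  assumes V: "fun_subspace smul V" "V \<subseteq> ba_measures S"
    and c0: "\<And>E. E \<in> S \<Longrightarrow> (\<lambda>n. \<nu> n E) \<in> c0_seqs" and b: "\<And>n E. E \<in> S \<Longrightarrow> norm (\<nu> n E) \<le> b"
    and A: "\<And>n. A n \<in> S" "\<And>n. \<nu> n (A n) = r" "r \<noteq> 0"
    and diag: "\<And>a. a \<in> linf_seqs \<Longrightarrow> diag_measure \<nu> a \<in> V"
  shows "\<exists>T C. quotient_operator smul (*) V ba_norm l2_seqs l2_norm T C"
proof -
  let ?P = "\<lambda>F n. \<psi> n (F (A n))"
  let ?K = "4 * C * b / norm r * 4"
  have P_le: "norm (?P F n) \<le> ba_norm F" if "F \<in> V" for F n
    using that V(2) A(1) \<psi> by (intro norm_functional_le_ba_norm) auto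
  then have P: "?P F \<in> linf_seqs" "sup_norm (?P F) \<le> ba_norm F" if "F \<in> V" for F
    using that by (auto intro: linf_seqsI sup_norm_le)
  have "quotient_operator smul (*) V ba_norm l2_seqs l2_norm (\<lambda>F. to_l2 (?P F)) ?K"
  proof
    show "bounded_operator (fun_nspace smul V ba_norm) (fun_nspace (*) l2_seqs l2_norm) (\<lambda>F. to_l2 (?P F))"
      unfolding bounded_operator_fun_nspace
    proof (intro conjI ballI allI)
      show "to_l2 (?P F) \<in> l2_seqs" if "F \<in> V" for F using P(1)[OF that] by (rule bessel_to_l2)
      show "to_l2 (?P (\<lambda>i. F i + G i)) = (\<lambda>i. to_l2 (?P F) i + to_l2 (?P G) i)" if "F \<in> V" "G \<in> V" for F G
        using to_l2_add[OF P(1)[OF that(1)] P(1)[OF that(2)]] by (simp add: dual_unit_ballD(1)[OF \<psi>] fun_eq_iff)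
      show "to_l2 (?P (\<lambda>i. smul c (F i))) = (\<lambda>i. c * to_l2 (?P F) i)" if "F \<in> V" for F c
        using to_l2_scale[OF P(1)[OF that]] by (simp add: dual_unit_ballD(2)[OF \<psi>] fun_eq_iff)
      have "l2_norm (to_l2 (?P F)) \<le> 1 * ba_norm F" if "F \<in> V" for F
        using bessel_to_l2(2)[OF P(1)[OF that]] P(2)[OF that] by simp
      then show "\<exists>C. \<forall>F\<in>V. l2_norm (to_l2 (?P F)) \<le> C * ba_norm F" by blast
    qed
    fix z :: "nat \<Rightarrow> 'k" assume "z \<in> l2_seqs"
    then obtain u where u: "u \<in> linf_seqs" "to_l2 u = z" "sup_norm u \<le> 4 * l2_norm z"
      using to_l2_lift by blast
    \<comment> \<open>Evaluation at \<open>A n\<close> multiplies the \<open>n\<close>-th entry by \<open>r\<close>.\<close>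
    let ?a = "\<lambda>n. u n / r"
    have "norm (?a n) \<le> sup_norm u / norm r" for n
      using norm_le_sup_norm[OF u(1)] by (simp add: norm_divide divide_right_mono)
    then have a: "?a \<in> linf_seqs" "sup_norm ?a \<le> sup_norm u / norm r"
      by (auto intro: linf_seqsI sup_norm_le)
    have "?P (diag_measure \<nu> ?a) = u"
    proof
      fix n
      show "?P (diag_measure \<nu> ?a) n = u n"
        using A \<psi>_J[OF linf_times_c0[OF a(1) c0[OF A(1)]]] by (simp add: diag_measure_def)
    qed
    moreover have "ba_norm (diag_measure \<nu> ?a) \<le> ?K * l2_norm z"
    proof -
      have b0: "b \<ge> 0" using b[OF A(1)[of 0], of 0] norm_ge_zero[of "\<nu> 0 (A 0)"] by linarith
      have "ba_norm (diag_measure \<nu> ?a) \<le> 4 * (C * (sup_norm ?a * b))"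
        using diag[OF a(1)] V(2) norm_diag_measure_le[OF a(1) c0 b] by (intro ba_norm_le) auto
      also have "\<dots> \<le> 4 * (C * (4 * l2_norm z / norm r * b))"
      proof -
        have "sup_norm ?a \<le> 4 * l2_norm z / norm r"
          using a(2) u(3) A(3) by (meson divide_right_mono norm_ge_zero order_trans)
        then show ?thesis using C_nonneg b0 by (intro mult_left_mono mult_right_mono) auto
      qed
      finally show ?thesis by (simp add: field_simps)
    qed
    ultimately show "\<exists>F\<in>V. to_l2 (?P F) = z \<and> ba_norm F \<le> ?K * l2_norm z"
      using diag[OF a(1)] u(2) by (intro bexI[of _ "diag_measure \<nu> ?a"]) auto
  qed (use V fun_subspace_l2 l2_norm_definite ba_norm_nonneg vector_space vector_space_scalars in auto)
  then show ?thesis by blast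
qed

text \<open>
  For finitely additive measures, the operator onto \<open>\<ell>\<^sub>2\<close> itself supplies the \<open>\<nu> n\<close>: its coordinates
  are finitely additive measures on the indices of a sequence of points.
\<close>

lemma quotient_operator_l2_ba:
  assumes "nontrivial_sigma_algebra S"
  shows "\<exists>T C. quotient_operator smul (*) (ba_measures S) ba_norm l2_seqs l2_norm T C"
proof -
  obtain D and w where D: "\<And>n. D n \<in> S" "disjoint_family D" "\<And>n m. w n \<in> D m \<longleftrightarrow> n = (m::nat)"
    using ex_separated_points[OF assms(1)] by metis
  let ?ind = "\<lambda>E j. if w j \<in> E then 1 else (0::'k)"
  let ?\<nu> = "\<lambda>n E. to_l2 (?ind E) n"
  have ind: "?ind E \<in> linf_seqs" "sup_norm (?ind E) \<le> 1" for E
    by (auto intro!: linf_seqsI[of _ 1] sup_norm_le)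
  have c0: "(\<lambda>n. ?\<nu> n E) \<in> c0_seqs" for E
    using bessel_to_l2(1)[OF ind(1)] l2_subset_c0 by blast
  have b: "norm (?\<nu> n E) \<le> 1" for n E
    using norm_le_l2_norm[OF bessel_to_l2(1)[OF ind(1)], of E n] bessel_to_l2(2)[OF ind(1), of E] ind(2)[of E]
    by linarith
  have add: "?\<nu> n (E \<union> E') = ?\<nu> n E + ?\<nu> n E'" if "E \<inter> E' = {}" for n E E'
  proof -
    have "?ind (E \<union> E') = (\<lambda>j. ?ind E j + ?ind E' j)" using that by (auto simp: fun_eq_iff)
    then show ?thesis using to_l2_add[OF ind(1) ind(1)] by simp
  qed
  let ?A = "\<lambda>n. \<Union>j\<in>rademacher_set n. D j"
  have "?\<nu> n (?A n) = of_real (1 / 2)" for n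
  proof -
    have "?ind (?A n) = (\<lambda>j. if j \<in> rademacher_set n then 1 else 0)" by (simp add: D(3))
    then show ?thesis using to_l2_rademacher_set[of n] by simp
  qed
  then show ?thesis
    using fun_subspace_ba c0 b D(1) diag_measure_ba[OF _ c0 b add]
    by (intro quotient_operator_l2[where \<nu> = ?\<nu> and A = ?A and r = "of_real (1 / 2)" and b = 1]) auto
qed

end


section \<open>Rademacher functions of an atomless measure\<close>

context finite_measure
begin

text \<open>
  Split a set into two parts of positive measure; one of them has at most half the measure. Iterate.
\<close>

lemma atomless_small_subset:
  assumes at: "atomless M" and A: "A \<in> sets M" "measure M A > 0" and e: "e > 0"
  shows "\<exists>B\<in>sets M. B \<subseteq> A \<and> 0 < measure M B \<and> measure M B < e"
proof -
  have "\<exists>B\<in>sets M. B \<subseteq> A \<and> 0 < measure M B \<and> measure M B \<le> measure M A / 2 ^ n" for n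
  proof (induction n)
    case 0
    then show ?case using A by auto
  next
    case (Suc n)
    then obtain B where B: "B \<in> sets M" "B \<subseteq> A" "0 < measure M B" "measure M B \<le> measure M A / 2 ^ n"
      by blast
    then obtain B' where B': "B' \<in> sets M" "B' \<subseteq> B" "0 < measure M B'" "measure M B' < measure M B"
      using at[unfolded atomless_def, rule_format, OF B(1)] by (auto simp: emeasure_eq_measure ennreal_less_iff)
    have diff: "measure M (B - B') = measure M B - measure M B'"
      using B B' by (intro finite_measure_Diff) auto
    show ?case
    proof (cases "measure M B' \<le> measure M B / 2")
      case True
      then show ?thesis using B B' by (intro bexI[of _ B']) auto
    next
      case False
      then show ?thesis using B B' diff by (intro bexI[of _ "B - B'"]) auto
    qed
  qed
  moreover obtain n :: nat where "measure M A / 2 ^ n < e"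
  proof -
    have "(\<lambda>n. measure M A * (1 / 2) ^ n) \<longlonglongrightarrow> measure M A * 0"
      by (intro tendsto_mult_left LIMSEQ_power_zero) simp
    then have "eventually (\<lambda>n. measure M A * (1 / 2) ^ n < e) sequentially"
      using e by (intro order_tendstoD(2)) auto
    then show thesis using that by (auto simp: eventually_sequentially power_one_over field_simps)
  qed
  ultimately show ?thesis by (meson le_less_trans)
qed

text \<open>
  Sierpinski's exhaustion: keep adding a set of at least half the possible measure. A remaining gap
  would be fillable by a small set at every stage, so infinitely often by the same amount.
\<close>

lemma atomless_half:
  assumes at: "atomless M" and A: "A \<in> sets M"
  shows "\<exists>B\<in>sets M. B \<subseteq> A \<and> measure M B = measure M A / 2"
proof -
  let ?t = "measure M A / 2"
  \<comment> \<open>\<open>?ok B C\<close>: the set \<open>C\<close> may be added to \<open>B\<close> without exceeding half the measure.\<close>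
  let ?ok = "\<lambda>B C. C \<in> sets M \<and> C \<subseteq> A - B \<and> measure M B + measure M C \<le> ?t"
  let ?P = "\<lambda>B. B \<in> sets M \<and> B \<subseteq> A \<and> measure M B \<le> ?t"
  let ?Q = "\<lambda>B B'. B \<subseteq> B' \<and> (\<forall>C. ?ok B C \<longrightarrow> measure M C \<le> 2 * (measure M B' - measure M B))"
  have "\<exists>f. \<forall>n::nat. ?P (f n) \<and> ?Q (f n) (f (Suc n))"
  proof (rule dependent_nat_choice)
    show "\<exists>B. ?P B" by (intro exI[of _ "{}"]) simp
    fix B n assume B: "?P B"
    let ?s = "SUP C\<in>{C. ?ok B C}. measure M C"
    have bdd: "bdd_above (measure M ` {C. ?ok B C})"
      by (intro bdd_aboveI2[of _ _ "measure M (space M)"]) (rule bounded_measure)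
    have empty: "{} \<in> {C. ?ok B C}" using B by simp
    have le: "measure M C \<le> ?s" if "?ok B C" for C
      using bdd that by (intro cSUP_upper) auto
    obtain C where C: "?ok B C" "?s \<le> 2 * measure M C"
    proof (cases "?s \<le> 0")
      case True
      then show thesis using that[of "{}"] empty by simp
    next
      case False
      have "\<exists>C. ?ok B C \<and> ?s / 2 < measure M C"
      proof (rule ccontr)
        assume "\<not> ?thesis"
        then have small: "measure M C \<le> ?s / 2" if "C \<in> {C. ?ok B C}" for C
          using that not_le by blast
        have "{C. ?ok B C} \<noteq> {}" using empty by (metis empty_iff)
        then have "?s \<le> ?s / 2" using small by (rule cSUP_least)
        then show False using False by linarith
      qed
      then obtain C where "?ok B C \<and> ?s / 2 < measure M C" ..
      then show thesis using that[of C] by linarith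
    qed
    have "measure M (B \<union> C) = measure M B + measure M C"
      using B C(1) by (intro finite_measure_Union) auto
    moreover have "measure M E \<le> 2 * measure M C" if "?ok B E" for E
      using le[OF that] C(2) by linarith
    ultimately show "\<exists>B'. ?P B' \<and> ?Q B B'"
      using B C(1) by (intro exI[of _ "B \<union> C"]) auto
  qed
  then obtain f where f': "\<forall>n::nat. ?P (f n) \<and> ?Q (f n) (f (Suc n))" ..
  have f: "?P (f n)" "?Q (f n) (f (Suc n))" for n
    using conjunct1[OF spec[OF f', of n]] conjunct2[OF spec[OF f', of n]] .
  let ?U = "\<Union>n. f n"
  have U: "?U \<in> sets M" "?U \<subseteq> A" using f(1) by auto
  have "incseq f" using f(2) by (intro incseq_SucI) blast
  then have lim: "(\<lambda>n. measure M (f n)) \<longlonglongrightarrow> measure M ?U"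
    using f(1) by (intro finite_Lim_measure_incseq) auto
  have le: "measure M ?U \<le> ?t" using lim by (rule LIMSEQ_le_const2) (use f(1) in auto)
  have "measure M ?U = ?t"
  proof (rule ccontr)
    assume "measure M ?U \<noteq> ?t"
    then have gap: "measure M ?U < ?t" using le by simp
    then have "measure M (A - ?U) > 0"
      using U A finite_measure_Diff[of A ?U] measure_nonneg[of M ?U] by linarith
    then obtain E where E: "E \<in> sets M" "E \<subseteq> A - ?U" "0 < measure M E" "measure M E < ?t - measure M ?U"
      using atomless_small_subset[OF at _ _ , of "A - ?U" "?t - measure M ?U"] gap A U by auto
    have "measure M E \<le> 2 * (measure M (f (Suc n)) - measure M (f n))" for n
    proof -
      have "measure M (f n) \<le> measure M ?U" using U(1) by (intro finite_measure_mono) auto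
      then have "?ok (f n) E" using E by auto
      then show ?thesis using f(2) by blast
    qed
    moreover have "(\<lambda>n. 2 * (measure M (f (Suc n)) - measure M (f n))) \<longlonglongrightarrow> 2 * (measure M ?U - measure M ?U)"
      using lim LIMSEQ_Suc[OF lim] by (intro tendsto_intros)
    ultimately have "measure M E \<le> 0" by (intro LIMSEQ_le_const) auto
    then show False using E(3) by simp
  qed
  then show ?thesis using U by blast
qed

end

text \<open>Repeated halving produces a dyadic tree of cells, indexed by the path read from the leaf.\<close>

primrec cell :: "('a set \<Rightarrow> 'a set) \<Rightarrow> 'a set \<Rightarrow> bool list \<Rightarrow> 'a set" where
  "cell H \<Omega> [] = \<Omega>"
| "cell H \<Omega> (b # l) = (if b then H (cell H \<Omega> l) else cell H \<Omega> l - H (cell H \<Omega> l))"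

declare cell.simps(2) [simp del]

definition words :: "nat \<Rightarrow> bool list set" where
  "words n = {l. length l = n}"

lemma words_simps: "words 0 = {[]}" "words (Suc n) = Cons True ` words n \<union> Cons False ` words n"
  by (auto simp: words_def length_Suc_conv image_iff)

lemma finite_words: "finite (words n)"
  by (induction n) (auto simp: words_simps)

lemma sum_words_Suc: "(\<Sum>l\<in>words (Suc n). f l) = (\<Sum>l\<in>words n. f (True # l) + f (False # l))"
proof -
  have "(\<Sum>l\<in>words (Suc n). f l) = (\<Sum>l\<in>Cons True ` words n. f l) + (\<Sum>l\<in>Cons False ` words n. f l)"
    unfolding words_simps by (rule sum.union_disjoint) (auto simp: finite_words)
  also have "\<dots> = (\<Sum>l\<in>words n. f (True # l)) + (\<Sum>l\<in>words n. f (False # l))"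
    by (simp add: sum.reindex)
  finally show ?thesis by (simp add: sum.distrib)
qed

lemma card_words: "card (words n) = 2 ^ n"
proof (induction n)
  case (Suc n)
  then show ?case using sum_words_Suc[of "\<lambda>_. 1::nat" n] by simp
qed (simp add: words_simps)

locale halving = finite_measure M for M :: "'a measure" +
  fixes H :: "'a set \<Rightarrow> 'a set"
  assumes H_sets: "\<And>A. A \<in> sets M \<Longrightarrow> H A \<in> sets M" and H_subset: "\<And>A. A \<in> sets M \<Longrightarrow> H A \<subseteq> A"
    and H_half: "\<And>A. A \<in> sets M \<Longrightarrow> measure M (H A) = measure M A / 2"
begin

abbreviation "Cell \<equiv> cell H (space M)"

lemma Cell_sets: "Cell l \<in> sets M"
  by (induction l) (auto simp: cell.simps H_sets)

lemma measure_Cell: "measure M (Cell l) = measure M (space M) / 2 ^ length l"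
  by (induction l) (auto simp: cell.simps H_half H_sets H_subset Cell_sets finite_measure_Diff)

lemma Cell_disjoint: "length l = length l' \<Longrightarrow> l \<noteq> l' \<Longrightarrow> Cell l \<inter> Cell l' = {}"
proof (induction l l' rule: list_induct2)
  case (Cons b l b' l')
  have sub: "Cell (b # l) \<subseteq> Cell l" for b l using H_subset[OF Cell_sets] by (auto simp: cell.simps)
  show ?case
  proof (cases "l = l'")
    case True
    then show ?thesis using Cons.prems by (auto simp: cell.simps)
  next
    case False
    then show ?thesis using Cons.IH sub[of b l] sub[of b' l'] by blast
  qed
qed simp

definition piece :: "'a set \<Rightarrow> bool list \<Rightarrow> real" where
  "piece E l = measure M (E \<inter> Cell l)"

text \<open>The integral over \<open>E\<close> of the \<open>n\<close>-th Rademacher function of the tree.\<close>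

definition rad :: "nat \<Rightarrow> 'a set \<Rightarrow> real" where
  "rad n E = (\<Sum>l\<in>words n. piece E (True # l) - piece E (False # l))"

definition rad_set :: "nat \<Rightarrow> 'a set" where
  "rad_set n = (\<Union>l\<in>words n. Cell (True # l))"

lemma piece_split:
  assumes "E \<in> sets M"
  shows "piece E l = piece E (True # l) + piece E (False # l)"
proof -
  have "E \<inter> Cell l = (E \<inter> Cell (True # l)) \<union> (E \<inter> Cell (False # l))"
    using H_subset[OF Cell_sets] by (auto simp: cell.simps)
  moreover have "measure M ((E \<inter> Cell (True # l)) \<union> (E \<inter> Cell (False # l))) =
      measure M (E \<inter> Cell (True # l)) + measure M (E \<inter> Cell (False # l))"
    using assms Cell_sets by (intro finite_measure_Union) (auto simp: cell.simps intro!: sets.Int sets.Diff H_sets)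
  ultimately show ?thesis by (simp only: piece_def)
qed

lemma sum_piece:
  assumes "E \<in> sets M"
  shows "(\<Sum>l\<in>words n. piece E l) = measure M E"
proof (induction n)
  case 0
  then show ?case using sets.sets_into_space[OF assms] by (simp add: words_simps piece_def Int_absorb2)
next
  case (Suc n)
  then show ?case by (simp add: sum_words_Suc piece_split[OF assms, symmetric])
qed

lemma abs_rad_le:
  assumes "E \<in> sets M"
  shows "\<bar>rad n E\<bar> \<le> measure M E"
proof -
  have "\<bar>rad n E\<bar> \<le> (\<Sum>l\<in>words n. \<bar>piece E (True # l) - piece E (False # l)\<bar>)"
    unfolding rad_def by (rule sum_abs)
  also have "\<dots> \<le> (\<Sum>l\<in>words n. piece E l)"
    by (intro sum_mono) (subst piece_split[OF assms], simp add: piece_def abs_le_iff)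
  finally show ?thesis by (simp add: sum_piece[OF assms])
qed

lemma rad_Un:
  assumes "E \<in> sets M" "E' \<in> sets M" "E \<inter> E' = {}"
  shows "rad n (E \<union> E') = rad n E + rad n E'"
proof -
  have "piece (E \<union> E') l = piece E l + piece E' l" for l
    unfolding piece_def Int_Un_distrib2 using assms Cell_sets[of l]
    by (intro finite_measure_Union) auto
  then show ?thesis by (simp add: rad_def sum.distrib[symmetric] algebra_simps)
qed

text \<open>
  The energy \<open>2\<^sup>n \<Sum>l (piece E l)\<^sup>2\<close> at level \<open>n\<close> is, up to the factor \<open>measure M (space M)\<close>, the
  squared norm of the conditional expectation of the indicator of \<open>E\<close>. It is increasing and bounded, and its increments dominate \<open>(rad n E)\<^sup>2\<close>.
\<close>

lemma rad_tendsto_0: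
  assumes E: "E \<in> sets M"
  shows "(\<lambda>n. rad n E) \<longlonglongrightarrow> 0"
proof -
  let ?V = "\<lambda>n. 2 ^ n * (\<Sum>l\<in>words n. (piece E l)\<^sup>2)"
  let ?d = "\<lambda>n. \<Sum>l\<in>words n. (piece E (True # l) - piece E (False # l))\<^sup>2"
  have step: "?V (Suc n) = ?V n + 2 ^ n * ?d n" for n
  proof -
    have "?V (Suc n) = 2 ^ n * (\<Sum>l\<in>words n. 2 * ((piece E (True # l))\<^sup>2 + (piece E (False # l))\<^sup>2))"
      unfolding sum_words_Suc sum_distrib_left[symmetric] by simp
    also have "(\<Sum>l\<in>words n. 2 * ((piece E (True # l))\<^sup>2 + (piece E (False # l))\<^sup>2)) =
        (\<Sum>l\<in>words n. (piece E l)\<^sup>2 + (piece E (True # l) - piece E (False # l))\<^sup>2)"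
    proof (rule sum.cong[OF refl])
      fix l
      show "2 * ((piece E (True # l))\<^sup>2 + (piece E (False # l))\<^sup>2) =
          (piece E l)\<^sup>2 + (piece E (True # l) - piece E (False # l))\<^sup>2"
        unfolding piece_split[OF E, of l] by (simp add: power2_eq_square algebra_simps)
    qed
    finally show ?thesis by (simp add: distrib_left sum.distrib)
  qed
  have rad: "(rad n E)\<^sup>2 \<le> ?V (Suc n) - ?V n" for n
    unfolding step rad_def
    using sum_squared_le_sum_of_squares[of "\<lambda>l. piece E (True # l) - piece E (False # l)" "words n"]
    by (simp add: card_words mult.commute)
  have "?V n \<le> (measure M (space M))\<^sup>2" for n
  proof -
    have "(piece E l)\<^sup>2 \<le> measure M (space M) / 2 ^ n * piece E l" if "l \<in> words n" for l
    proof -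
      have "piece E l \<le> measure M (Cell l)"
        unfolding piece_def using Cell_sets by (intro finite_measure_mono) auto
      then have "piece E l \<le> measure M (space M) / 2 ^ n"
        using that by (simp add: measure_Cell words_def)
      then show ?thesis unfolding power2_eq_square by (rule mult_right_mono) (simp add: piece_def)
    qed
    then have "(\<Sum>l\<in>words n. (piece E l)\<^sup>2) \<le> measure M (space M) / 2 ^ n * measure M E"
      unfolding sum_piece[OF E, of n, symmetric] sum_distrib_left by (rule sum_mono)
    then have "?V n \<le> 2 ^ n * (measure M (space M) / 2 ^ n * measure M E)"
      by (rule mult_left_mono) simp
    also have "\<dots> \<le> (measure M (space M))\<^sup>2"
      using bounded_measure[of E] by (simp add: power2_eq_square mult_left_mono)
    finally show ?thesis .
  qed
  moreover have "incseq ?V" using step by (intro incseq_SucI) (simp add: sum_nonneg)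
  ultimately obtain L where L: "?V \<longlonglongrightarrow> L" using incseq_convergent[of ?V] by blast
  have "(\<lambda>n. ?V (Suc n) - ?V n) \<longlonglongrightarrow> L - L" using LIMSEQ_Suc[OF L] L by (rule tendsto_diff)
  then have "(\<lambda>n. ?V (Suc n) - ?V n) \<longlonglongrightarrow> 0" by (simp only: diff_self)
  then have "(\<lambda>n. (rad n E)\<^sup>2) \<longlonglongrightarrow> 0"
    by (rule tendsto_sandwich[OF always_eventually always_eventually tendsto_const, rotated 2])
      (use rad in \<open>simp_all only: zero_le_power2 simp_thms\<close>)
  then have "(\<lambda>n. sqrt ((rad n E)\<^sup>2)) \<longlonglongrightarrow> sqrt 0" by (rule tendsto_real_sqrt)
  then show ?thesis by (simp add: tendsto_rabs_zero_iff)
qed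

lemma rad_set_sets: "rad_set n \<in> sets M"
  unfolding rad_set_def using finite_words Cell_sets by (intro sets.finite_UN) auto

lemma rad_rad_set: "rad n (rad_set n) = measure M (space M) / 2"
proof -
  have "piece (rad_set n) (True # l) - piece (rad_set n) (False # l) = measure M (space M) / 2 ^ Suc n"
    if l: "l \<in> words n" for l
  proof -
    have "Cell (True # l) \<subseteq> rad_set n" using l unfolding rad_set_def by blast
    then have "rad_set n \<inter> Cell (True # l) = Cell (True # l)" by blast
    moreover have "rad_set n \<inter> Cell (False # l) = {}"
    proof -
      have "Cell (True # l') \<inter> Cell (False # l) = {}" if "l' \<in> words n" for l'
        using l that by (intro Cell_disjoint) (auto simp: words_def)
      then show ?thesis unfolding rad_set_def by blast
    qed
    ultimately show ?thesis
      using l unfolding piece_def by (simp only: measure_Cell measure_empty) (simp add: words_def)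
  qed
  then have "rad n (rad_set n) = (\<Sum>l\<in>words n. measure M (space M) / 2 ^ Suc n)"
    unfolding rad_def by (intro sum.cong) auto
  then show ?thesis by (simp add: card_words)
qed

end

context vector_measures_c0
begin

text \<open>
  The indefinite integrals of the Rademacher functions of an atomless measure are dominated by that
  measure. This makes the diagonal measures countably additive.
\<close>

lemma quotient_operator_l2_ca:
  assumes M: "M \<in> ca_pos \<Omega> S" "emeasure M \<Omega> \<noteq> 0" "atomless M"
  shows "\<exists>T C. quotient_operator smul (*) (ca_measures S) ba_norm l2_seqs l2_norm T C"
proof -
  have sp: "space M = \<Omega>" "sets M = S" and fin: "finite_measure M" using M(1) by (auto simp: ca_pos_def)
  interpret M: finite_measure M by (rule fin)
  have "\<forall>A. \<exists>B. A \<in> sets M \<longrightarrow> B \<in> sets M \<and> B \<subseteq> A \<and> measure M B = measure M A / 2"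
    using M.atomless_half[OF M(3)] by blast
  then obtain H where H: "\<And>A. A \<in> sets M \<Longrightarrow> H A \<in> sets M \<and> H A \<subseteq> A \<and> measure M (H A) = measure M A / 2"
    by metis
  interpret H: halving M H by unfold_locales (use H in auto)
  let ?\<nu> = "\<lambda>n E. of_real (H.rad n E) :: 'k"
  let ?r = "of_real (measure M (space M) / 2) :: 'k"
  have c0: "(\<lambda>n. ?\<nu> n E) \<in> c0_seqs" if "E \<in> S" for E
    using tendsto_of_real[OF H.rad_tendsto_0, of E, where 'a = 'k] that by (simp add: c0_seqs_def sp)
  have le: "norm (?\<nu> n E) \<le> measure M E" if "E \<in> S" for n E
    using H.abs_rad_le[of E n] that by (simp add: sp)
  have b: "norm (?\<nu> n E) \<le> measure M (space M)" if "E \<in> S" for n E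
    using le[OF that, of n] M.bounded_measure[of E] by linarith
  have add: "?\<nu> n (E \<union> E') = ?\<nu> n E + ?\<nu> n E'" if "E \<in> S" "E' \<in> S" "E \<inter> E' = {}" for n E E'
    using H.rad_Un[of E E' n] that by (simp add: sp)
  have "measure M (space M) \<noteq> 0" using M(2) by (simp add: sp M.emeasure_eq_measure)
  then have r: "?r \<noteq> 0" by simp
  have diag: "diag_measure ?\<nu> a \<in> ca_measures S" if a: "a \<in> linf_seqs" for a
  proof (rule ca_measuresI[OF diag_measure_ba[OF a c0 b add]])
    fix B :: "nat \<Rightarrow> 'a set" assume B: "range B \<subseteq> S" "decseq B" "(\<Inter>n. B n) = {}"
    have "(\<lambda>n. measure M (B n)) \<longlonglongrightarrow> measure M (\<Inter>n. B n)"
      using B by (intro M.finite_Lim_measure_decseq) (auto simp: sp)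
    then have "(\<lambda>n. C * (sup_norm a * measure M (B n))) \<longlonglongrightarrow> 0"
      using B(3) by (intro tendsto_mult_right_zero) simp
    then show "(\<lambda>n. diag_measure ?\<nu> a (B n)) \<longlonglongrightarrow> 0"
    proof (rule Lim_null_comparison[rotated])
      have "norm (diag_measure ?\<nu> a (B n)) \<le> C * (sup_norm a * measure M (B n))" for n
        using B(1) by (intro norm_diag_measure_le a c0 le) auto
      then show "eventually (\<lambda>n. norm (diag_measure ?\<nu> a (B n)) \<le> C * (sup_norm a * measure M (B n))) sequentially"
        by simp
    qed
  qed
  have rad_set: "?\<nu> n (H.rad_set n) = ?r" for n by (simp only: H.rad_rad_set)
  show ?thesis
    using fun_subspace_ca ca_subset_ba c0 b H.rad_set_sets rad_set r diag
    by (intro quotient_operator_l2[where \<nu> = ?\<nu> and A = H.rad_set and r = ?r and b = "measure M (space M)"])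
      (simp_all only: sp not_False_eq_True)
qed

end


section \<open>Bochner integrals with values in a non-separable space\<close>

text \<open>
  On each of the finitely many sets where \<open>s\<close> is constant, this is a continuous function of \<open>f\<close>; the
  difference of two general Borel functions need not be measurable in a non-separable space.
\<close>

lemma borel_measurable_diff_simple:
  fixes f :: "'a \<Rightarrow> 'x::real_normed_vector"
  assumes f: "f \<in> borel_measurable M" and s: "simple_function M s"
  shows "(\<lambda>\<omega>. norm (f \<omega> - s \<omega>)) \<in> borel_measurable M"
proof (rule measurable_compose_countable'[where f = "\<lambda>y \<omega>. norm (f \<omega> - y)" and g = s and I = "s ` space M"])
  fix y
  have "continuous_on UNIV (\<lambda>x::'x. norm (x - y))" by (intro continuous_intros)
  then show "(\<lambda>\<omega>. norm (f \<omega> - y)) \<in> borel_measurable M"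
    using measurable_compose[OF f borel_measurable_continuous_onI] by auto
next
  show "s \<in> measurable M (count_space (s ` space M))"
    using s by (subst measurable_count_space_eq2) (auto simp: simple_function_def)
  show "countable (s ` space M)" using s by (simp add: simple_function_def countable_finite)
qed

lemma has_gen_bochner_integralI:
  assumes "f \<in> borel_measurable M" "\<And>i. Bochner_Integration.simple_bochner_integrable M (s i)"
    "(\<lambda>i. \<integral>\<^sup>+\<omega>. ennreal (norm (f \<omega> - s i \<omega>)) \<partial>M) \<longlonglongrightarrow> 0"
    "(\<lambda>i. Bochner_Integration.simple_bochner_integral M (s i)) \<longlonglongrightarrow> x"
  shows "has_gen_bochner_integral M f x"
  unfolding has_gen_bochner_integral_def using assms by (intro conjI exI[of _ s] allI)

lemma simple_bochner_integrable_simple: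
  "Bochner_Integration.simple_bochner_integrable M s \<Longrightarrow> simple_function M s"
  by (rule simple_bochner_integrable.cases)

text \<open>
  Approximation in mean by simple functions, made fast enough, is approximation almost everywhere.
\<close>

lemma gen_bochner_AE_simple_limit:
  fixes f :: "'a \<Rightarrow> 'x::real_normed_vector"
  assumes "has_gen_bochner_integral M f x"
  shows "\<exists>s. (\<forall>i. simple_function M (s i)) \<and> (AE \<omega> in M. (\<lambda>i. s i \<omega>) \<longlonglongrightarrow> f \<omega>)"
proof -
  obtain s where f: "f \<in> borel_measurable M" and s: "\<And>i. Bochner_Integration.simple_bochner_integrable M (s i)"
      and lim: "(\<lambda>i. \<integral>\<^sup>+\<omega>. ennreal (norm (f \<omega> - s i \<omega>)) \<partial>M) \<longlonglongrightarrow> 0"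
    using assms unfolding has_gen_bochner_integral_def by blast
  have sf: "simple_function M (s i)" for i using s by (rule simple_bochner_integrable_simple)
  have "\<exists>i. (\<integral>\<^sup>+\<omega>. ennreal (norm (f \<omega> - s i \<omega>)) \<partial>M) < ennreal ((1 / 2) ^ n)" for n :: nat
    using order_tendstoD(2)[OF lim, of "ennreal ((1 / 2) ^ n)"] by (auto simp: eventually_sequentially ennreal_zero_less_divide)
  then obtain r where r: "\<And>n::nat. (\<integral>\<^sup>+\<omega>. ennreal (norm (f \<omega> - s (r n) \<omega>)) \<partial>M) < ennreal ((1 / 2) ^ n)"
    by metis
  have meas: "(\<lambda>\<omega>. ennreal (norm (f \<omega> - s i \<omega>))) \<in> borel_measurable M" for i
    using borel_measurable_diff_simple[OF f sf] by simp
  have "(\<integral>\<^sup>+\<omega>. (\<Sum>n. ennreal (norm (f \<omega> - s (r n) \<omega>))) \<partial>M) = (\<Sum>n. \<integral>\<^sup>+\<omega>. ennreal (norm (f \<omega> - s (r n) \<omega>)) \<partial>M)"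
    using meas by (rule nn_integral_suminf)
  also have "\<dots> \<le> (\<Sum>n. ennreal ((1 / 2) ^ n))"
    using r by (intro suminf_le) (auto intro: less_imp_le)
  also have "\<dots> = ennreal (\<Sum>n. (1 / 2) ^ n)"
    by (rule suminf_ennreal2) (auto intro: summable_geometric)
  finally have "(\<integral>\<^sup>+\<omega>. (\<Sum>n. ennreal (norm (f \<omega> - s (r n) \<omega>))) \<partial>M) \<noteq> \<infinity>"
    using top.not_eq_extremum by (metis ennreal_less_top infinity_ennreal_def le_less_trans less_irrefl)
  then have "AE \<omega> in M. (\<Sum>n. ennreal (norm (f \<omega> - s (r n) \<omega>))) \<noteq> \<infinity>"
    using meas by (intro nn_integral_PInf_AE borel_measurable_suminf_order) auto
  then have "AE \<omega> in M. (\<lambda>n. s (r n) \<omega>) \<longlonglongrightarrow> f \<omega>"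
  proof eventually_elim
    case (elim \<omega>)
    then have "(\<Sum>n. ennreal (norm (f \<omega> - s (r n) \<omega>))) \<noteq> top" by simp
    then have "summable (\<lambda>n. norm (f \<omega> - s (r n) \<omega>))"
      by (rule summable_suminf_not_top[rotated]) simp
    then have "(\<lambda>n. norm (f \<omega> - s (r n) \<omega>)) \<longlonglongrightarrow> 0" by (rule summable_LIMSEQ_zero)
    then have "(\<lambda>n. f \<omega> - s (r n) \<omega>) \<longlonglongrightarrow> 0" by (rule tendsto_norm_zero_cancel)
    from tendsto_diff[OF tendsto_const[of "f \<omega>"] this] show ?case by simp
  qed
  then show ?thesis using sf by (intro exI[of _ "\<lambda>n. s (r n)"] conjI allI)
qed

text \<open>
  The sum itself need not be Borel in a non-separable space. It is modified on a null set, off which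
  it is a pointwise limit of simple functions.
\<close>

lemma gen_bochner_AE_sum:
  fixes f g :: "'a \<Rightarrow> 'x::real_normed_vector"
  assumes "has_gen_bochner_integral M f x" "has_gen_bochner_integral M g y"
  shows "\<exists>h\<in>borel_measurable M. AE \<omega> in M. h \<omega> = f \<omega> + g \<omega>"
proof -
  obtain s where s: "\<And>i. simple_function M (s i)" "AE \<omega> in M. (\<lambda>i. s i \<omega>) \<longlonglongrightarrow> f \<omega>"
    using gen_bochner_AE_simple_limit[OF assms(1)] by blast
  obtain t where t: "\<And>i. simple_function M (t i)" "AE \<omega> in M. (\<lambda>i. t i \<omega>) \<longlonglongrightarrow> g \<omega>"
    using gen_bochner_AE_simple_limit[OF assms(2)] by blast
  have "AE \<omega> in M. (\<lambda>i. s i \<omega> + t i \<omega>) \<longlonglongrightarrow> f \<omega> + g \<omega>"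
    using s(2) t(2) by eventually_elim (rule tendsto_add)
  then obtain N where N: "{\<omega>\<in>space M. \<not> (\<lambda>i. s i \<omega> + t i \<omega>) \<longlonglongrightarrow> f \<omega> + g \<omega>} \<subseteq> N"
      "emeasure M N = 0" "N \<in> sets M"
    by (rule AE_E)
  let ?h = "\<lambda>\<omega>. if \<omega> \<in> N then 0 else f \<omega> + g \<omega>"
  have "?h \<in> borel_measurable M"
  proof (rule borel_measurable_LIMSEQ_metric[where f = "\<lambda>i \<omega>. if \<omega> \<in> N then 0 else s i \<omega> + t i \<omega>"])
    fix i
    have "simple_function M (\<lambda>\<omega>. s i \<omega> + t i \<omega>)" using s(1) t(1) by (rule simple_function_compose2)
    then have "(\<lambda>\<omega>. s i \<omega> + t i \<omega>) \<in> borel_measurable M" by (rule borel_measurable_simple_function)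
    then show "(\<lambda>\<omega>. if \<omega> \<in> N then 0 else s i \<omega> + t i \<omega>) \<in> borel_measurable M"
      using N(3) by (intro measurable_If_set) (auto simp: sets.Int_space_eq2)
  next
    fix \<omega> assume "\<omega> \<in> space M"
    then show "(\<lambda>i. if \<omega> \<in> N then 0 else s i \<omega> + t i \<omega>) \<longlonglongrightarrow> ?h \<omega>" using N(1) by auto
  qed
  moreover have "N \<in> null_sets M" using N(2,3) by auto
  then have "AE \<omega> in M. ?h \<omega> = f \<omega> + g \<omega>" by (rule AE_I') auto
  ultimately show ?thesis by (intro bexI[of _ ?h])
qed

lemma has_gen_bochner_integral_add_AE:
  fixes f g :: "'a \<Rightarrow> 'x::real_normed_vector"
  assumes f: "has_gen_bochner_integral M f x" and g: "has_gen_bochner_integral M g y"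
    and h: "h \<in> borel_measurable M" "AE \<omega> in M. h \<omega> = f \<omega> + g \<omega>"
  shows "has_gen_bochner_integral M h (x + y)"
proof -
  obtain s where fm: "f \<in> borel_measurable M" and s: "\<And>i. Bochner_Integration.simple_bochner_integrable M (s i)"
      "(\<lambda>i. \<integral>\<^sup>+\<omega>. ennreal (norm (f \<omega> - s i \<omega>)) \<partial>M) \<longlonglongrightarrow> 0"
      "(\<lambda>i. Bochner_Integration.simple_bochner_integral M (s i)) \<longlonglongrightarrow> x"
    using f unfolding has_gen_bochner_integral_def by blast
  obtain t where gm: "g \<in> borel_measurable M" and t: "\<And>i. Bochner_Integration.simple_bochner_integrable M (t i)"
      "(\<lambda>i. \<integral>\<^sup>+\<omega>. ennreal (norm (g \<omega> - t i \<omega>)) \<partial>M) \<longlonglongrightarrow> 0"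
      "(\<lambda>i. Bochner_Integration.simple_bochner_integral M (t i)) \<longlonglongrightarrow> y"
    using g unfolding has_gen_bochner_integral_def by blast
  have le: "(\<integral>\<^sup>+\<omega>. ennreal (norm (h \<omega> - (s i \<omega> + t i \<omega>))) \<partial>M) \<le>
      (\<integral>\<^sup>+\<omega>. ennreal (norm (f \<omega> - s i \<omega>)) \<partial>M) + (\<integral>\<^sup>+\<omega>. ennreal (norm (g \<omega> - t i \<omega>)) \<partial>M)" for i
  proof -
    have "(\<integral>\<^sup>+\<omega>. ennreal (norm (h \<omega> - (s i \<omega> + t i \<omega>))) \<partial>M) \<le>
        (\<integral>\<^sup>+\<omega>. ennreal (norm (f \<omega> - s i \<omega>)) + ennreal (norm (g \<omega> - t i \<omega>)) \<partial>M)"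
    proof (rule nn_integral_mono_AE)
      show "AE \<omega> in M. ennreal (norm (h \<omega> - (s i \<omega> + t i \<omega>))) \<le>
          ennreal (norm (f \<omega> - s i \<omega>)) + ennreal (norm (g \<omega> - t i \<omega>))"
        using h(2)
      proof eventually_elim
        case (elim \<omega>)
        have "norm (h \<omega> - (s i \<omega> + t i \<omega>)) \<le> norm (f \<omega> - s i \<omega>) + norm (g \<omega> - t i \<omega>)"
          unfolding elim using norm_triangle_ineq[of "f \<omega> - s i \<omega>" "g \<omega> - t i \<omega>"] by (simp add: algebra_simps)
        then show ?case by (simp add: ennreal_plus[symmetric] ennreal_leI del: ennreal_plus)
      qed
    qed
    also have "\<dots> = (\<integral>\<^sup>+\<omega>. ennreal (norm (f \<omega> - s i \<omega>)) \<partial>M) + (\<integral>\<^sup>+\<omega>. ennreal (norm (g \<omega> - t i \<omega>)) \<partial>M)"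
      using borel_measurable_diff_simple[OF fm simple_bochner_integrable_simple[OF s(1)]]
        borel_measurable_diff_simple[OF gm simple_bochner_integrable_simple[OF t(1)]]
      by (intro nn_integral_add) auto
    finally show ?thesis .
  qed
  have "(\<lambda>i. (\<integral>\<^sup>+\<omega>. ennreal (norm (f \<omega> - s i \<omega>)) \<partial>M) + (\<integral>\<^sup>+\<omega>. ennreal (norm (g \<omega> - t i \<omega>)) \<partial>M)) \<longlonglongrightarrow> 0"
    using tendsto_add[OF s(2) t(2)] by simp
  then have lim1: "(\<lambda>i. \<integral>\<^sup>+\<omega>. ennreal (norm (h \<omega> - (s i \<omega> + t i \<omega>))) \<partial>M) \<longlonglongrightarrow> 0"
    by (rule tendsto_sandwich[OF always_eventually always_eventually tendsto_const, rotated 2])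
      (use le in auto)
  have lim2: "(\<lambda>i. Bochner_Integration.simple_bochner_integral M (\<lambda>\<omega>. s i \<omega> + t i \<omega>)) \<longlonglongrightarrow> x + y"
    using tendsto_add[OF s(3) t(3)] by (simp add: simple_bochner_integral_add[OF s(1) t(1)])
  have simple: "Bochner_Integration.simple_bochner_integrable M (\<lambda>\<omega>. s i \<omega> + t i \<omega>)" for i
    by (rule simple_bochner_integrable_compose2[of "(+)", OF _ s(1) t(1)]) simp
  show ?thesis using h(1) simple lim1 lim2 by (rule has_gen_bochner_integralI)
qed

lemma has_gen_bochner_integral_bounded_linear:
  fixes f :: "'a \<Rightarrow> 'y::real_normed_vector" and L :: "'y \<Rightarrow> 'x::real_normed_vector"
  assumes L: "bounded_linear L" and f: "has_gen_bochner_integral M f x"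
  shows "has_gen_bochner_integral M (\<lambda>\<omega>. L (f \<omega>)) (L x)"
proof -
  interpret L: bounded_linear L by (rule L)
  obtain s where fm: "f \<in> borel_measurable M" and s: "\<And>i. Bochner_Integration.simple_bochner_integrable M (s i)"
      "(\<lambda>i. \<integral>\<^sup>+\<omega>. ennreal (norm (f \<omega> - s i \<omega>)) \<partial>M) \<longlonglongrightarrow> 0"
      "(\<lambda>i. Bochner_Integration.simple_bochner_integral M (s i)) \<longlonglongrightarrow> x"
    using f unfolding has_gen_bochner_integral_def by blast
  obtain K where K: "K > 0" "\<And>y. norm (L y) \<le> norm y * K" using L.pos_bounded by blast
  have meas: "(\<lambda>\<omega>. L (f \<omega>)) \<in> borel_measurable M"
    using measurable_compose[OF fm borel_measurable_continuous_onI[OF linear_continuous_on[OF L]]] .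
  have le: "(\<integral>\<^sup>+\<omega>. ennreal (norm (L (f \<omega>) - L (s i \<omega>))) \<partial>M) \<le>
      ennreal K * (\<integral>\<^sup>+\<omega>. ennreal (norm (f \<omega> - s i \<omega>)) \<partial>M)" for i
  proof -
    have "(\<integral>\<^sup>+\<omega>. ennreal (norm (L (f \<omega>) - L (s i \<omega>))) \<partial>M) \<le>
        (\<integral>\<^sup>+\<omega>. ennreal K * ennreal (norm (f \<omega> - s i \<omega>)) \<partial>M)"
    proof (rule nn_integral_mono)
      fix \<omega>
      have "norm (L (f \<omega>) - L (s i \<omega>)) \<le> K * norm (f \<omega> - s i \<omega>)"
        using K(2)[of "f \<omega> - s i \<omega>"] by (simp add: L.diff mult.commute)
      then show "ennreal (norm (L (f \<omega>) - L (s i \<omega>))) \<le> ennreal K * ennreal (norm (f \<omega> - s i \<omega>))"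
        using K(1) by (simp add: ennreal_mult[symmetric] ennreal_leI)
    qed
    also have "\<dots> = ennreal K * (\<integral>\<^sup>+\<omega>. ennreal (norm (f \<omega> - s i \<omega>)) \<partial>M)"
      using borel_measurable_diff_simple[OF fm simple_bochner_integrable_simple[OF s(1)]]
      by (intro nn_integral_cmult) auto
    finally show ?thesis .
  qed
  have "(\<lambda>i. ennreal K * (\<integral>\<^sup>+\<omega>. ennreal (norm (f \<omega> - s i \<omega>)) \<partial>M)) \<longlonglongrightarrow> ennreal K * 0"
    by (rule ennreal_tendsto_cmult[OF _ s(2)]) simp
  then have "(\<lambda>i. ennreal K * (\<integral>\<^sup>+\<omega>. ennreal (norm (f \<omega> - s i \<omega>)) \<partial>M)) \<longlonglongrightarrow> 0" by simp
  then have lim1: "(\<lambda>i. \<integral>\<^sup>+\<omega>. ennreal (norm (L (f \<omega>) - L (s i \<omega>))) \<partial>M) \<longlonglongrightarrow> 0"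
    by (rule tendsto_sandwich[OF always_eventually always_eventually tendsto_const, rotated 2])
      (use le in auto)
  have lim2: "(\<lambda>i. Bochner_Integration.simple_bochner_integral M (\<lambda>\<omega>. L (s i \<omega>))) \<longlonglongrightarrow> L x"
    using L.tendsto[OF s(3)] by (simp add: simple_bochner_integral_linear[OF L.linear_axioms s(1)])
  have simple: "Bochner_Integration.simple_bochner_integrable M (\<lambda>\<omega>. L (s i \<omega>))" for i
    using simple_bochner_integrable_compose2[of "\<lambda>a b. L a" M "s i" "s i"] s(1) by (simp add: L.zero)
  show ?thesis using meas simple lim1 lim2 by (rule has_gen_bochner_integralI)
qed

lemma borel_measurable_indicator_scaleR:
  fixes h :: "'a \<Rightarrow> 'x::real_normed_vector"
  assumes "h \<in> borel_measurable M" "E \<in> sets M"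
  shows "(\<lambda>\<omega>. indicator E \<omega> *\<^sub>R h \<omega>) \<in> borel_measurable M"
proof -
  have "(\<lambda>\<omega>. if \<omega> \<in> E then h \<omega> else 0) \<in> borel_measurable M"
    using assms by (intro measurable_If_set) (auto simp: sets.Int_space_eq2)
  moreover have "(\<lambda>\<omega>. indicator E \<omega> *\<^sub>R h \<omega>) = (\<lambda>\<omega>. if \<omega> \<in> E then h \<omega> else 0)"
    by (auto simp: indicator_def)
  ultimately show ?thesis by simp
qed

text \<open>
  Cutting the approximating simple functions off \<open>N\<close> changes them by at most the error of the
  approximation, and \<open>M\<close> and \<open>M'\<close> agree off \<open>N\<close>.
\<close>

lemma has_gen_bochner_integral_change_measure:
  fixes u :: "'a \<Rightarrow> 'x::real_normed_vector"
  assumes sets: "sets M = sets M'" and N: "N \<in> sets M'"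
    and agree: "\<And>E. E \<in> sets M' \<Longrightarrow> emeasure M E = emeasure M' (E - N)"
    and fin: "finite_measure M'"
    and u: "has_gen_bochner_integral M' u x" "\<And>\<omega>. \<omega> \<in> N \<Longrightarrow> u \<omega> = 0"
  shows "has_gen_bochner_integral M u x"
proof -
  interpret M': finite_measure M' by (rule fin)
  have sp: "space M = space M'" using sets by (rule sets_eq_imp_space_eq)
  have um: "u \<in> borel_measurable M'" using u(1) by (simp add: has_gen_bochner_integral_def)
  obtain s where s: "\<And>i. Bochner_Integration.simple_bochner_integrable M' (s i)"
      "(\<lambda>i. \<integral>\<^sup>+\<omega>. ennreal (norm (u \<omega> - s i \<omega>)) \<partial>M') \<longlonglongrightarrow> 0"
      "(\<lambda>i. Bochner_Integration.simple_bochner_integral M' (s i)) \<longlonglongrightarrow> x"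
    using u(1) unfolding has_gen_bochner_integral_def by blast
  let ?t = "\<lambda>i \<omega>. if \<omega> \<in> N then 0 else s i \<omega>"
  have simple_t: "simple_function M' (?t i)" for i
    using simple_bochner_integrable_simple[OF s(1)] N
    by (intro simple_function_If_set) (auto simp: sets.Int_space_eq2)
  have t': "Bochner_Integration.simple_bochner_integrable M' (?t i)" for i
    using simple_t by (intro simple_bochner_integrable.intros) (auto simp: M'.emeasure_finite)
  have dens: "M = density M' (indicator (space M' - N))"
  proof (rule measure_eqI)
    fix E assume "E \<in> sets M"
    then have E: "E \<in> sets M'" using sets by simp
    have "emeasure (density M' (indicator (space M' - N))) E =
        (\<integral>\<^sup>+\<omega>. indicator (space M' - N) \<omega> * indicator E \<omega> \<partial>M')"
      using E N by (intro emeasure_density) auto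
    also have "\<dots> = (\<integral>\<^sup>+\<omega>. indicator (E - N) \<omega> \<partial>M')"
      by (intro nn_integral_cong) (auto simp: indicator_def)
    also have "\<dots> = emeasure M' (E - N)" using E N by simp
    finally show "emeasure M E = emeasure (density M' (indicator (space M' - N))) E"
      using agree[OF E] by simp
  qed (simp add: sets)
  have fin_M: "emeasure M E \<noteq> \<infinity>" for E
    by (cases "E \<in> sets M'") (auto simp: agree sets emeasure_notin_sets)
  have t: "Bochner_Integration.simple_bochner_integrable M (?t i)" for i
  proof (intro simple_bochner_integrable.intros fin_M)
    show "simple_function M (?t i)" using simple_t[of i] by (simp add: simple_function_def sp sets)
  qed
  have meas_diff: "(\<lambda>\<omega>. ennreal (norm (u \<omega> - ?t i \<omega>))) \<in> borel_measurable M'" for i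
    using borel_measurable_diff_simple[OF um simple_t] by simp
  have le: "(\<integral>\<^sup>+\<omega>. ennreal (norm (u \<omega> - ?t i \<omega>)) \<partial>M) \<le> (\<integral>\<^sup>+\<omega>. ennreal (norm (u \<omega> - s i \<omega>)) \<partial>M')" for i
  proof -
    have "(\<integral>\<^sup>+\<omega>. ennreal (norm (u \<omega> - ?t i \<omega>)) \<partial>M) =
        (\<integral>\<^sup>+\<omega>. indicator (space M' - N) \<omega> * ennreal (norm (u \<omega> - ?t i \<omega>)) \<partial>M')"
      unfolding dens using N meas_diff by (intro nn_integral_density) auto
    also have "\<dots> \<le> (\<integral>\<^sup>+\<omega>. ennreal (norm (u \<omega> - s i \<omega>)) \<partial>M')"
      by (intro nn_integral_mono) (auto simp: indicator_def)
    finally show ?thesis .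
  qed
  have lim1: "(\<lambda>i. \<integral>\<^sup>+\<omega>. ennreal (norm (u \<omega> - ?t i \<omega>)) \<partial>M) \<longlonglongrightarrow> 0"
    by (rule tendsto_sandwich[OF always_eventually always_eventually tendsto_const s(2)])
      (use le in auto)
  have eq: "Bochner_Integration.simple_bochner_integral M (?t i) = Bochner_Integration.simple_bochner_integral M' (?t i)" for i
    unfolding simple_bochner_integral_def sp
  proof (intro sum.cong refl)
    fix y
    show "measure M {\<omega> \<in> space M'. ?t i \<omega> = y} *\<^sub>R y = measure M' {\<omega> \<in> space M'. ?t i \<omega> = y} *\<^sub>R y"
    proof (cases "y = 0")
      case False
      let ?E = "{\<omega> \<in> space M'. ?t i \<omega> = y}"
      have "?E = ?t i -` {y} \<inter> space M'" by blast
      then have "?E \<in> sets M'" using simple_functionD(2)[OF simple_t] by metis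
      moreover have "?E - N = ?E" using False by auto
      ultimately have "emeasure M ?E = emeasure M' ?E" using agree[of ?E] by simp
      then show ?thesis by (simp add: measure_def)
    qed simp
  qed
  have lim2: "(\<lambda>i. Bochner_Integration.simple_bochner_integral M' (?t i)) \<longlonglongrightarrow> x"
  proof -
    have diff: "Bochner_Integration.simple_bochner_integrable M' (\<lambda>\<omega>. ?t i \<omega> - s i \<omega>)" for i
      by (rule simple_bochner_integrable_compose2[of "(-)", OF _ t' s(1)]) simp
    have norm_diff: "Bochner_Integration.simple_bochner_integrable M' (\<lambda>\<omega>. norm (?t i \<omega> - s i \<omega>))" for i
      by (rule simple_bochner_integrable_compose2[of "\<lambda>x y. norm (x - y)", OF _ t' s(1)]) simp
    have "ennreal (norm (Bochner_Integration.simple_bochner_integral M' (?t i) - Bochner_Integration.simple_bochner_integral M' (s i))) \<le>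
        (\<integral>\<^sup>+\<omega>. ennreal (norm (u \<omega> - s i \<omega>)) \<partial>M')" for i
    proof -
      have "norm (Bochner_Integration.simple_bochner_integral M' (?t i) - Bochner_Integration.simple_bochner_integral M' (s i)) \<le>
          Bochner_Integration.simple_bochner_integral M' (\<lambda>\<omega>. norm (?t i \<omega> - s i \<omega>))"
        unfolding simple_bochner_integral_diff[OF t' s(1), symmetric]
        by (rule simple_bochner_integral_norm_bound[OF diff])
      then have "ennreal (norm (Bochner_Integration.simple_bochner_integral M' (?t i) - Bochner_Integration.simple_bochner_integral M' (s i))) \<le>
          ennreal (Bochner_Integration.simple_bochner_integral M' (\<lambda>\<omega>. norm (?t i \<omega> - s i \<omega>)))"
        by (rule ennreal_leI)
      also have "\<dots> = (\<integral>\<^sup>+\<omega>. ennreal (norm (?t i \<omega> - s i \<omega>)) \<partial>M')"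
        using norm_diff by (intro simple_bochner_integral_eq_nn_integral) auto
      also have "\<dots> \<le> (\<integral>\<^sup>+\<omega>. ennreal (norm (u \<omega> - s i \<omega>)) \<partial>M')"
        using u(2) by (intro nn_integral_mono) auto
      finally show ?thesis .
    qed
    then have "(\<lambda>i. ennreal (norm (Bochner_Integration.simple_bochner_integral M' (?t i) - Bochner_Integration.simple_bochner_integral M' (s i)))) \<longlonglongrightarrow> 0"
      by (intro tendsto_sandwich[OF always_eventually always_eventually tendsto_const s(2)]) auto
    then have "(\<lambda>i. norm (Bochner_Integration.simple_bochner_integral M' (?t i) - Bochner_Integration.simple_bochner_integral M' (s i))) \<longlonglongrightarrow> 0"
      by (simp add: ennreal_0[symmetric] del: ennreal_0)
    then have "(\<lambda>i. Bochner_Integration.simple_bochner_integral M' (?t i) - Bochner_Integration.simple_bochner_integral M' (s i)) \<longlonglongrightarrow> 0"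
      by (rule tendsto_norm_zero_cancel)
    from tendsto_add[OF this s(3)] show ?thesis by simp
  qed
  have "u \<in> borel_measurable M" using um measurable_cong_sets[OF sets refl, of "borel :: 'x measure"] by simp
  then show ?thesis using t lim1 lim2[folded eq] by (rule has_gen_bochner_integralI)
qed


section \<open>Measures with the Radon-Nikodym property\<close>

context vector_measures
begin

lemma sum_norm_le_variation:
  fixes F :: "'a set \<Rightarrow> 'x"
  assumes F: "F \<in> ba_measures S" and P: "finite P" "P \<subseteq> S" "disjoint P" and A: "A \<in> S"
  shows "(\<Sum>B\<in>P. ennreal (norm (F (B \<inter> A)))) \<le> variation S F A"
proof -
  let ?g = "\<lambda>C. norm (F C)"
  have "(\<Sum>B\<in>P. ?g (B \<inter> A)) = (\<Sum>C\<in>(\<lambda>B. B \<inter> A) ` P. ?g C)"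
  proof (rule sum.reindex_nontrivial[symmetric, unfolded comp_def])
    fix B C assume "B \<in> P" "C \<in> P" "B \<noteq> C" "B \<inter> A = C \<inter> A"
    then have "B \<inter> A = {}" using disjointD[OF P(3), of B C] by blast
    then show "?g (B \<inter> A) = 0" using ba_measuresD(4)[OF F] by simp
  qed (rule P(1))
  moreover have "ennreal (\<Sum>C\<in>(\<lambda>B. B \<inter> A) ` P. ?g C) \<le> variation S F A"
  proof (rule sum_le_variation)
    show "disjoint ((\<lambda>B. B \<inter> A) ` P)"
    proof (rule disjointI)
      fix C D assume "C \<in> (\<lambda>B. B \<inter> A) ` P" "D \<in> (\<lambda>B. B \<inter> A) ` P" "C \<noteq> D"
      then obtain C' D' where "C' \<in> P" "D' \<in> P" "C' \<noteq> D'" "C = C' \<inter> A" "D = D' \<inter> A" by blast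
      then show "C \<inter> D = {}" using disjointD[OF P(3), of C' D'] by blast
    qed
  qed (use P A ba_measuresD(4)[OF F] in auto)
  ultimately show ?thesis by simp
qed

lemma variation_empty: "variation S F {} = 0"
proof -
  have "P = {}" if "partition_on {} P" for P :: "'a set set"
    using that by (auto simp: partition_on_def)
  then have "(\<Sum>A\<in>P. ennreal (norm (F A))) \<le> 0" if "partition_on {} P" for P :: "'a set set"
    using that by fastforce
  then show ?thesis unfolding variation_def by (intro antisym SUP_least) auto
qed

lemma variation_super:
  assumes "A \<in> S" "B \<in> S" "A \<inter> B = {}"
  shows "variation S F A + variation S F B \<le> variation S F (A \<union> B)"
proof -
  let ?p = "\<lambda>E. {P. finite P \<and> P \<subseteq> S \<and> partition_on E P}"
  let ?s = "\<lambda>P. \<Sum>A\<in>P. ennreal (norm (F A))"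
  have ne: "?p E \<noteq> {}" if "E \<in> S" for E
  proof (cases "E = {}")
    case True
    then have "{} \<in> ?p E" by (simp add: partition_on_empty)
    then show ?thesis by blast
  next
    case False
    then have "{E} \<in> ?p E" using that by (simp add: partition_on_def)
    then show ?thesis by blast
  qed
  have sum: "?s P + ?s Q \<le> variation S F (A \<union> B)" if P: "P \<in> ?p A" and Q: "Q \<in> ?p B" for P Q
  proof -
    have "P \<inter> Q = {}" using P Q assms(3) by (auto simp: partition_on_def) (metis Int_iff UnionI all_not_in_conv)
    then have "?s P + ?s Q = ?s (P \<union> Q)" using P Q by (intro sum.union_disjoint[symmetric]) auto
    also have "\<dots> \<le> variation S F (A \<union> B)"
      unfolding variation_def
    proof (rule SUP_upper)
      have "disjoint (P \<union> Q)"
        using P Q assms(3) by (intro disjoint_union) (auto simp: partition_on_def)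
      then have "partition_on (A \<union> B) (P \<union> Q)" using P Q by (auto simp: partition_on_def)
      then show "P \<union> Q \<in> ?p (A \<union> B)" using P Q by auto
    qed
    finally show ?thesis .
  qed
  have "variation S F A + ?s Q \<le> variation S F (A \<union> B)" if "Q \<in> ?p B" for Q
    unfolding variation_def[of S F A]
    by (subst ennreal_SUP_add_left[symmetric, OF ne[OF assms(1)]]) (use that sum in \<open>auto intro!: SUP_least\<close>)
  then have "(SUP Q\<in>?p B. variation S F A + ?s Q) \<le> variation S F (A \<union> B)" by (rule SUP_least)
  moreover have "(SUP Q\<in>?p B. variation S F A + ?s Q) = variation S F A + variation S F B"
    unfolding variation_def[of S F B] by (simp only: ennreal_SUP_add_right[OF ne[OF assms(2)]])
  ultimately show ?thesis by simp
qed

lemma variation_mono: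
  assumes "A \<in> S" "B \<in> S" "A \<subseteq> B"
  shows "variation S F A \<le> variation S F B"
proof -
  have "A \<union> (B - A) = B" using assms(3) by blast
  then have "variation S F A + variation S F (B - A) \<le> variation S F B"
    using variation_super[of A "B - A" F] assms by auto
  then show ?thesis by (rule order_trans[rotated]) simp
qed

lemma norm_le_variation:
  fixes F :: "'a set \<Rightarrow> 'x"
  assumes "F \<in> ba_measures S" "E \<in> S"
  shows "ennreal (norm (F E)) \<le> variation S F E"
  using sum_norm_le_variation[OF assms(1), of "{E}" E] assms(2) by simp

text \<open>
  Finite superadditivity gives one inequality. For the other, cut each set of a partition along the
  \<open>A i\<close> and use that \<open>F\<close> itself is countably additive on the pieces.
\<close>

lemma countably_additive_variation:
  fixes F :: "'a set \<Rightarrow> 'x"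
  assumes F: "F \<in> ca_measures S"
  shows "countably_additive S (variation S F)"
proof (rule countably_additiveI)
  have ba: "F \<in> ba_measures S" using F ca_subset_ba by blast
  fix A :: "nat \<Rightarrow> 'a set" assume A: "range A \<subseteq> S" "disjoint_family A" "(\<Union>i. A i) \<in> S"
  show "(\<Sum>i. variation S F (A i)) = variation S F (\<Union>i. A i)"
  proof (rule antisym)
    have "(\<Sum>i<n. variation S F (A i)) \<le> variation S F (\<Union>i<n. A i)" for n
    proof (induction n)
      case (Suc n)
      have "A i \<inter> A n = {}" if "i < n" for i using A(2) that by (auto simp: disjoint_family_on_def)
      then have "(\<Union>i<n. A i) \<inter> A n = {}" by blast
      then have "variation S F (\<Union>i<n. A i) + variation S F (A n) \<le> variation S F ((\<Union>i<n. A i) \<union> A n)"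
        using A(1) by (intro variation_super A.finite_UN) auto
      moreover have "(\<Union>i<n. A i) \<union> A n = (\<Union>i<Suc n. A i)" by (auto simp: lessThan_Suc)
      ultimately have "variation S F (\<Union>i<n. A i) + variation S F (A n) \<le> variation S F (\<Union>i<Suc n. A i)"
        by simp
      then show ?case
        using order_trans[OF add_right_mono[OF Suc.IH, of "variation S F (A n)"]] by simp
    qed (simp add: variation_empty)
    moreover have "variation S F (\<Union>i<n. A i) \<le> variation S F (\<Union>i. A i)" for n
      using A(1,3) by (intro variation_mono) auto
    ultimately have "(\<Sum>i<n. variation S F (A i)) \<le> variation S F (\<Union>i. A i)" for n
      using order_trans by blast
    then show "(\<Sum>i. variation S F (A i)) \<le> variation S F (\<Union>i. A i)"
      by (simp add: suminf_eq_SUP SUP_least)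
    show "variation S F (\<Union>i. A i) \<le> (\<Sum>i. variation S F (A i))"
      unfolding variation_def[of S F "\<Union>i. A i"]
    proof (rule SUP_least)
      fix P assume "P \<in> {P. finite P \<and> P \<subseteq> S \<and> partition_on (\<Union>i. A i) P}"
      then have P: "finite P" "P \<subseteq> S" "disjoint P" "\<Union>P = (\<Union>i. A i)" by (auto simp: partition_on_def)
      have le: "ennreal (norm (F B)) \<le> (\<Sum>i. ennreal (norm (F (B \<inter> A i))))" if "B \<in> P" for B
      proof -
        have "range (\<lambda>i. B \<inter> A i) \<subseteq> S" using that P(2) A(1) by auto
        moreover have "disjoint_family (\<lambda>i. B \<inter> A i)"
          using A(2) unfolding disjoint_family_on_def by blast
        ultimately have "(\<lambda>i. F (B \<inter> A i)) sums F (\<Union>i. B \<inter> A i)"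
          using F unfolding ca_measures_def by blast
        moreover have "(\<Union>i. B \<inter> A i) = B" using that P(4) by blast
        ultimately have "(\<lambda>n. \<Sum>i<n. F (B \<inter> A i)) \<longlonglongrightarrow> F B" by (simp add: sums_def)
        then have lim: "(\<lambda>n. ennreal (norm (\<Sum>i<n. F (B \<inter> A i)))) \<longlonglongrightarrow> ennreal (norm (F B))"
          by (intro tendsto_ennrealI tendsto_norm)
        have "ennreal (norm (\<Sum>i<n. F (B \<inter> A i))) \<le> (\<Sum>i. ennreal (norm (F (B \<inter> A i))))" for n
        proof -
          have "ennreal (norm (\<Sum>i<n. F (B \<inter> A i))) \<le> ennreal (\<Sum>i<n. norm (F (B \<inter> A i)))"
            by (intro ennreal_leI norm_sum)
          also have "\<dots> = (\<Sum>i<n. ennreal (norm (F (B \<inter> A i))))" by simp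
          also have "\<dots> \<le> (\<Sum>i. ennreal (norm (F (B \<inter> A i))))"
            by (intro sum_le_suminf) auto
          finally show ?thesis .
        qed
        then show ?thesis by (intro LIMSEQ_le_const2[OF lim] exI[of _ 0] allI impI)
      qed
      have "(\<Sum>B\<in>P. ennreal (norm (F B))) \<le> (\<Sum>B\<in>P. \<Sum>i. ennreal (norm (F (B \<inter> A i))))"
        using le by (rule sum_mono)
      also have "\<dots> = (\<Sum>i. \<Sum>B\<in>P. ennreal (norm (F (B \<inter> A i))))"
        by (rule suminf_sum[symmetric]) simp
      also have "\<dots> \<le> (\<Sum>i. variation S F (A i))"
        using A(1) by (intro suminf_le sum_norm_le_variation[OF ba P(1-3)]) auto
      finally show "(\<Sum>B\<in>P. ennreal (norm (F B))) \<le> (\<Sum>i. variation S F (A i))" .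
    qed
  qed
qed

lemma ex_finite_measure:
  assumes "countably_additive S m" "m {} = 0" "m \<Omega> < \<infinity>"
  shows "\<exists>M\<in>ca_pos \<Omega> S. \<forall>E\<in>S. emeasure M E = m E"
proof -
  let ?M = "measure_of \<Omega> S m"
  have em: "emeasure ?M E = m E" if "E \<in> S" for E
    using assms that by (intro emeasure_measure_of_sigma A.sigma_algebra_axioms) (auto simp: positive_def)
  have sp: "space ?M = \<Omega>" "sets ?M = S"
    using A.space_closed by (simp_all add: A.sets_measure_of_eq)
  have "finite_measure ?M" using assms(3) em[OF A.top] by (intro finite_measureI) (simp add: sp)
  then show ?thesis using em sp by (intro bexI[of _ ?M]) (auto simp: ca_pos_def)
qed

lemma ca_posD: "M \<in> ca_pos \<Omega> S \<Longrightarrow> space M = \<Omega>" "M \<in> ca_pos \<Omega> S \<Longrightarrow> sets M = S"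
  "M \<in> ca_pos \<Omega> S \<Longrightarrow> finite_measure M"
  by (auto simp: ca_pos_def)

lemma ex_variation_measure:
  fixes F :: "'a set \<Rightarrow> 'x"
  assumes F: "F \<in> bvca_measures \<Omega> S"
  shows "\<exists>M\<in>ca_pos \<Omega> S. \<forall>E\<in>S. ennreal (norm (F E)) \<le> emeasure M E"
proof -
  have ca: "F \<in> ca_measures S" and fin: "variation S F \<Omega> < \<infinity>"
    using F by (auto simp: bvca_measures_def)
  obtain M where M: "M \<in> ca_pos \<Omega> S" "\<And>E. E \<in> S \<Longrightarrow> emeasure M E = variation S F E"
    using ex_finite_measure[OF countably_additive_variation[OF ca] variation_empty fin] by blast
  moreover have "ennreal (norm (F E)) \<le> variation S F E" if "E \<in> S" for E
    using ca ca_subset_ba that by (intro norm_le_variation) auto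
  ultimately show ?thesis by (intro bexI[of _ M]) auto
qed

definition has_density :: "'a measure \<Rightarrow> ('a set \<Rightarrow> 'x) \<Rightarrow> bool" where
  "has_density M F \<longleftrightarrow> (\<exists>f. gen_bochner_integrable M f \<and>
     (\<forall>E\<in>S. has_gen_bochner_integral M (\<lambda>\<omega>. indicator E \<omega> *\<^sub>R f \<omega>) (F E)))"

lemma radon_nikodym_measures_iff:
  "F \<in> radon_nikodym_measures \<Omega> S \<longleftrightarrow> F \<in> bvca_measures \<Omega> S \<and>
     (\<forall>M\<in>ca_pos \<Omega> S. abs_cont F M \<longrightarrow> has_density M F)"
  by (simp add: radon_nikodym_measures_def has_density_def)

text \<open>
  Take the union \<open>N\<close> of null sets whose \<open>m\<close>-measures approach the supremum over all null sets. A null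
  set charged by \<open>m\<close> off \<open>N\<close> could be added to \<open>N\<close> to exceed the supremum.
\<close>

lemma ex_maximal_null_set:
  assumes M: "M \<in> ca_pos \<Omega> S" and m: "m \<in> ca_pos \<Omega> S"
  shows "\<exists>N\<in>null_sets M. \<forall>E\<in>null_sets M. emeasure m (E - N) = 0"
proof -
  interpret m: finite_measure m using m by (rule ca_posD)
  have sets: "sets M = S" "sets m = S" using M m by (auto simp: ca_posD)
  let ?s = "SUP E\<in>null_sets M. measure m E"
  have bdd: "bdd_above (measure m ` null_sets M)"
    by (intro bdd_aboveI2[of _ _ "measure m (space m)"]) (rule m.bounded_measure)
  have "\<exists>E\<in>null_sets M. ?s - 1 / real (Suc n) < measure m E" for n
  proof (rule ccontr)
    assume "\<not> ?thesis"
    then have le: "measure m E \<le> ?s - 1 / real (Suc n)" if "E \<in> null_sets M" for E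
      using that not_le by blast
    have "null_sets M \<noteq> {}" using null_sets.empty_sets by blast
    then have "?s \<le> ?s - 1 / real (Suc n)" using le by (rule cSUP_least)
    then show False by simp
  qed
  then obtain f where f: "\<And>n. f n \<in> null_sets M" "\<And>n. ?s - 1 / real (Suc n) < measure m (f n)"
    by metis
  let ?N = "\<Union>n. f n"
  have N: "?N \<in> null_sets M" using f(1) by (rule null_sets_UN)
  have in_m: "E \<in> sets m" if "E \<in> null_sets M" for E using that sets by auto
  have "?s - 1 / real (Suc n) \<le> measure m ?N" for n
    using f(2)[of n] m.finite_measure_mono[of "f n" ?N] in_m[OF N] by fastforce
  then have le: "?s \<le> measure m ?N"
  proof -
    have "(\<lambda>n. ?s - 1 / real (Suc n)) \<longlonglongrightarrow> ?s - 0"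
      by (intro tendsto_diff tendsto_const LIMSEQ_Suc[OF lim_1_over_n])
    then show ?thesis
      using \<open>\<And>n. ?s - 1 / real (Suc n) \<le> measure m ?N\<close> by (intro LIMSEQ_le_const2) auto
  qed
  have "emeasure m (E - ?N) = 0" if E: "E \<in> null_sets M" for E
  proof -
    have "measure m (?N \<union> (E - ?N)) = measure m ?N + measure m (E - ?N)"
      using in_m[OF N] in_m[OF E] by (intro m.finite_measure_Union) auto
    moreover have "?N \<union> (E - ?N) = ?N \<union> E" by blast
    then have "measure m (?N \<union> (E - ?N)) \<le> ?s"
      using N E bdd by (intro cSUP_upper) auto
    ultimately have "measure m (E - ?N) \<le> 0" using le by linarith
    then show ?thesis by (simp add: m.emeasure_eq_measure measure_le_0_iff)
  qed
  then show ?thesis using N by blast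
qed

text \<open>
  The summands of a measure absolutely continuous with respect to \<open>M\<close> need not be so themselves.
  Let \<open>N\<close> be an \<open>M\<close>-null set such that off \<open>N\<close> the variations of the summands are absolutely
  continuous, and let \<open>M'\<close> be \<open>M\<close> plus these variations on \<open>N\<close>. Both summands have densities with
  respect to \<open>M'\<close>, which is \<open>M\<close> off \<open>N\<close>, and the sum does not charge \<open>N\<close>.
\<close>

lemma radon_nikodym_add:
  assumes F: "F \<in> radon_nikodym_measures \<Omega> S" and G: "G \<in> radon_nikodym_measures \<Omega> S"
    and M: "M \<in> ca_pos \<Omega> S" and ac: "abs_cont (\<lambda>E. F E + G E) M"
  shows "has_density M (\<lambda>E. F E + G E :: 'x)"
proof -
  have ba: "F \<in> ba_measures S" "G \<in> ba_measures S"
    using F G ca_subset_ba by (auto simp: radon_nikodym_measures_iff bvca_measures_def)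
  obtain mF where mF: "mF \<in> ca_pos \<Omega> S" "\<And>E. E \<in> S \<Longrightarrow> ennreal (norm (F E)) \<le> emeasure mF E"
    using F ex_variation_measure[of F] unfolding radon_nikodym_measures_iff by blast
  obtain mG where mG: "mG \<in> ca_pos \<Omega> S" "\<And>E. E \<in> S \<Longrightarrow> ennreal (norm (G E)) \<le> emeasure mG E"
    using G ex_variation_measure[of G] unfolding radon_nikodym_measures_iff by blast
  note fin = finite_measure.emeasure_finite[OF ca_posD(3)]
  have "\<exists>m\<in>ca_pos \<Omega> S. \<forall>E\<in>S. emeasure m E = emeasure mF E + emeasure mG E"
  proof (rule ex_finite_measure)
    show "countably_additive S (\<lambda>E. emeasure mF E + emeasure mG E)"
      using ca_posD(2)[OF mF(1)] ca_posD(2)[OF mG(1)]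
      by (intro countably_additiveI) (simp add: suminf_add[symmetric] suminf_emeasure)
    show "emeasure mF \<Omega> + emeasure mG \<Omega> < \<infinity>"
      using fin[OF mF(1), of \<Omega>] fin[OF mG(1), of \<Omega>] by (simp add: less_top)
  qed simp
  then obtain m where m: "m \<in> ca_pos \<Omega> S" "\<And>E. E \<in> S \<Longrightarrow> emeasure m E = emeasure mF E + emeasure mG E"
    by blast
  obtain N where N: "N \<in> null_sets M" "\<And>E. E \<in> null_sets M \<Longrightarrow> emeasure m (E - N) = 0"
    using ex_maximal_null_set[OF M m(1)] by blast
  have NS: "N \<in> S" using N(1) ca_posD(2)[OF M] by auto
  have "\<exists>M'\<in>ca_pos \<Omega> S. \<forall>E\<in>S. emeasure M' E = emeasure M E + emeasure m (E \<inter> N)"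
  proof (rule ex_finite_measure)
    show "countably_additive S (\<lambda>E. emeasure M E + emeasure m (E \<inter> N))"
    proof (rule countably_additiveI)
      fix A :: "nat \<Rightarrow> 'a set" assume A: "range A \<subseteq> S" "disjoint_family A"
      have "(\<Sum>i. emeasure m (A i \<inter> N)) = emeasure m (\<Union>i. A i \<inter> N)"
        using A NS ca_posD(2)[OF m(1)] by (intro suminf_emeasure) (auto simp: disjoint_family_on_def)
      moreover have "(\<Union>i. A i \<inter> N) = (\<Union>i. A i) \<inter> N" by blast
      ultimately show "(\<Sum>i. emeasure M (A i) + emeasure m (A i \<inter> N)) =
          emeasure M (\<Union>i. A i) + emeasure m ((\<Union>i. A i) \<inter> N)"
        using A ca_posD(2)[OF M] by (simp add: suminf_add[symmetric] suminf_emeasure)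
    qed
    show "emeasure M \<Omega> + emeasure m (\<Omega> \<inter> N) < \<infinity>"
      using fin[OF M, of \<Omega>] fin[OF m(1), of "\<Omega> \<inter> N"] by (simp add: less_top)
  qed simp
  then obtain M' where M': "M' \<in> ca_pos \<Omega> S"
      "\<And>E. E \<in> S \<Longrightarrow> emeasure M' E = emeasure M E + emeasure m (E \<inter> N)" by blast
  have sets: "sets M = S" "sets M' = S" "sets m = S" using M M'(1) m(1) by (auto simp: ca_posD)
  \<comment> \<open>Off \<open>N\<close> the variations vanish on \<open>M\<close>-null sets, and on \<open>N\<close> they are part of \<open>M'\<close>.\<close>
  have null_M': "emeasure mF E = 0 \<and> emeasure mG E = 0" if E: "E \<in> null_sets M'" for E
  proof -
    have ES: "E \<in> S" using E sets by auto
    have "emeasure M E = 0" "emeasure m (E \<inter> N) = 0"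
      using E M'(2)[OF ES] by (auto simp: null_sets_def)
    moreover from this have "E \<in> null_sets M" using ES sets by auto
    then have "emeasure m (E - N) = 0" by (rule N(2))
    moreover have "emeasure m E = emeasure m (E \<inter> N) + emeasure m (E - N)"
      using ES NS sets by (subst plus_emeasure) (auto intro!: arg_cong[of _ _ "emeasure m"])
    ultimately have "emeasure m E = 0" by simp
    then show ?thesis using m(2)[OF ES] by simp
  qed
  have "abs_cont F M'" unfolding abs_cont_def
  proof
    fix E assume E: "E \<in> null_sets M'"
    then have "ennreal (norm (F E)) \<le> 0" using mF(2)[of E] null_M'[OF E] sets by auto
    then show "F E = 0" by simp
  qed
  then obtain f where f: "gen_bochner_integrable M' f"
      "\<And>E. E \<in> S \<Longrightarrow> has_gen_bochner_integral M' (\<lambda>\<omega>. indicator E \<omega> *\<^sub>R f \<omega>) (F E)"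
    using F M'(1) by (auto simp: radon_nikodym_measures_iff has_density_def)
  have "abs_cont G M'" unfolding abs_cont_def
  proof
    fix E assume E: "E \<in> null_sets M'"
    then have "ennreal (norm (G E)) \<le> 0" using mG(2)[of E] null_M'[OF E] sets by auto
    then show "G E = 0" by simp
  qed
  then obtain g where g: "gen_bochner_integrable M' g"
      "\<And>E. E \<in> S \<Longrightarrow> has_gen_bochner_integral M' (\<lambda>\<omega>. indicator E \<omega> *\<^sub>R g \<omega>) (G E)"
    using G M'(1) by (auto simp: radon_nikodym_measures_iff has_density_def)
  obtain h where h: "h \<in> borel_measurable M'" "AE \<omega> in M'. h \<omega> = f \<omega> + g \<omega>"
    using f(1) g(1) gen_bochner_AE_sum unfolding gen_bochner_integrable_def by blast
  have agree: "emeasure M E = emeasure M' (E - N)" if "E \<in> sets M'" for E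
  proof -
    have "emeasure M' (E - N) = emeasure M (E - N) + emeasure m ((E - N) \<inter> N)"
      using that NS sets by (intro M'(2)) auto
    also have "(E - N) \<inter> N = {}" by blast
    finally have "emeasure M' (E - N) = emeasure M (E - N)" by simp
    also have "\<dots> = emeasure M E" using N(1) that sets by (intro emeasure_Diff_null_set) auto
    finally show ?thesis by simp
  qed
  have int: "has_gen_bochner_integral M (\<lambda>\<omega>. indicator (E - N) \<omega> *\<^sub>R h \<omega>) (F E + G E)" if E: "E \<in> S" for E
  proof -
    have EN: "E - N \<in> S" "E \<inter> N \<in> S" using E NS by auto
    have "AE \<omega> in M'. indicator (E - N) \<omega> *\<^sub>R h \<omega> =
        indicator (E - N) \<omega> *\<^sub>R f \<omega> + indicator (E - N) \<omega> *\<^sub>R g \<omega>"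
      using h(2) by eventually_elim (simp add: scaleR_add_right)
    moreover have "(\<lambda>\<omega>. indicator (E - N) \<omega> *\<^sub>R h \<omega>) \<in> borel_measurable M'"
      using h(1) EN(1) sets by (simp add: borel_measurable_indicator_scaleR)
    ultimately have int': "has_gen_bochner_integral M' (\<lambda>\<omega>. indicator (E - N) \<omega> *\<^sub>R h \<omega>) (F (E - N) + G (E - N))"
      by (intro has_gen_bochner_integral_add_AE[OF f(2)[OF EN(1)] g(2)[OF EN(1)]])
    have "has_gen_bochner_integral M (\<lambda>\<omega>. indicator (E - N) \<omega> *\<^sub>R h \<omega>) (F (E - N) + G (E - N))"
    proof (rule has_gen_bochner_integral_change_measure[OF _ _ agree ca_posD(3)[OF M'(1)] int'])
      show "indicator (E - N) \<omega> *\<^sub>R h \<omega> = 0" if "\<omega> \<in> N" for \<omega> using that by simp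
    qed (simp_all add: sets NS)
    moreover have "F (E - N) + G (E - N) = F E + G E"
    proof -
      have "E \<inter> N \<in> null_sets M" using N(1) E sets by (intro null_set_Int1) auto
      then have null: "F (E \<inter> N) + G (E \<inter> N) = 0" using ac unfolding abs_cont_def by blast
      have "(E - N) \<union> (E \<inter> N) = E" "(E - N) \<inter> (E \<inter> N) = {}" by blast+
      then have "F E = F (E - N) + F (E \<inter> N)" "G E = G (E - N) + G (E \<inter> N)"
        using ba_measuresD(2)[OF ba(1) EN] ba_measuresD(2)[OF ba(2) EN] by simp_all
      then have "F E + G E = (F (E - N) + G (E - N)) + (F (E \<inter> N) + G (E \<inter> N))"
        by (simp only: add.assoc add.left_commute)
      then show ?thesis using null by simp
    qed
    ultimately show ?thesis by simp
  qed
  let ?h = "\<lambda>\<omega>. indicator (\<Omega> - N) \<omega> *\<^sub>R h \<omega>"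
  have "gen_bochner_integrable M ?h"
    unfolding gen_bochner_integrable_def using int[OF A.top] by blast
  moreover have "has_gen_bochner_integral M (\<lambda>\<omega>. indicator E \<omega> *\<^sub>R ?h \<omega>) (F E + G E)" if E: "E \<in> S" for E
  proof -
    have "E \<subseteq> \<Omega>" using E A.sets_into_space by blast
    then have "(\<lambda>\<omega>. indicator E \<omega> *\<^sub>R ?h \<omega>) = (\<lambda>\<omega>. indicator (E - N) \<omega> *\<^sub>R h \<omega>)"
      by (auto simp: indicator_def fun_eq_iff)
    then show ?thesis using int[OF E] by simp
  qed
  ultimately show ?thesis unfolding has_density_def by blast
qed

lemma has_density_scale:
  assumes "has_density M F"
  shows "has_density M (\<lambda>E. smul c (F E))"
proof -
  have L: "bounded_linear (\<lambda>x. smul c x)"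
    by (rule bounded_linear_intro[where K = "norm c"])
      (auto simp: scale_right_distrib smul_scaleR norm_scale mult.commute)
  obtain f where f: "gen_bochner_integrable M f"
      "\<And>E. E \<in> S \<Longrightarrow> has_gen_bochner_integral M (\<lambda>\<omega>. indicator E \<omega> *\<^sub>R f \<omega>) (F E)"
    using assms unfolding has_density_def by blast
  have "gen_bochner_integrable M (\<lambda>\<omega>. smul c (f \<omega>))"
    using f(1) has_gen_bochner_integral_bounded_linear[OF L] unfolding gen_bochner_integrable_def by blast
  moreover have "has_gen_bochner_integral M (\<lambda>\<omega>. indicator E \<omega> *\<^sub>R smul c (f \<omega>)) (smul c (F E))" if "E \<in> S" for E
    using has_gen_bochner_integral_bounded_linear[OF L f(2)[OF that]] by (simp add: smul_scaleR)
  ultimately show ?thesis unfolding has_density_def by blast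
qed

lemma variation_add_le:
  fixes F G :: "'a set \<Rightarrow> 'x"
  shows "variation S (\<lambda>E. F E + G E) E \<le> variation S F E + variation S G E"
  unfolding variation_def[of S "\<lambda>E. F E + G E"]
proof (rule SUP_least)
  fix P assume P: "P \<in> {P. finite P \<and> P \<subseteq> S \<and> partition_on E P}"
  have "(\<Sum>A\<in>P. ennreal (norm (F A + G A))) \<le> (\<Sum>A\<in>P. ennreal (norm (F A)) + ennreal (norm (G A)))"
    by (intro sum_mono) (simp add: ennreal_plus[symmetric] ennreal_leI norm_triangle_ineq del: ennreal_plus)
  also have "\<dots> = (\<Sum>A\<in>P. ennreal (norm (F A))) + (\<Sum>A\<in>P. ennreal (norm (G A)))" by (rule sum.distrib)
  also have "\<dots> \<le> variation S F E + variation S G E"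
    unfolding variation_def using P by (intro add_mono SUP_upper)
  finally show "(\<Sum>A\<in>P. ennreal (norm (F A + G A))) \<le> variation S F E + variation S G E" .
qed

lemma variation_scale_le:
  fixes F :: "'a set \<Rightarrow> 'x"
  shows "variation S (\<lambda>E. smul c (F E)) E \<le> ennreal (norm c) * variation S F E"
  unfolding variation_def[of S "\<lambda>E. smul c (F E)"]
proof (rule SUP_least)
  fix P assume P: "P \<in> {P. finite P \<and> P \<subseteq> S \<and> partition_on E P}"
  have "(\<Sum>A\<in>P. ennreal (norm (smul c (F A)))) = ennreal (norm c) * (\<Sum>A\<in>P. ennreal (norm (F A)))"
    by (simp add: norm_scale ennreal_mult sum_distrib_left del: sum_ennreal)
  also have "\<dots> \<le> ennreal (norm c) * variation S F E"
    unfolding variation_def using P by (intro mult_left_mono SUP_upper) auto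
  finally show "(\<Sum>A\<in>P. ennreal (norm (smul c (F A)))) \<le> ennreal (norm c) * variation S F E" .
qed

text \<open>
  For the scalar \<open>0\<close>, absolute continuity of the product says nothing about \<open>F\<close>, so this case uses
  the zero measure directly.
\<close>

lemma fun_subspace_M1: "fun_subspace smul (radon_nikodym_measures \<Omega> S)"
proof -
  note ca = fun_subspaceD[OF fun_subspace_ca]
  have zero: "(\<lambda>E. 0 :: 'x) \<in> radon_nikodym_measures \<Omega> S"
  proof -
    have "variation S (\<lambda>E. 0 :: 'x) \<Omega> \<le> ennreal 0" by (rule variation_leI) simp
    then have "(\<lambda>E. 0 :: 'x) \<in> bvca_measures \<Omega> S" using ca(1) by (simp add: bvca_measures_def)
    moreover have "has_density M (\<lambda>E. 0 :: 'x)" for M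
    proof -
      have "Bochner_Integration.simple_bochner_integrable M (\<lambda>\<omega>. 0 :: 'x)"
        by (intro Bochner_Integration.simple_bochner_integrable.intros) auto
      moreover have "Bochner_Integration.simple_bochner_integral M (\<lambda>\<omega>. 0 :: 'x) = 0"
        by (simp add: simple_bochner_integral_def sum.neutral)
      ultimately have "has_gen_bochner_integral M (\<lambda>\<omega>. 0 :: 'x) 0"
        by (intro has_gen_bochner_integralI[where s = "\<lambda>i \<omega>. 0"]) simp_all
      then show ?thesis
        unfolding has_density_def gen_bochner_integrable_def by (intro exI[of _ "\<lambda>\<omega>. 0"]) auto
    qed
    ultimately show ?thesis by (simp add: radon_nikodym_measures_iff)
  qed
  have add: "(\<lambda>E. F E + G E) \<in> radon_nikodym_measures \<Omega> S"
    if F: "F \<in> radon_nikodym_measures \<Omega> S" and G: "G \<in> radon_nikodym_measures \<Omega> S" for F G :: "'a set \<Rightarrow> 'x"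
  proof -
    have "F \<in> ca_measures S" "G \<in> ca_measures S" "variation S F \<Omega> < \<infinity>" "variation S G \<Omega> < \<infinity>"
      using F G by (auto simp: radon_nikodym_measures_iff bvca_measures_def)
    then have "(\<lambda>E. F E + G E) \<in> bvca_measures \<Omega> S"
      using ca(2) variation_add_le[of F G \<Omega>] by (auto simp: bvca_measures_def intro: le_less_trans)
    then show ?thesis using radon_nikodym_add[OF F G] by (simp add: radon_nikodym_measures_iff)
  qed
  have scale: "(\<lambda>E. smul c (F E)) \<in> radon_nikodym_measures \<Omega> S"
    if F: "F \<in> radon_nikodym_measures \<Omega> S" for c and F :: "'a set \<Rightarrow> 'x"
  proof (cases "c = 0")
    case True
    then show ?thesis using zero by simp
  next
    case False
    have "F \<in> ca_measures S" "variation S F \<Omega> < \<infinity>"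
      using F by (auto simp: radon_nikodym_measures_iff bvca_measures_def)
    moreover from this have "ennreal (norm c) * variation S F \<Omega> < \<infinity>"
      by (simp add: ennreal_mult_less_top)
    ultimately have "(\<lambda>E. smul c (F E)) \<in> bvca_measures \<Omega> S"
      using ca(3) le_less_trans[OF variation_scale_le] by (auto simp: bvca_measures_def)
    moreover have "abs_cont F M" if "abs_cont (\<lambda>E. smul c (F E)) M" for M
      using that False by (auto simp: abs_cont_def)
    ultimately show ?thesis
      using F has_density_scale by (auto simp: radon_nikodym_measures_iff)
  qed
  show ?thesis unfolding fun_subspace_def using zero add scale by blast
qed

end


lemma has_gen_bochner_integral_compose:
  fixes U :: "'a \<Rightarrow> complex" and L :: "complex \<Rightarrow> 'x::real_normed_vector"
  assumes "bounded_linear L" "integrable M U"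
  shows "has_gen_bochner_integral M (\<lambda>\<omega>. L (U \<omega>)) (L (integral\<^sup>L M U))"
proof (rule has_gen_bochner_integral_bounded_linear[OF assms(1)])
  show "has_gen_bochner_integral M U (integral\<^sup>L M U)"
    unfolding has_gen_bochner_integral_eq by (rule has_bochner_integral_integrable[OF assms(2)])
qed

text \<open>
  The positive measure with mass \<open>\<parallel>c n\<parallel>\<close> at \<open>w n\<close> is absolutely continuous and has a density \<open>g\<close>.
  Multiplying \<open>g\<close> by the function with value \<open>sgn (c n)\<close> on \<open>D n\<close> turns the masses into the \<open>c n\<close>.
\<close>

lemma ex_density_point_masses:
  fixes c :: "nat \<Rightarrow> complex"
  assumes fin: "finite_measure M" and D: "\<And>n. D n \<in> sets M" "\<And>n m. w n \<in> D m \<longleftrightarrow> n = (m::nat)" "disjoint_family D"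
    and c: "summable (\<lambda>n. norm (c n))"
    and null: "\<And>E n. E \<in> null_sets M \<Longrightarrow> w n \<in> E \<Longrightarrow> c n = 0"
  shows "\<exists>U. integrable M U \<and> (\<forall>E\<in>sets M. integrable M (\<lambda>\<omega>. indicator E \<omega> *\<^sub>R U \<omega>) \<and>
    integral\<^sup>L M (\<lambda>\<omega>. indicator E \<omega> *\<^sub>R U \<omega>) = (\<Sum>n. indicator E (w n) *\<^sub>R c n))"
proof -
  interpret M: finite_measure M by (rule fin)
  have w: "w n \<in> space M" for n using D(1)[of n] D(2)[of n n] sets.sets_into_space by blast
  let ?Q = "density (count_space UNIV) (\<lambda>n. ennreal (norm (c n)))"
  let ?P = "distr ?Q M w"
  have w_meas: "w \<in> measurable ?Q M" using w by simp
  have Q: "emeasure ?Q A = (\<Sum>n. ennreal (norm (c n)) * indicator A n)" for A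
    by (simp add: emeasure_density nn_integral_count_space_nat)
  have "absolutely_continuous M ?P"
    unfolding absolutely_continuous_def
  proof
    fix E assume E: "E \<in> null_sets M"
    have "emeasure ?P E = emeasure ?Q (w -` E)"
      using E by (subst emeasure_distr[OF w_meas]) auto
    also have "\<dots> = 0"
    proof -
      have "ennreal (norm (c n)) * indicator (w -` E) n = 0" for n
        using null[OF E, of n] by (cases "w n \<in> E") auto
      then show ?thesis unfolding Q by (simp only: suminf_zero)
    qed
    finally show "E \<in> null_sets ?P" using null_setsD2[OF E] by (intro null_setsI) simp_all
  qed
  then obtain g where g: "g \<in> borel_measurable M" "density M g = ?P"
    using M.Radon_Nikodym[of ?P] by auto
  have "(\<integral>\<^sup>+\<omega>. g \<omega> \<partial>M) = emeasure (density M g) (space M)"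
    using g(1) by (simp add: emeasure_density cong: nn_integral_cong)
  also have "\<dots> = emeasure ?Q (w -` space M)"
    unfolding g(2) by (subst emeasure_distr[OF w_meas]) auto
  also have "\<dots> \<le> (\<Sum>n. ennreal (norm (c n)))"
    unfolding Q by (intro suminf_le) (auto simp: indicator_def)
  also have "\<dots> = ennreal (\<Sum>n. norm (c n))" using c by (intro suminf_ennreal2) auto
  finally have "(\<integral>\<^sup>+\<omega>. g \<omega> \<partial>M) \<noteq> \<infinity>" by (auto simp: top_unique)
  then have g_fin: "AE \<omega> in M. g \<omega> \<noteq> \<infinity>" using g(1) by (rule nn_integral_PInf_AE[rotated])
  let ?g = "\<lambda>\<omega>. enn2real (g \<omega>)"
  have g_meas: "?g \<in> borel_measurable M" using g(1) by simp
  have "density M (\<lambda>\<omega>. ennreal (?g \<omega>)) = density M g"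
    using g(1) g_fin by (intro density_cong) (auto elim!: eventually_mono simp: less_top)
  then have dens: "density M (\<lambda>\<omega>. ennreal (?g \<omega>)) = ?P" using g(2) by simp
  let ?k = "\<lambda>\<omega>. \<Sum>n. indicator (D n) \<omega> *\<^sub>R sgn (c n)"
  have k_meas: "?k \<in> borel_measurable M" using D(1) by (intro borel_measurable_suminf) auto
  have k_w: "?k (w n) = sgn (c n)" for n
  proof -
    have "?k (w n) = (\<Sum>m\<in>{n}. indicator (D m) (w n) *\<^sub>R sgn (c m))"
      by (rule suminf_finite) (auto simp: D(2) indicator_def)
    then show ?thesis by (simp add: D(2) indicator_def)
  qed
  have meas: "(\<lambda>\<omega>. indicator E \<omega> *\<^sub>R ?k \<omega>) \<in> borel_measurable M" if "E \<in> sets M" for E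
    using that k_meas by (intro borel_measurable_scaleR) auto
  have sum_c: "norm (c n) *\<^sub>R (indicator E (w n) *\<^sub>R sgn (c n)) = indicator E (w n) *\<^sub>R c n" for E n
    by (cases "c n = 0") (simp_all add: sgn_div_norm)
  have main: "integrable M (\<lambda>\<omega>. ?g \<omega> *\<^sub>R (indicator E \<omega> *\<^sub>R ?k \<omega>))"
    "integral\<^sup>L M (\<lambda>\<omega>. ?g \<omega> *\<^sub>R (indicator E \<omega> *\<^sub>R ?k \<omega>)) = (\<Sum>n. indicator E (w n) *\<^sub>R c n)" if E: "E \<in> sets M" for E
  proof -
    let ?u = "\<lambda>\<omega>. indicator E \<omega> *\<^sub>R ?k \<omega>"
    have sum: "summable (\<lambda>n. norm (indicator E (w n) *\<^sub>R c n))"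
      using c by (rule summable_comparison_test'[where N = 0]) (auto simp: indicator_def)
    have count: "integrable (count_space UNIV) (\<lambda>n. norm (c n) *\<^sub>R ?u (w n))"
      using sum unfolding integrable_count_space_nat_iff k_w sum_c .
    have int_Q: "integrable ?Q (\<lambda>n. ?u (w n))"
      using count by (subst integrable_density) auto
    have int_P: "integrable ?P ?u"
      using int_Q by (subst integrable_distr_eq[OF w_meas meas[OF E]])
    show "integrable M (\<lambda>\<omega>. ?g \<omega> *\<^sub>R ?u \<omega>)"
      using int_P unfolding dens[symmetric] by (subst (asm) integrable_density[OF meas[OF E] g_meas]) auto
    have "integral\<^sup>L M (\<lambda>\<omega>. ?g \<omega> *\<^sub>R ?u \<omega>) = integral\<^sup>L ?P ?u"
      unfolding dens[symmetric] by (rule integral_density[OF meas[OF E] g_meas, symmetric]) simp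
    also have "\<dots> = integral\<^sup>L ?Q (\<lambda>n. ?u (w n))"
      by (rule integral_distr[OF w_meas meas[OF E]])
    also have "\<dots> = integral\<^sup>L (count_space UNIV) (\<lambda>n. norm (c n) *\<^sub>R ?u (w n))"
      by (rule integral_density) auto
    also have "\<dots> = (\<Sum>n. norm (c n) *\<^sub>R ?u (w n))"
      using count by (rule integral_count_space_nat)
    finally show "integral\<^sup>L M (\<lambda>\<omega>. ?g \<omega> *\<^sub>R ?u \<omega>) = (\<Sum>n. indicator E (w n) *\<^sub>R c n)"
      unfolding k_w sum_c .
  qed
  let ?U = "\<lambda>\<omega>. ?g \<omega> *\<^sub>R ?k \<omega>"
  have eq: "(\<lambda>\<omega>. indicator E \<omega> *\<^sub>R ?U \<omega>) = (\<lambda>\<omega>. ?g \<omega> *\<^sub>R (indicator E \<omega> *\<^sub>R ?k \<omega>))" for E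
    by (simp add: mult.commute)
  have "integrable M (\<lambda>\<omega>. ?g \<omega> *\<^sub>R (indicator (space M) \<omega> *\<^sub>R ?k \<omega>))" by (rule main(1)) simp
  then have "integrable M ?U"
    by (rule Bochner_Integration.integrable_cong[THEN iffD1, rotated 2]) (auto simp: indicator_def)
  then show ?thesis
  proof (intro exI[of _ ?U] conjI ballI)
    fix E assume "E \<in> sets M"
    then show "integrable M (\<lambda>\<omega>. indicator E \<omega> *\<^sub>R ?U \<omega>)"
      "integral\<^sup>L M (\<lambda>\<omega>. indicator E \<omega> *\<^sub>R ?U \<omega>) = (\<Sum>n. indicator E (w n) *\<^sub>R c n)"
      unfolding eq by (rule main)+
  qed
qed

context vector_measures
begin

text \<open>
  A real linear map from the complex numbers onto the line through \<open>u\<close>. Along it, densities of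
  complex measures become densities of measures with values in the line.
\<close>

lemma ex_scalar_line: "\<exists>L :: complex \<Rightarrow> 'x. bounded_linear L \<and> (\<forall>z. L (to_complex z) = smul z u)"
proof -
  obtain i :: 'k where i: "norm i \<le> 1"
      "\<And>z. z = of_real (Re (to_complex z)) + of_real (Im (to_complex z)) * i"
    using scalar_parts by blast
  let ?L = "\<lambda>z. Re z *\<^sub>R u + Im z *\<^sub>R smul i u"
  have "bounded_linear ?L"
    by (intro bounded_linear_add bounded_linear_scaleR_left[THEN bounded_linear_compose]
        bounded_linear_Re bounded_linear_Im)
  moreover have "?L (to_complex z) = smul z u" for z
  proof -
    have "smul z u = smul (of_real (Re (to_complex z)) + of_real (Im (to_complex z)) * i) u"
      using i(2)[of z] by simp
    also have "\<dots> = ?L (to_complex z)"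
      by (simp only: scale_left_distrib scale_scale[symmetric] scale_of_real)
    finally show ?thesis by simp
  qed
  ultimately show ?thesis by blast
qed

lemma point_masses_l1_variation:
  assumes a: "a \<in> l1_seqs"
  shows "variation S (point_masses w (l1_mass u a)) \<Omega> \<le> ennreal (norm u * l1_norm a)"
proof (rule variation_leI)
  fix P assume P: "finite P" "P \<subseteq> S" "disjoint P"
  have s: "summable (\<lambda>n. norm (restrict_seq A a n))" for A
    using restrict_seq_l1[OF a] by (simp add: l1_seqs_def)
  have sa: "summable (\<lambda>n. norm (a n))" using a by (simp add: l1_seqs_def)
  have "(\<Sum>A\<in>P. norm (point_masses w (l1_mass u a) A)) \<le>
      (\<Sum>A\<in>P. norm u * (\<Sum>n. norm (restrict_seq {n. w n \<in> A} a n)))"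
  proof (rule sum_mono)
    fix A assume "A \<in> P"
    then have "norm (point_masses w (l1_mass u a) A) = norm u * norm (\<Sum>n. restrict_seq {n. w n \<in> A} a n)"
      using P(2) by (auto simp: point_masses_def l1_mass_def norm_scale mult.commute)
    also have "\<dots> \<le> norm u * (\<Sum>n. norm (restrict_seq {n. w n \<in> A} a n))"
      by (intro mult_left_mono summable_norm s) simp
    finally show "norm (point_masses w (l1_mass u a) A) \<le> norm u * (\<Sum>n. norm (restrict_seq {n. w n \<in> A} a n))" .
  qed
  also have "\<dots> = norm u * (\<Sum>n. \<Sum>A\<in>P. norm (restrict_seq {n. w n \<in> A} a n))"
    unfolding sum_distrib_left[symmetric] by (subst suminf_sum[OF s]) simp
  also have "\<dots> \<le> norm u * (\<Sum>n. norm (a n))"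
  proof (intro mult_left_mono suminf_le summable_sum s sa)
    fix n
    \<comment> \<open>At most one of the disjoint sets contains the point.\<close>
    show "(\<Sum>A\<in>P. norm (restrict_seq {n. w n \<in> A} a n)) \<le> norm (a n)"
    proof (cases "\<exists>B\<in>P. w n \<in> B")
      case True
      then obtain B where B: "B \<in> P" "w n \<in> B" by blast
      have "(\<Sum>A\<in>P. norm (restrict_seq {n. w n \<in> A} a n)) = (\<Sum>A\<in>{B}. norm (restrict_seq {n. w n \<in> A} a n))"
      proof (rule sum.mono_neutral_right)
        show "\<forall>A\<in>P - {B}. norm (restrict_seq {n. w n \<in> A} a n) = 0"
        proof
          fix A assume "A \<in> P - {B}"
          then have "w n \<notin> A" using B disjointD[OF P(3), of A B] by blast
          then show "norm (restrict_seq {n. w n \<in> A} a n) = 0" by (simp add: restrict_seq_def)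
        qed
      qed (use P(1) B in auto)
      then show ?thesis by (simp add: norm_restrict_seq_le)
    next
      case False
      then have "(\<Sum>A\<in>P. norm (restrict_seq {n. w n \<in> A} a n)) = 0"
        by (intro sum.neutral) (auto simp: restrict_seq_def)
      then show ?thesis by simp
    qed
  qed simp
  finally show "(\<Sum>A\<in>P. norm (point_masses w (l1_mass u a) A)) \<le> norm u * l1_norm a"
    by (simp add: l1_norm_def)
qed

text \<open>
  A null set \<open>E\<close> containing \<open>w n\<close> forces \<open>a n = 0\<close>: the value at the null set \<open>E \<inter> D n\<close> is
  \<open>smul (a n) u\<close>. So the scalar masses have a density.
\<close>

lemma point_masses_l1_M1:
  assumes D: "\<And>n. D n \<in> S" "disjoint_family D" "\<And>n m. w n \<in> D m \<longleftrightarrow> n = (m::nat)"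
    and u: "u \<noteq> 0" and a: "a \<in> l1_seqs"
  shows "point_masses w (l1_mass u a) \<in> radon_nikodym_measures \<Omega> S"
proof -
  let ?F = "point_masses w (l1_mass u a)"
  have "?F \<in> ca_measures S" using point_masses_l1_cca[OF a] cca_subset_ca by blast
  moreover have "variation S ?F \<Omega> < \<infinity>"
    using point_masses_l1_variation[OF a, of w u] le_less_trans by fastforce
  ultimately have bv: "?F \<in> bvca_measures \<Omega> S" by (simp add: bvca_measures_def)
  have "has_density M ?F" if M: "M \<in> ca_pos \<Omega> S" and ac: "abs_cont ?F M" for M
  proof -
    have sets: "sets M = S" using M by (rule ca_posD)
    let ?c = "\<lambda>n. to_complex (a n)"
    have null: "?c n = 0" if E: "E \<in> null_sets M" "w n \<in> E" for E n
    proof -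
      have En: "E \<inter> D n \<in> null_sets M" using E(1) D(1) sets by (intro null_set_Int2) auto
      have "{m. w m \<in> E \<inter> D n} = {n}" using D(3) E(2) by auto
      then have "?F (E \<inter> D n) = smul (\<Sum>m. restrict_seq {n} a m) u"
        using En sets by (auto simp: point_masses_def l1_mass_def)
      also have "(\<Sum>m. restrict_seq {n} a m) = (\<Sum>m\<in>{n}. restrict_seq {n} a m)"
        by (rule suminf_finite) (auto simp: restrict_seq_def)
      finally have "?F (E \<inter> D n) = smul (a n) u" by (simp add: restrict_seq_def)
      moreover have "?F (E \<inter> D n) = 0" using ac En by (simp add: abs_cont_def)
      ultimately show ?thesis using u by simp
    qed
    have "summable (\<lambda>n. norm (?c n))" using a by (simp add: l1_seqs_def)
    moreover have DM: "D n \<in> sets M" for n using D(1) sets by simp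
    ultimately have "\<exists>U. integrable M U \<and> (\<forall>E\<in>sets M. integrable M (\<lambda>\<omega>. indicator E \<omega> *\<^sub>R U \<omega>) \<and>
        integral\<^sup>L M (\<lambda>\<omega>. indicator E \<omega> *\<^sub>R U \<omega>) = (\<Sum>n. indicator E (w n) *\<^sub>R ?c n))"
      using null by (intro ex_density_point_masses[OF ca_posD(3)[OF M] DM D(3) D(2)])
    then obtain U where U': "integrable M U \<and> (\<forall>E\<in>S. integrable M (\<lambda>\<omega>. indicator E \<omega> *\<^sub>R U \<omega>) \<and>
        integral\<^sup>L M (\<lambda>\<omega>. indicator E \<omega> *\<^sub>R U \<omega>) = (\<Sum>n. indicator E (w n) *\<^sub>R ?c n))"
      unfolding sets ..
    then have U: "integrable M U" "\<And>E. E \<in> S \<Longrightarrow> integrable M (\<lambda>\<omega>. indicator E \<omega> *\<^sub>R U \<omega>)"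
        "\<And>E. E \<in> S \<Longrightarrow> integral\<^sup>L M (\<lambda>\<omega>. indicator E \<omega> *\<^sub>R U \<omega>) = (\<Sum>n. indicator E (w n) *\<^sub>R ?c n)"
      by simp_all
    obtain L :: "complex \<Rightarrow> 'x" where L: "bounded_linear L" "\<And>z. L (to_complex z) = smul z u"
      using ex_scalar_line by blast
    interpret L: bounded_linear L by (rule L)
    have "has_gen_bochner_integral M (\<lambda>\<omega>. indicator E \<omega> *\<^sub>R L (U \<omega>)) (?F E)" if E: "E \<in> S" for E
    proof -
      have lin: "bounded_linear (to_complex :: 'k \<Rightarrow> complex)"
        by (rule bounded_linear_intro[of _ 1]) (auto simp: linear_scale[OF linear_to_complex])
      have s: "summable (restrict_seq {n. w n \<in> E} a)"
        using restrict_seq_l1[OF a] by (simp add: l1_seqs_def summable_norm_cancel)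
      have "(\<Sum>n. indicator E (w n) *\<^sub>R ?c n) = (\<Sum>n. to_complex (restrict_seq {n. w n \<in> E} a n))"
        by (intro arg_cong[of _ _ suminf] ext) (simp add: restrict_seq_def)
      also have "\<dots> = to_complex (\<Sum>n. restrict_seq {n. w n \<in> E} a n)"
        using bounded_linear.suminf[OF lin s] by simp
      finally have "L (\<Sum>n. indicator E (w n) *\<^sub>R ?c n) = ?F E"
        using E by (simp add: L(2) point_masses_def l1_mass_def)
      then show ?thesis
        using has_gen_bochner_integral_compose[OF L(1) U(2)[OF E]] by (simp add: U(3)[OF E] L.scaleR)
    qed
    moreover have "gen_bochner_integrable M (\<lambda>\<omega>. L (U \<omega>))"
      unfolding gen_bochner_integrable_def using has_gen_bochner_integral_compose[OF L(1) U(1)] by blast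
    ultimately show ?thesis unfolding has_density_def by blast
  qed
  then show ?thesis using bv by (simp add: radon_nikodym_measures_iff)
qed

lemma quotient_operator_l1_M1:
  assumes "nontrivial_sigma_algebra S" "(x::'x) \<noteq> 0"
  shows "\<exists>T C. quotient_operator smul (*) (radon_nikodym_measures \<Omega> S)
    (\<lambda>F. enn2real (variation S F \<Omega>)) l1_seqs l1_norm T C"
proof -
  obtain D and w where D: "\<And>n. D n \<in> S" "disjoint_family D" "\<And>n m. w n \<in> D m \<longleftrightarrow> n = (m::nat)"
    using ex_separated_points[OF assms(1)] by metis
  obtain \<phi> u where \<phi>: "\<phi> \<in> dual_unit_ball smul" "\<phi> u = 1"
    using ex_functional_eq_1[OF assms(2)] by blast
  have u: "u \<noteq> 0" using \<phi> dual_unit_ballD(4)[OF \<phi>(1)] by auto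
  let ?N = "\<lambda>F :: 'a set \<Rightarrow> 'x. enn2real (variation S F \<Omega>)"
  have mass: "?N (point_masses w (l1_mass u a)) \<le> norm u * l1_norm a" if "a \<in> l1_seqs" for a
    using point_masses_l1_variation[OF that, of w u] l1_norm_nonneg[OF that] by (intro enn2real_leI) auto
  have bound: "(\<Sum>A\<in>P. norm (\<phi> (F A))) \<le> ?N F"
    if F: "F \<in> radon_nikodym_measures \<Omega> S" and P: "finite P" "P \<subseteq> S" "disjoint P" for F P
  proof -
    have F': "F \<in> ba_measures S" "variation S F \<Omega> < \<infinity>"
      using F ca_subset_ba by (auto simp: radon_nikodym_measures_iff bvca_measures_def)
    have "ennreal (\<Sum>A\<in>P. norm (\<phi> (F A))) \<le> ennreal (\<Sum>A\<in>P. norm (F A))"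
      by (intro ennreal_leI sum_mono dual_unit_ballD(3)[OF \<phi>(1)])
    also have "\<dots> \<le> variation S F \<Omega>"
      using P A.sets_into_space ba_measuresD(4)[OF F'(1)] by (intro sum_le_variation) auto
    finally have "enn2real (ennreal (\<Sum>A\<in>P. norm (\<phi> (F A)))) \<le> ?N F"
      using F'(2) by (intro enn2real_mono) auto
    then show ?thesis by (simp add: sum_nonneg)
  qed
  have "quotient_operator smul (*) (radon_nikodym_measures \<Omega> S) ?N l1_seqs l1_norm
      (\<lambda>F n. \<phi> (F (D n))) (norm u)"
    using D \<phi> fun_subspace_M1 _ bound point_masses_l1_M1[OF D u] mass
    by (rule quotient_operator_l1) simp
  then show ?thesis by blast
qed

end


section \<open>Quotients and complemented subspaces of measure spaces\<close>

theorem theorem39: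
  fixes smul :: "'k::real_or_complex \<Rightarrow> 'x::banach \<Rightarrow> 'x"
    and \<Omega> :: "'a set" and S :: "'a set set"
  assumes X: "banach_space_over smul"
    and S: "sigma_algebra \<Omega> S"
    and nontrivial: "nontrivial_sigma_algebra S"
  shows
    "((\<exists>x::'x. x \<noteq> 0) \<longrightarrow> has_separable_quotient (ba_space smul \<Omega> S)) \<and>
     (infinite_dimensional (type_nspace smul) \<longrightarrow>
       (contains_copy (type_nspace smul) c0_space \<longrightarrow>
          has_quotient_isomorphic_to (ba_space smul \<Omega> S) l2_space) \<and>
       (contains_copy (type_nspace smul) c0_space \<and>
        \<not> contains_copy (type_nspace smul) linf_space \<longrightarrow>
          contains_complemented_copy (ba_space smul \<Omega> S) c0_space) \<and>
       (\<not> (\<exists>P\<in>ca_pos \<Omega> S. prob_space P \<and> atomless P) \<longrightarrow>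
          has_quotient_isomorphic_to (ca_space smul \<Omega> S) l1_space) \<and>
       (contains_copy (type_nspace smul) c0_space \<and>
        (\<exists>M\<in>ca_pos \<Omega> S. emeasure M \<Omega> \<noteq> 0 \<and> atomless M) \<longrightarrow>
          has_quotient_isomorphic_to (ca_space smul \<Omega> S) l2_space) \<and>
       ((\<exists>F\<in>vcarrier (cca_space smul \<Omega> S). variation S F \<Omega> = \<infinity>) \<longrightarrow>
          has_separable_quotient (cca_space smul \<Omega> S)) \<and>
       (contains_copy (type_nspace smul) c0_space \<longrightarrow>
          contains_complemented_copy (cca_space smul \<Omega> S) c0_space) \<and>
       (contains_copy (type_nspace smul) l1_space \<longrightarrow>
          has_quotient_isomorphic_to (M1_space smul \<Omega> S) l1_space))"
proof -
  interpret vector_measures smul \<Omega> S using X S by (rule vector_measures.intro)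
  have M1: "M1_space smul \<Omega> S =
      fun_nspace smul (radon_nikodym_measures \<Omega> S) (\<lambda>F. enn2real (variation S F \<Omega>))"
    by (simp add: M1_space_def bvca_space_def)
  have cca_ba: "cca_measures S \<subseteq> (ba_measures S :: ('a set \<Rightarrow> 'x) set)"
    using cca_subset_ca ca_subset_ba by (rule order_trans)
  have l1: "has_quotient_isomorphic_to (fun_nspace smul V ba_norm) l1_space"
      "has_separable_quotient (fun_nspace smul V ba_norm)"
    if V: "(x::'x) \<noteq> 0" "cca_measures S \<subseteq> V" "V \<subseteq> ba_measures S" "fun_subspace smul V" for x V
  proof -
    obtain T C where "quotient_operator smul (*) V ba_norm l1_seqs l1_norm T C"
      using quotient_operator_l1_ba[OF nontrivial V] by blast
    then interpret quotient_operator smul "(*)" V ba_norm l1_seqs l1_norm T C .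
    show "has_quotient_isomorphic_to (fun_nspace smul V ba_norm) l1_space"
      unfolding sequence_spaces by (rule has_quotient_isomorphic_to_image)
    show "has_separable_quotient (fun_nspace smul V ba_norm)"
      using infinite_dimensional_l1 separable_l1 l1_norm_nonneg unfolding sequence_spaces
      by (rule has_separable_quotient_if_image)
  qed
  have nonzero: "\<exists>x::'x. x \<noteq> 0" if "infinite_dimensional (type_nspace smul)"
  proof (rule ccontr)
    assume "\<not> ?thesis"
    then have zero: "y = 0" for y :: 'x by blast
    have "y \<in> lin_span (type_nspace smul) {}" for y :: 'x
      unfolding zero[of y] by (simp add: lin_span_def linear_subspace_def type_nspace_def)
    then have "lin_span (type_nspace smul) {} = vcarrier (type_nspace smul)"
      by (simp add: type_nspace_def set_eq_iff)
    then show False using that unfolding infinite_dimensional_def by (metis empty_subsetI finite.emptyI)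
  qed
  have l2: "has_quotient_isomorphic_to (fun_nspace smul V ba_norm) l2_space"
    if "quotient_operator smul (*) V ba_norm l2_seqs l2_norm T C" for V T C
    unfolding sequence_spaces using that by (rule quotient_operator.has_quotient_isomorphic_to_image)
  show ?thesis
  proof (intro conjI impI)
    assume "\<exists>x::'x. x \<noteq> 0"
    then show "has_separable_quotient (ba_space smul \<Omega> S)"
      unfolding measure_spaces using l1(2) cca_ba fun_subspace_ba by blast
  next
    assume "infinite_dimensional (type_nspace smul)"
    then obtain x :: 'x where x: "x \<noteq> 0" using nonzero by blast
    {
      assume "contains_copy (type_nspace smul) (c0_space :: ('k, nat \<Rightarrow> 'k) nspace)"
      then obtain J \<psi> C where "vector_measures_c0 smul \<Omega> S J \<psi> C" using ex_vector_measures_c0 by blast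
      then interpret c0: vector_measures_c0 smul \<Omega> S J \<psi> C .
      show "has_quotient_isomorphic_to (ba_space smul \<Omega> S) l2_space"
        unfolding measure_spaces using c0.quotient_operator_l2_ba[OF nontrivial] l2 by blast
      show "contains_complemented_copy (cca_space smul \<Omega> S) c0_space"
        unfolding measure_spaces using cca_ba ca_disjoint_null cca_subset_ca
        by (intro c0.complemented_c0[OF nontrivial]) auto
    }
    {
      assume *: "contains_copy (type_nspace smul) (c0_space :: ('k, nat \<Rightarrow> 'k) nspace) \<and>
        \<not> contains_copy (type_nspace smul) (linf_space :: ('k, nat \<Rightarrow> 'k) nspace)"
      then obtain J \<psi> C where "vector_measures_c0 smul \<Omega> S J \<psi> C" using ex_vector_measures_c0 by blast
      then interpret c0: vector_measures_c0 smul \<Omega> S J \<psi> C .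
      show "contains_complemented_copy (ba_space smul \<Omega> S) c0_space"
        unfolding measure_spaces using cca_ba ba_disjoint_null *
        by (intro c0.complemented_c0[OF nontrivial]) auto
    }
    {
      assume *: "contains_copy (type_nspace smul) (c0_space :: ('k, nat \<Rightarrow> 'k) nspace) \<and>
        (\<exists>M\<in>ca_pos \<Omega> S. emeasure M \<Omega> \<noteq> 0 \<and> atomless M)"
      then obtain J \<psi> C where "vector_measures_c0 smul \<Omega> S J \<psi> C" using ex_vector_measures_c0 by blast
      then interpret c0: vector_measures_c0 smul \<Omega> S J \<psi> C .
      show "has_quotient_isomorphic_to (ca_space smul \<Omega> S) l2_space"
        unfolding measure_spaces using c0.quotient_operator_l2_ca * l2 by blast
    }
    show "has_quotient_isomorphic_to (ca_space smul \<Omega> S) l1_space"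
      unfolding measure_spaces using x cca_subset_ca ca_subset_ba fun_subspace_ca by (rule l1(1))
    show "has_separable_quotient (cca_space smul \<Omega> S)"
      unfolding measure_spaces using x order_refl cca_ba fun_subspace_cca by (rule l1(2))
    show "has_quotient_isomorphic_to (M1_space smul \<Omega> S) l1_space"
      unfolding M1 sequence_spaces using quotient_operator_l1_M1[OF nontrivial x]
        quotient_operator.has_quotient_isomorphic_to_image by blast
  qed
qed

end
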